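(* Let $\mathbb{K}$ be a field and let $K_n$ ($n\ge 2$) be a weighted oriented complete graph. Then $\operatorname{reg}(I(K_n)^{(k)})$ is eventually a linear function of $k$ (i.e. it agrees with a linear function of $k$ for all $k\gg 0$). Moreover, if $N^+_{K_n}(V^+)\ne V(K_n)$, then for all $k\gg 0$, $$\operatorname{reg}(I(K_n)^{(k)})=(\omega+1)(k-1)+\max_{(x_i,x_\ell)\in E(K_n),\ w(x_\ell)=\omega}\Big\{\sum_{x\in N^+_{K_n}(x_i)\cap N^+_{K_n}[x_\ell]}(w(x)-1)\Big\}+2,$$ where $\omega=\max\{w(x)\mid x\in V(K_n)\}$ and the maximum is taken over all edges $(x_i,x_\ell)\in E(K_n)$ with $w(x_\ell)=\omega$.
   Context: A weighted oriented graph is a triple $D=(V(D),E(D),w)$ with finite vertex set $V(D)=\{x_1,\dots,x_n\}$, a set $E(D)$ of directed edges (where $(u,v)$ is an edge from $u$ to $v$), without loops or parallel edges (at most one of $(u,v),(v,u)$ is in $E(D)$), and a weight function $w$ from $V(D)$ to the positive integers. A vertex is a source if no edge ends at it; by convention $w(v)=1$ whenever $v$ is a source. A weighted oriented complete graph $K_n$ is a weighted oriented graph on $\{x_1,\dots,x_n\}$ in which for each pair $i\ne j$ exactly one of $(x_i,x_j),(x_j,x_i)$ is an edge. $V^+=\{x: w(x)\ge 2\}$. $N^+_{K_n}(x)=\{y:(x,y)\in E(K_n)\}$, $N^+_{K_n}[x]=N^+_{K_n}(x)\cup\{x\}$, and $N^+_{K_n}(V^+)=\bigcup_{x\in V^+}N^+_{K_n}(x)$.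 The edge ideal is $I(K_n)=(x_ix_j^{w(x_j)}:(x_i,x_j)\in E(K_n))\subset R=\mathbb{K}[x_1,\dots,x_n]$. The $k$-th symbolic power of an ideal $I$ is $I^{(k)}=\bigcap_{P\in \operatorname{Ass}(R/I)}(I^kR_P\cap R)$. $\operatorname{reg}(I)=\max\{j-i : \beta_{i,j}(I)\ne 0\}$ is the Castelnuovo–Mumford regularity. *)

theory Defs
  imports
    Complex_Main
    "HOL-Library.Poly_Mapping"
    "Jordan_Normal_Form.Matrix_Kernel"
begin

text \<open>
  The vertex set of a graph is a finite type \<open>'v\<close>. The polynomial ring over the field
  \<open>'k\<close> with one variable per vertex is the type of finitely supported functions from
  exponent vectors to \<open>'k\<close>; its multiplication is the convolution of \<open>Poly_Mapping\<close>.
\<close>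

type_synonym ('v, 'k) poly_ring = "('v \<Rightarrow>\<^sub>0 nat) \<Rightarrow>\<^sub>0 'k"


section \<open>Weighted oriented graphs\<close>

definition is_source :: "('v \<times> 'v) set \<Rightarrow> 'v \<Rightarrow> bool" where
  "is_source E v \<longleftrightarrow> (\<forall>u. (u, v) \<notin> E)"

definition weighted_oriented_graph :: "('v::finite \<times> 'v) set \<Rightarrow> ('v \<Rightarrow> nat) \<Rightarrow> bool" where
  "weighted_oriented_graph E w \<longleftrightarrow>
     (\<forall>v. (v, v) \<notin> E) \<and>
     (\<forall>u v. \<not> ((u, v) \<in> E \<and> (v, u) \<in> E)) \<and>
     (\<forall>v. w v \<ge> 1) \<and>
     (\<forall>v. is_source E v \<longrightarrow> w v = 1)"

definition weighted_oriented_complete_graph ::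
  "('v::finite \<times> 'v) set \<Rightarrow> ('v \<Rightarrow> nat) \<Rightarrow> bool" where
  "weighted_oriented_complete_graph E w \<longleftrightarrow>
     weighted_oriented_graph E w \<and>
     (\<forall>u v. u \<noteq> v \<longrightarrow> ((u, v) \<in> E) \<noteq> ((v, u) \<in> E))"

definition V_plus :: "('v \<Rightarrow> nat) \<Rightarrow> 'v set" where
  "V_plus w = {x. w x \<ge> 2}"

definition out_nbhd :: "('v \<times> 'v) set \<Rightarrow> 'v \<Rightarrow> 'v set" where
  "out_nbhd E x = {y. (x, y) \<in> E}"

definition closed_out_nbhd :: "('v \<times> 'v) set \<Rightarrow> 'v \<Rightarrow> 'v set" where
  "closed_out_nbhd E x = insert x (out_nbhd E x)"

definition out_nbhd_set :: "('v \<times> 'v) set \<Rightarrow> 'v set \<Rightarrow> 'v set" where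
  "out_nbhd_set E A = (\<Union>x\<in>A. out_nbhd E x)"


section \<open>Ideals, associated primes and symbolic powers\<close>

text \<open>Ideals are the submodules of a commutative ring regarded as a module over itself.\<close>

definition is_ideal :: "'a::comm_ring_1 set \<Rightarrow> bool" where
  "is_ideal I \<longleftrightarrow> Modules.module.subspace (*) I"

definition ideal_gen :: "'a::comm_ring_1 set \<Rightarrow> 'a set" where
  "ideal_gen S = Modules.module.span (*) S"

lemma module_times: "Modules.module ((*) :: 'a::comm_ring_1 \<Rightarrow> 'a \<Rightarrow> 'a)"
  by standard (simp_all add: algebra_simps)

definition ideal_mult :: "'a::comm_ring_1 set \<Rightarrow> 'a set \<Rightarrow> 'a set" where
  "ideal_mult I J = ideal_gen {a * b | a b. a \<in> I \<and> b \<in> J}"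

fun ideal_power :: "'a::comm_ring_1 set \<Rightarrow> nat \<Rightarrow> 'a set" where
  "ideal_power I 0 = UNIV"
| "ideal_power I (Suc k) = ideal_mult I (ideal_power I k)"

definition is_prime_ideal :: "'a::comm_ring_1 set \<Rightarrow> bool" where
  "is_prime_ideal P \<longleftrightarrow>
     is_ideal P \<and> P \<noteq> UNIV \<and> (\<forall>a b. a * b \<in> P \<longrightarrow> a \<in> P \<or> b \<in> P)"

text \<open>
  \<open>Ass(R/I)\<close>: the prime ideals that are the annihilator of the class of some
  \<open>f\<close> in \<open>R/I\<close>.
\<close>

definition ass_primes :: "'a::comm_ring_1 set \<Rightarrow> 'a set set" where
  "ass_primes I = {P. is_prime_ideal P \<and> (\<exists>f. P = {g. g * f \<in> I})}"

text \<open>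
  \<open>J R\<^sub>P \<inter> R\<close>: the elements of \<open>J R\<^sub>P\<close> are the fractions \<open>a/s\<close> with \<open>a\<close> in \<open>J\<close> and
  \<open>s\<close> outside \<open>P\<close>, and \<open>f/1 = a/s\<close> holds in \<open>R\<^sub>P\<close> iff \<open>t (s f - a) = 0\<close> for some
  \<open>t\<close> outside \<open>P\<close>.
\<close>

definition local_contraction :: "'a::comm_ring_1 set \<Rightarrow> 'a set \<Rightarrow> 'a set" where
  "local_contraction P J =
     {f. \<exists>a s t. a \<in> J \<and> s \<notin> P \<and> t \<notin> P \<and> t * (s * f - a) = 0}"

lemma local_contraction_eq:
  assumes "is_prime_ideal P" and "is_ideal J"
  shows "local_contraction P J = {f. \<exists>s. s \<notin> P \<and> s * f \<in> J}"
proof (intro Set.set_eqI iffI)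
  fix f assume "f \<in> local_contraction P J"
  then obtain a s t where *: "a \<in> J" "s \<notin> P" "t \<notin> P" "t * (s * f - a) = 0"
    by (auto simp: local_contraction_def)
  have "(t * s) * f = t * a"
    using *(4) by (simp add: algebra_simps)
  moreover have "t * a \<in> J"
    using assms(2) *(1) Modules.module.subspace_scale[OF module_times] by (auto simp: is_ideal_def)
  moreover have "t * s \<notin> P"
    using assms(1) *(2,3) by (auto simp: is_prime_ideal_def)
  ultimately show "f \<in> {f. \<exists>s. s \<notin> P \<and> s * f \<in> J}"
    by auto
next
  fix f assume "f \<in> {f. \<exists>s. s \<notin> P \<and> s * f \<in> J}"
  then obtain s where "s \<notin> P" "s * f \<in> J" by auto
  moreover from this have "s * (s * f - s * f) = 0" by simp
  ultimately show "f \<in> local_contraction P J"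
    unfolding local_contraction_def by blast
qed

definition symbolic_power :: "'a::comm_ring_1 set \<Rightarrow> nat \<Rightarrow> 'a set" where
  "symbolic_power I k = (\<Inter>P\<in>ass_primes I. local_contraction P (ideal_power I k))"


section \<open>Edge ideals\<close>

definition Var :: "'v \<Rightarrow> ('v, 'k::field) poly_ring" where
  "Var v = Poly_Mapping.single (Poly_Mapping.single v 1) 1"

definition edge_ideal :: "('v \<times> 'v) set \<Rightarrow> ('v \<Rightarrow> nat) \<Rightarrow> ('v, 'k::field) poly_ring set" where
  "edge_ideal E w = ideal_gen {Var u * Var v ^ w v | u v. (u, v) \<in> E}"


section \<open>Minimal graded free resolutions and regularity\<close>

definition monom_degree :: "('v::finite \<Rightarrow>\<^sub>0 nat) \<Rightarrow> nat" where
  "monom_degree m = (\<Sum>v\<in>UNIV. Poly_Mapping.lookup m v)"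

text \<open>The zero polynomial is homogeneous of every degree, and only it is so of negative degree.\<close>

definition homogeneous :: "('v::finite, 'k::field) poly_ring \<Rightarrow> int \<Rightarrow> bool" where
  "homogeneous p d \<longleftrightarrow> (\<forall>m\<in>Poly_Mapping.keys p. int (monom_degree m) = d)"

definition irrelevant_ideal :: "('v, 'k::field) poly_ring set" where
  "irrelevant_ideal = ideal_gen (range Var)"

definition mat_image :: "'a::comm_ring_1 mat \<Rightarrow> 'a vec set" where
  "mat_image A = {A *\<^sub>v v | v. v \<in> carrier_vec (dim_col A)}"

text \<open>
  A resolution \<open>\<dots> \<rightarrow> F\<^sub>1 \<rightarrow> F\<^sub>0 \<rightarrow> I \<rightarrow> 0\<close> by finitely generated graded free modules is given by
  matrices \<open>A i\<close> and shifts \<open>d i b\<close>. Here \<open>F\<^sub>i\<close> is the direct sum of the \<open>R(- d i b)\<close> with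
  \<open>b < dim_col (A i)\<close>; the matrix \<open>A (Suc i)\<close> represents \<open>F\<^sub>i\<^sub>+\<^sub>1 \<rightarrow> F\<^sub>i\<close>, and the matrix \<open>A 0\<close>
  with one row represents \<open>F\<^sub>0 \<rightarrow> R\<close>, whose image is \<open>I\<close>. The maps have degree 0, so the
  \<open>(a, b)\<close> entry is homogeneous of degree (shift of column \<open>b\<close>) - (shift of row \<open>a\<close>).
  Minimality means that the image of \<open>F\<^sub>i\<^sub>+\<^sub>1\<close> lies in \<open>(x\<^sub>1, \<dots>, x\<^sub>n) F\<^sub>i\<close>.
\<close>

definition row_shift :: "(nat \<Rightarrow> nat \<Rightarrow> int) \<Rightarrow> nat \<Rightarrow> nat \<Rightarrow> int" where
  "row_shift d i a = (case i of 0 \<Rightarrow> 0 | Suc j \<Rightarrow> d j a)"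

definition graded_free_resolution ::
  "('v::finite, 'k::field) poly_ring set \<Rightarrow> (nat \<Rightarrow> nat \<Rightarrow> int) \<Rightarrow>
   (nat \<Rightarrow> ('v, 'k) poly_ring mat) \<Rightarrow> bool" where
  "graded_free_resolution I d A \<longleftrightarrow>
     dim_row (A 0) = 1 \<and>
     (\<forall>i. dim_row (A (Suc i)) = dim_col (A i)) \<and>
     (\<forall>i. \<forall>a<dim_row (A i). \<forall>b<dim_col (A i).
        homogeneous (A i $$ (a, b)) (d i b - row_shift d i a)) \<and>
     {v $ 0 | v. v \<in> mat_image (A 0)} = I \<and>
     (\<forall>i. mat_kernel (A i) = mat_image (A (Suc i)))"

definition minimal_graded_free_resolution ::
  "('v::finite, 'k::field) poly_ring set \<Rightarrow> (nat \<Rightarrow> nat \<Rightarrow> int) \<Rightarrow>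
   (nat \<Rightarrow> ('v, 'k) poly_ring mat) \<Rightarrow> bool" where
  "minimal_graded_free_resolution I d A \<longleftrightarrow>
     graded_free_resolution I d A \<and>
     (\<forall>i. \<forall>a<dim_row (A (Suc i)). \<forall>b<dim_col (A (Suc i)).
        A (Suc i) $$ (a, b) \<in> irrelevant_ideal)"

text \<open>
  The graded Betti number \<open>\<beta>\<^sub>i\<^sub>,\<^sub>j(I)\<close> is the number of summands \<open>R(-j)\<close> of \<open>F\<^sub>i\<close> in a minimal
  graded free resolution of the homogeneous ideal \<open>I\<close>. Such a resolution exists and is unique
  up to isomorphism, so the choice made here does not matter.
\<close>

definition betti :: "('v::finite, 'k::field) poly_ring set \<Rightarrow> nat \<Rightarrow> int \<Rightarrow> nat" where
  "betti I i j =
     (let (d, A) = (SOME (d, A). minimal_graded_free_resolution I d A)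
      in card {b. b < dim_col (A i) \<and> d i b = j})"

text \<open>
  For a nonzero homogeneous ideal the set below is nonempty, and it is finite by Hilbert's
  syzygy theorem.
\<close>

definition regularity :: "('v::finite, 'k::field) poly_ring set \<Rightarrow> int" where
  "regularity I = Max {j - int i | i j. betti I i j \<noteq> 0}"

end

theory Submission
  imports Defs "HOL-Library.Countable"
begin

text \<open>
  For a monomial ideal \<open>J\<close>, the snake lemma along a minimal resolution identifies the shifts of its
  \<open>i\<close>-th module with the degrees of the Koszul homology \<open>H\<^sub>i(J)\<close>. In multidegree \<open>a\<close> this is the
  homology of the complex of all squarefree \<open>A\<close> with \<open>x\<^bsup>a-A\<^esup>\<close> in \<open>J\<close>, and it vanishes if the complex
  is a cone. So the regularity of \<open>J\<close> is a maximum over a combinatorially defined set.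

  If \<open>N\<^sup>+(V\<^sup>+)\<close> is everything, the irrelevant ideal is associated and the symbolic powers are the
  ordinary powers. The pairs \<open>(a, k)\<close> with a given complex that is not a cone form finitely many
  translates of order ideals of exponent vectors of the generators (Dickson's lemma), and on an order
  ideal the maximum of a linear functional at level \<open>k\<close> is eventually linear in \<open>k\<close>.

  Otherwise the associated primes are generated by all variables but one \<open>x\<^sub>i\<close>, and \<open>x\<^sup>a\<close> lies in the
  \<open>k\<close>-th symbolic power iff \<open>\<Sum>j\<noteq>i. a j div W i j \<ge> k\<close> for all \<open>i\<close>, where \<open>W i j\<close> is the weight of \<open>j\<close>
  if \<open>(i, j)\<close> is an edge and 1 otherwise. The Koszul complex of the quotient is glued from one
  acyclic piece for each \<open>i\<close>, so only monomials violating two of these conditions matter, and their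
  largest degree is attained at an edge whose head has weight \<open>\<omega>\<close>.
\<close>

section \<open>Exponent vectors\<close>

text \<open>\<open>betti\<close> reads its numbers off an unspecified minimal resolution, so both
  existence and independence of the choice must be proved. Resolutions are built once, multigraded
  so that all entries are scalars times monomials; afterwards regularity only concerns the complexes
  \<open>kcx\<close>. Their homology vanishes above the number of variables, which keeps the maximum
  finite.

  The case split arises because the ideals of all variables but one are always associated; only the
  irrelevant ideal is in question, and it annihilates the monomial with exponents
  \<open>w v - 1\<close> once every vertex has an in-neighbour of weight at least 2.

  In the other case, let a monomial stay below level \<open>k\<close> at both ends of an edge
  \<open>(i, l)\<close> with \<open>w l\<close> = \<omega>. Its degree is bounded by counting level
  \<open>i\<close> with factor \<omega> and level \<open>l\<close> with factor 1; a rounding loss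
  \<open>w v - 1\<close> is unavoidable only at \<open>l\<close> and at common out-neighbours. This
  yields the slope \<omega> + 1 and the sum in the formula. The extremal monomial times all n
  variables carries homology in degree n - 2, whence the final 2.\<close>

abbreviation lookup :: "('a \<Rightarrow>\<^sub>0 'b::zero) \<Rightarrow> 'a \<Rightarrow> 'b"
  where "lookup \<equiv> Poly_Mapping.lookup"

abbreviation monomial :: "'a \<Rightarrow> 'b::zero \<Rightarrow> 'a \<Rightarrow>\<^sub>0 'b"
  where "monomial \<equiv> Poly_Mapping.single"

abbreviation keys :: "('a \<Rightarrow>\<^sub>0 'b::zero) \<Rightarrow> 'a set"
  where "keys \<equiv> Poly_Mapping.keys"

definition expo :: "('v::finite \<Rightarrow> nat) \<Rightarrow> ('v \<Rightarrow>\<^sub>0 nat)"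
  where "expo f = Abs_poly_mapping f"

lemma lookup_expo [simp]: "lookup (expo f) v = f v"
  by (simp add: expo_def)

definition dvds :: "('v \<Rightarrow>\<^sub>0 nat) \<Rightarrow> ('v \<Rightarrow>\<^sub>0 nat) \<Rightarrow> bool"
  where "dvds s t \<longleftrightarrow> (\<forall>v. lookup s v \<le> lookup t v)"

lemma dvds_refl [simp]: "dvds s s"
  by (simp add: dvds_def)

lemma dvds_trans: "dvds s t \<Longrightarrow> dvds t u \<Longrightarrow> dvds s u"
  unfolding dvds_def using le_trans by blast

lemma dvds_add [simp]: "dvds s (s + t)" "dvds s (t + s)"
  by (simp_all add: dvds_def lookup_add)

lemma dvds_zero [simp]: "dvds 0 t"
  by (simp add: dvds_def)

lemma dvds_imp_eq_add: "dvds s t \<Longrightarrow> t - s + s = t"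
  by (intro poly_mapping_eqI) (simp add: dvds_def lookup_add lookup_minus)

lemma dvds_antisym: "dvds s t \<Longrightarrow> dvds t s \<Longrightarrow> s = t"
  by (intro poly_mapping_eqI) (auto simp: dvds_def intro: antisym)

definition up_closed :: "('v \<Rightarrow>\<^sub>0 nat) set \<Rightarrow> bool"
  where "up_closed T \<longleftrightarrow> (\<forall>s t. s \<in> T \<longrightarrow> dvds s t \<longrightarrow> t \<in> T)"

lemma up_closedD: "up_closed T \<Longrightarrow> s \<in> T \<Longrightarrow> dvds s t \<Longrightarrow> t \<in> T"
  by (auto simp: up_closed_def)

definition ind :: "'v::finite set \<Rightarrow> ('v \<Rightarrow>\<^sub>0 nat)"
  where "ind A = expo (\<lambda>v. if v \<in> A then 1 else 0)"

lemma lookup_ind [simp]: "lookup (ind A) v = (if v \<in> A then 1 else 0)"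
  by (simp add: ind_def)

lemma ind_empty [simp]: "ind {} = 0"
  by (intro poly_mapping_eqI) simp

lemma ind_insert: "v \<notin> A \<Longrightarrow> ind (insert v A) = monomial v 1 + ind A"
  by (intro poly_mapping_eqI) (auto simp: lookup_add lookup_single when_def)

lemma monom_degree_add: "monom_degree (s + t) = monom_degree s + monom_degree t"
  by (simp add: monom_degree_def lookup_add sum.distrib)

lemma monom_degree_zero [simp]: "monom_degree 0 = 0"
  by (simp add: monom_degree_def)

lemma monom_degree_expo [simp]: "monom_degree (expo f) = sum f UNIV"
  by (simp add: monom_degree_def)

lemma monom_degree_ind [simp]: "monom_degree (ind A) = card A"
  by (simp add: ind_def sum.If_cases)

lemma monom_degree_single [simp]: "monom_degree (monomial v n) = n"
  by (simp add: monom_degree_def lookup_single when_def)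

lemma monom_degree_minus: "dvds s t \<Longrightarrow> monom_degree t = monom_degree (t - s) + monom_degree s"
  by (metis dvds_imp_eq_add monom_degree_add)

lemma monom_degree_eq_0_iff: "monom_degree s = 0 \<longleftrightarrow> s = 0"
  by (auto simp: monom_degree_def intro!: poly_mapping_eqI)

lemma finite_monom_degree_le: "finite {t :: 'v::finite \<Rightarrow>\<^sub>0 nat. monom_degree t \<le> d}"
proof (rule finite_subset)
  show "{t :: 'v \<Rightarrow>\<^sub>0 nat. monom_degree t \<le> d} \<subseteq> expo ` {f. range f \<subseteq> {..d}}"
  proof
    fix t :: "'v \<Rightarrow>\<^sub>0 nat" assume "t \<in> {t. monom_degree t \<le> d}"
    then have *: "(\<Sum>v\<in>UNIV. lookup t v) \<le> d" by (simp add: monom_degree_def)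
    have "lookup t v \<le> d" for v
      using member_le_sum[of v UNIV "lookup t"] * by simp
    moreover have "t = expo (lookup t)" by (intro poly_mapping_eqI) simp
    ultimately show "t \<in> expo ` {f. range f \<subseteq> {..d}}" by blast
  qed
  have "finite {f :: 'v \<Rightarrow> nat. range f \<subseteq> {..d}}"
    using finite_set_of_finite_funs[of "UNIV :: 'v set" "{..d}"]
    by (simp add: image_subset_iff)
  then show "finite (expo ` {f :: 'v \<Rightarrow> nat. range f \<subseteq> {..d}})" by simp
qed

lemma finite_monom_degree_eq: "finite {t :: 'v::finite \<Rightarrow>\<^sub>0 nat. int (monom_degree t) = d}"
  by (rule finite_subset[OF _ finite_monom_degree_le[of "nat d"]]) auto

lemma lookup_single_mult:
  fixes f :: "('v \<Rightarrow>\<^sub>0 nat) \<Rightarrow>\<^sub>0 'k::semiring_0"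
  shows "lookup (monomial s c * f) t = (if dvds s t then c * lookup f (t - s) else 0)"
proof -
  have "lookup (monomial s c * f) t = c * (\<Sum>q. lookup f q when t = s + q)"
    by (simp add: lookup_mult lookup_single when_mult)
  also have "(\<Sum>q. lookup f q when t = s + q) = (if dvds s t then lookup f (t - s) else 0)"
  proof (cases "dvds s t")
    case True
    then have "t = s + q \<longleftrightarrow> q = t - s" for q
      using dvds_imp_eq_add[OF True] by (metis add.commute add_diff_cancel_right')
    then show ?thesis using True by simp
  next
    case False
    then have "t \<noteq> s + q" for q by auto
    then show ?thesis using False by simp
  qed
  finally show ?thesis by simp
qed

lemma Var_eq: "Var v = monomial (monomial v 1) 1"
  by (simp add: Var_def)

lemma dvds_single_iff: "dvds (monomial v n) t \<longleftrightarrow> n \<le> lookup t v"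
  by (auto simp: dvds_def lookup_single when_def)

lemma lookup_Var_mult:
  "lookup (Var v * f) t = (if lookup t v > 0 then lookup f (t - monomial v 1) else 0)"
  by (auto simp: Var_eq lookup_single_mult dvds_single_iff)

section \<open>Koszul complexes\<close>

text \<open>The position sign of the exterior algebra; \<open>to_nat\<close> supplies an arbitrary
  linear order of the vertices.\<close>

definition ksgn :: "'v::finite \<Rightarrow> 'v set \<Rightarrow> 'a::comm_ring_1"
  where "ksgn v A = (- 1) ^ card {u \<in> A. to_nat u < to_nat v}"

lemma ksgn_square [simp]: "ksgn v A * ksgn v A = 1"
  by (simp add: ksgn_def flip: power_add mult_2)

lemma ksgn_insert:
  assumes "u \<notin> A"
  shows "ksgn v (insert u A) = (if to_nat u < to_nat v then - 1 else 1) * ksgn v A"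
proof -
  have "{w \<in> insert u A. to_nat w < to_nat v} =
      (if to_nat u < to_nat v then insert u {w \<in> A. to_nat w < to_nat v}
       else {w \<in> A. to_nat w < to_nat v})" by auto
  then show ?thesis using assms by (simp add: ksgn_def)
qed

lemma ksgn_swap:
  assumes "u \<notin> A" "v \<notin> A" "u \<noteq> v"
  shows "ksgn v A * ksgn u (insert v A) = - (ksgn u A * ksgn v (insert u A))"
proof -
  have "to_nat u \<noteq> to_nat v" using assms by simp
  then consider "to_nat u < to_nat v" | "to_nat v < to_nat u" by linarith
  then show ?thesis using assms by cases (simp_all add: ksgn_insert)
qed

text \<open>One formula for two complexes: \<open>X = Var\<close> gives the Koszul differential,
  \<open>X\<close> constantly 1 gives its scalar part in one multidegree, a simplicial boundary.
  Chains are coefficient functions, so the component at \<open>A\<close> collects from the sets with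
  one more element.\<close>

definition kdiff :: "('v::finite \<Rightarrow> 'a::comm_ring_1) \<Rightarrow> ('v set \<Rightarrow> 'a) \<Rightarrow> 'v set \<Rightarrow> 'a"
  where "kdiff X z A = (\<Sum>v\<in>-A. ksgn v A * X v * z (insert v A))"

abbreviation sdiff :: "('v::finite set \<Rightarrow> 'a::comm_ring_1) \<Rightarrow> 'v set \<Rightarrow> 'a"
  where "sdiff \<equiv> kdiff (\<lambda>_. 1)"

lemma kdiff_diff: "kdiff X (\<lambda>B. z B - y B) A = kdiff X z A - kdiff X y A"
  by (simp add: kdiff_def sum_subtractf algebra_simps)

lemma kdiff_zero [simp]: "kdiff X (\<lambda>B. 0) A = 0"
  by (simp add: kdiff_def)

lemma kdiff_cong:
  assumes "\<And>v. v \<notin> A \<Longrightarrow> z (insert v A) = y (insert v A)"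
  shows "kdiff X z A = kdiff X y A"
  unfolding kdiff_def using assms by (intro sum.cong) auto

lemma kdiff_kdiff [simp]: "kdiff X (kdiff X z) A = 0"
proof -
  define F where "F v u = ksgn v A * X v * (ksgn u (insert v A) * X u * z (insert u (insert v A)))"
    for v u
  have swap: "F v u = - F u v" if "v \<notin> A" "u \<notin> A" "u \<noteq> v" for u v
  proof -
    have "F v u = (ksgn v A * ksgn u (insert v A)) * (X v * X u * z (insert u (insert v A)))"
      by (simp add: F_def algebra_simps)
    also have "\<dots> = - (ksgn u A * ksgn v (insert u A)) * (X v * X u * z (insert u (insert v A)))"
      by (simp only: ksgn_swap[OF that(2,1,3)])
    also have "\<dots> = - F u v"
      by (simp add: F_def algebra_simps insert_commute)
    finally show ?thesis .
  qed
  let ?P = "{(v, u). v \<notin> A \<and> u \<notin> A \<and> to_nat v < to_nat u}"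
  let ?Q = "{(v, u). v \<notin> A \<and> u \<notin> A \<and> to_nat u < to_nat v}"
  have "kdiff X (kdiff X z) A = (\<Sum>v\<in>-A. \<Sum>u\<in>-insert v A. F v u)"
    by (simp add: kdiff_def F_def sum_distrib_left)
  also have "\<dots> = (\<Sum>(v,u)\<in>(SIGMA v:-A. - insert v A). F v u)"
    by (simp add: sum.Sigma)
  also have "(SIGMA v:-A. - insert v A) = ?P \<union> ?Q"
    by auto (metis linorder_neqE_nat injD inj_to_nat)
  also have "(\<Sum>(v,u)\<in>?P \<union> ?Q. F v u) = (\<Sum>(v,u)\<in>?P. F v u) + (\<Sum>(v,u)\<in>?Q. F v u)"
    by (rule sum.union_disjoint) auto
  also have "(\<Sum>(v,u)\<in>?Q. F v u) = (\<Sum>(v,u)\<in>?P. F u v)"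
    by (rule sum.reindex_bij_witness[of _ "\<lambda>(v,u). (u,v)" "\<lambda>(v,u). (u,v)"]) auto
  also have "(\<Sum>(v,u)\<in>?P. F v u) = (\<Sum>(v,u)\<in>?P. - F u v)"
    by (intro sum.cong) (auto intro!: swap)
  finally show ?thesis by (simp add: sum_negf split_def)
qed

text \<open>The squarefree part of a Koszul complex in one multidegree: chains are scalar functions
  on the members of cardinality \<open>p\<close> of a set family.\<close>

definition kchain :: "'v set set \<Rightarrow> nat \<Rightarrow> ('v set \<Rightarrow> 'k::zero) \<Rightarrow> bool"
  where "kchain D p c \<longleftrightarrow> (\<forall>A. c A \<noteq> 0 \<longrightarrow> A \<in> D \<and> card A = p)"

text \<open>For a family closed under subsets this is nonvanishing of reduced simplicial homology in
  dimension \<open>p - 1\<close>, since faces are counted by cardinality and the empty face is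
  included. The type argument only carries the coefficient field.\<close>

definition khom :: "'k::field itself \<Rightarrow> 'v::finite set set \<Rightarrow> nat \<Rightarrow> bool"
  where "khom _ D p \<longleftrightarrow> (\<exists>c :: 'v set \<Rightarrow> 'k. kchain D p c \<and> (\<forall>A. sdiff c A = 0) \<and>
    \<not> (\<exists>e. kchain D (Suc p) e \<and> (\<forall>A. sdiff e A = c A)))"

definition kcone :: "'v \<Rightarrow> ('v::finite set \<Rightarrow> 'k::comm_ring_1) \<Rightarrow> 'v set \<Rightarrow> 'k"
  where "kcone v c A = (if v \<in> A then ksgn v (A - {v}) * c (A - {v}) else 0)"

text \<open>The homotopy identity for coning with apex \<open>v\<close>, evaluated at a single set.
  The cycle condition is local, at \<open>A - {v}\<close> only, because it is later applied to
  chains that are not cycles.\<close>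

lemma kdiff_kcone:
  assumes cyc: "v \<in> A \<Longrightarrow> sdiff c (A - {v}) = 0"
  shows "sdiff (kcone v c) A = c A"
proof (cases "v \<in> A")
  case False
  have "sdiff (kcone v c) A = (\<Sum>u\<in>{v}. ksgn u A * kcone v c (insert u A))"
    unfolding kdiff_def using False
    by (intro sum.mono_neutral_cong_right) (auto simp: kcone_def)
  also have "\<dots> = c A" using False by (simp add: kcone_def mult.assoc[symmetric])
  finally show ?thesis .
next
  case True
  define B where "B = A - {v}"
  have A: "A = insert v B" "v \<notin> B" using True by (auto simp: B_def)
  have "sdiff c B = (\<Sum>u\<in>insert v (-A). ksgn u B * c (insert u B))"
    unfolding kdiff_def using A by (intro sum.cong) auto
  then have 0: "ksgn v B * c A + (\<Sum>u\<in>-A. ksgn u B * c (insert u B)) = 0"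
    using cyc[OF True] A by (simp add: B_def[symmetric])
  have "sdiff (kcone v c) A = (\<Sum>u\<in>-A. ksgn u A * (ksgn v (insert u B) * c (insert u B)))"
    unfolding kdiff_def kcone_def
  proof (intro sum.cong refl)
    fix u assume "u \<in> - A"
    then have "insert u A - {v} = insert u B" "v \<in> insert u A" using A by auto
    then show "ksgn u A * 1 * (if v \<in> insert u A then ksgn v (insert u A - {v}) * c (insert u A - {v})
                 else 0) = ksgn u A * (ksgn v (insert u B) * c (insert u B))" by simp
  qed
  also have "\<dots> = (\<Sum>u\<in>-A. - (ksgn v B * (ksgn u B * c (insert u B))))"
  proof (intro sum.cong refl)
    fix u assume u: "u \<in> - A"
    have "ksgn v B * ksgn u A = - (ksgn u B * ksgn v (insert u B) :: 'b)"
      using ksgn_swap[of u B v] A u by simp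
    \<comment> \<open>Signs are cancelled by inserting their squares, as the coefficient ring has no
      division.\<close>
    moreover have "ksgn v B * ksgn u B = (ksgn v B * (ksgn u A * ksgn u A)) * (ksgn u B :: 'b)"
      by (simp only: ksgn_square mult_1_right)
    ultimately have "ksgn v B * ksgn u B = - (ksgn u B * ksgn u B) * (ksgn u A * ksgn v (insert u B) :: 'b)"
      by (simp only: mult_ac minus_mult_left[symmetric] minus_mult_right[symmetric] mult_minus_left mult_minus_right)
    then have "ksgn v B * ksgn u B = - (ksgn u A * ksgn v (insert u B) :: 'b)"
      by (simp only: ksgn_square mult_1_left mult_minus1)
    then show "ksgn u A * (ksgn v (insert u B) * c (insert u B)) = - (ksgn v B * (ksgn u B * c (insert u B)))"
      by (simp only: mult.assoc[symmetric] mult_minus_left minus_minus)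
  qed
  also have "\<dots> = - (ksgn v B * (\<Sum>u\<in>-A. ksgn u B * c (insert u B)))"
    by (simp add: sum_negf sum_distrib_left)
  also have "\<dots> = ksgn v B * (ksgn v B * c A)"
    using 0 by (simp add: eq_neg_iff_add_eq_0[symmetric])
  also have "\<dots> = c A" by (simp add: mult.assoc[symmetric])
  finally show ?thesis .
qed

lemma card_kcone_Suc: "v \<in> A \<Longrightarrow> card (A - {v}) = p \<Longrightarrow> card A = Suc p" for A :: "'v::finite set"
  by (metis card_Suc_Diff1 finite)

lemma not_khom_cone:
  assumes "\<And>A. A \<in> D \<Longrightarrow> insert v A \<in> D"
  shows "\<not> khom TYPE('k::field) D p"
proof
  assume "khom TYPE('k) D p"
  then obtain c :: "'a set \<Rightarrow> 'k" where c: "kchain D p c" "\<forall>A. sdiff c A = 0"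
    "\<not> (\<exists>e. kchain D (Suc p) e \<and> (\<forall>A. sdiff e A = c A))"
    unfolding khom_def by blast
  have "kchain D (Suc p) (kcone v c)"
    unfolding kchain_def
  proof (intro allI impI)
    fix A assume "kcone v c A \<noteq> 0"
    then have vA: "v \<in> A" and "c (A - {v}) \<noteq> 0" by (auto simp: kcone_def split: if_splits)
    then have "A - {v} \<in> D" "card (A - {v}) = p" using c(1) by (auto simp: kchain_def)
    then show "A \<in> D \<and> card A = Suc p"
      using assms[of "A - {v}"] insert_Diff[OF vA] card_kcone_Suc[OF vA] by metis
  qed
  moreover have "\<forall>A. sdiff (kcone v c) A = c A"
    using c(2) kdiff_kcone by blast
  ultimately show False using c(3) by blast
qed

text \<open>This takes the place of Hilbert's syzygy theorem: it bounds the homological degrees that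
  can contribute to the regularity.\<close>

lemma khom_card_le: "khom TYPE('k::field) (D :: 'v::finite set set) p \<Longrightarrow> p \<le> card (UNIV :: 'v set)"
proof (rule ccontr)
  assume h: "khom TYPE('k) D p" and "\<not> p \<le> card (UNIV :: 'v set)"
  then have "card A \<noteq> p" for A :: "'v set" using card_mono[of UNIV A] by auto
  then have z: "kchain D p c \<Longrightarrow> c = (\<lambda>_. 0)" for c :: "'v set \<Rightarrow> 'k" by (auto simp: kchain_def)
  obtain c :: "'v set \<Rightarrow> 'k" where "kchain D p c"
    "\<not> (\<exists>e. kchain D (Suc p) e \<and> (\<forall>A. sdiff e A = c A))"
    using h unfolding khom_def by blast
  moreover have "kchain D (Suc p) (\<lambda>_. 0 :: 'k)" by (simp add: kchain_def)
  ultimately show False using z[of c] by force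
qed

lemma khom_singleton_empty: "khom TYPE('k::field) {{} :: 'v::finite set} 0"
  unfolding khom_def
proof (intro exI conjI)
  let ?c = "\<lambda>A :: 'v set. if A = {} then 1 else 0 :: 'k"
  show "kchain {{}} 0 ?c" by (simp add: kchain_def)
  show "\<forall>A. sdiff ?c A = 0" by (simp add: kdiff_def)
  show "\<not> (\<exists>e. kchain {{}} (Suc 0) e \<and> (\<forall>A. sdiff e A = ?c A))"
  proof
    assume "\<exists>e. kchain {{}} (Suc 0) e \<and> (\<forall>A. sdiff e A = ?c A)"
    then obtain e :: "'v set \<Rightarrow> 'k" where e: "kchain {{}} (Suc 0) e"
      "\<forall>A. sdiff e A = ?c A" by blast
    have "e A = 0" for A using e(1) by (cases "A = {}") (auto simp: kchain_def)
    then have "e = (\<lambda>_. 0)" by auto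
    then have "sdiff e {} = 0" by simp
    then show False using e(2)[rule_format, of "{}"] by simp
  qed
qed

section \<open>Homogeneous polynomials and monomial ideals\<close>

definition mon :: "('v \<Rightarrow>\<^sub>0 nat) set \<Rightarrow> ('v, 'k::field) poly_ring set"
  where "mon T = {f. keys f \<subseteq> T}"

lemma mon_iff: "f \<in> mon T \<longleftrightarrow> (\<forall>t. lookup f t \<noteq> 0 \<longrightarrow> t \<in> T)"
  by (auto simp: mon_def in_keys_iff)

lemma poly_eq_sum_monomials:
  "f = (\<Sum>t\<in>keys f. monomial t (lookup f t))"
  by (intro poly_mapping_eqI)
    (auto simp: lookup_sum lookup_single when_def in_keys_iff sum.delta' if_distrib cong: if_cong)

lemma homogeneous_iff: "homogeneous p d \<longleftrightarrow> (\<forall>t. lookup p t \<noteq> 0 \<longrightarrow> int (monom_degree t) = d)"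
  by (auto simp: homogeneous_def in_keys_iff)

lemma homogeneous_zero [simp]: "homogeneous 0 d"
  by (simp add: homogeneous_iff)

lemma homogeneous_diff: "homogeneous p d \<Longrightarrow> homogeneous q d \<Longrightarrow> homogeneous (p - q) d"
  unfolding homogeneous_iff lookup_minus by (metis diff_self)

lemma homogeneous_add: "homogeneous p d \<Longrightarrow> homogeneous q d \<Longrightarrow> homogeneous (p + q) d"
  unfolding homogeneous_iff lookup_add by (metis add.left_neutral)

lemma homogeneous_sum: "(\<And>i. i \<in> I \<Longrightarrow> homogeneous (p i) d) \<Longrightarrow> homogeneous (sum p I) d"
  by (induction I rule: infinite_finite_induct) (auto intro: homogeneous_add)

lemma homogeneous_mult:
  assumes "homogeneous p d" "homogeneous q e"
  shows "homogeneous (p * q) (d + e)"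
  unfolding homogeneous_def
proof
  fix t assume "t \<in> keys (p * q)"
  then obtain a b where "t = a + b" "a \<in> keys p" "b \<in> keys q"
    using keys_mult[of p q] by blast
  then show "int (monom_degree t) = d + e"
    using assms by (auto simp: homogeneous_def monom_degree_add)
qed

lemma homogeneous_Var: "homogeneous (Var v) 1"
  by (simp add: homogeneous_def Var_eq)

lemma lookup_ksgn_mult:
  "lookup (ksgn v A * (f :: ('v::finite, 'k::field) poly_ring)) t = ksgn v A * lookup f t"
  by (cases "even (card {u \<in> A. to_nat u < to_nat v})") (simp_all add: ksgn_def)

lemma homogeneous_ksgn_mult:
  "homogeneous f d \<Longrightarrow> homogeneous (ksgn v A * f) d"
  by (simp add: homogeneous_iff lookup_ksgn_mult)

lemma homogeneous_kdiff:
  assumes "\<And>v. v \<notin> A \<Longrightarrow> homogeneous (z (insert v A)) (d - 1)"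
  shows "homogeneous (kdiff Var z A) d"
  unfolding kdiff_def
proof (rule homogeneous_sum)
  fix v assume "v \<in> - A"
  then have "homogeneous (Var v * z (insert v A)) (1 + (d - 1))"
    using assms by (intro homogeneous_mult homogeneous_Var) auto
  then show "homogeneous (ksgn v A * Var v * z (insert v A)) d"
    by (simp add: mult.assoc homogeneous_ksgn_mult)
qed

definition hcomp :: "int \<Rightarrow> ('v::finite, 'k::field) poly_ring \<Rightarrow> ('v, 'k) poly_ring"
  where "hcomp d f = Abs_poly_mapping (\<lambda>t. if int (monom_degree t) = d then lookup f t else 0)"

lemma lookup_Abs_homogeneous:
  fixes f :: "('v::finite \<Rightarrow>\<^sub>0 nat) \<Rightarrow> 'k::zero"
  assumes "\<And>t. f t \<noteq> 0 \<Longrightarrow> int (monom_degree t) = d"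
  shows "lookup (Abs_poly_mapping f) = f"
proof (rule lookup_Abs_poly_mapping)
  show "finite {x. f x \<noteq> 0}"
    by (rule finite_subset[OF _ finite_monom_degree_eq[of d]]) (use assms in auto)
qed

lemma lookup_hcomp: "lookup (hcomp d f) t = (if int (monom_degree t) = d then lookup f t else 0)"
  unfolding hcomp_def by (subst lookup_Abs_homogeneous[where d = d]) (auto split: if_splits)

lemma homogeneous_hcomp: "homogeneous (hcomp d f) d"
  by (simp add: homogeneous_iff lookup_hcomp)

lemma hcomp_sum: "hcomp d (sum f I) = (\<Sum>i\<in>I. hcomp d (f i))"
  by (intro poly_mapping_eqI) (simp add: lookup_hcomp lookup_sum)

lemma hcomp_id: "homogeneous f d \<Longrightarrow> hcomp d f = f"
  by (intro poly_mapping_eqI) (auto simp: lookup_hcomp homogeneous_iff)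

lemma hcomp_mult:
  assumes "homogeneous g e"
  shows "hcomp d (g * f) = g * hcomp (d - e) f"
proof -
  have 1: "hcomp d (monomial s c * f) = monomial s c * hcomp (d - int (monom_degree s)) f" for s c
    by (intro poly_mapping_eqI) (auto simp: lookup_hcomp lookup_single_mult monom_degree_minus)
  have "hcomp d (g * f) = hcomp d (\<Sum>t\<in>keys g. monomial t (lookup g t) * f)"
    by (subst poly_eq_sum_monomials[of g]) (simp add: sum_distrib_right)
  also have "\<dots> = (\<Sum>t\<in>keys g. monomial t (lookup g t) * hcomp (d - e) f)"
    using assms by (simp add: hcomp_sum 1 homogeneous_def)
  also have "\<dots> = g * hcomp (d - e) f"
    by (subst (3) poly_eq_sum_monomials[of g]) (simp add: sum_distrib_right)
  finally show ?thesis .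
qed

lemma lookup_mult_zero:
  "lookup (f * g) 0 = lookup f 0 * lookup (g :: ('v, 'k::field) poly_ring) 0"
proof -
  have "dvds t 0 \<longleftrightarrow> t = 0" for t :: "'v \<Rightarrow>\<^sub>0 nat"
    using dvds_antisym[of t 0] by auto
  moreover have "lookup (f * g) 0 = (\<Sum>t\<in>keys f. lookup (monomial t (lookup f t) * g) 0)"
    by (subst poly_eq_sum_monomials[of f]) (simp add: sum_distrib_right lookup_sum)
  ultimately show ?thesis
    by (auto simp: lookup_single_mult in_keys_iff if_distrib split: if_splits cong: if_cong)
qed

lemma poly_eq_sum_Var:
  fixes f :: "('v::finite, 'k::field) poly_ring"
  assumes "lookup f 0 = 0"
  shows "\<exists>g. f = (\<Sum>v\<in>UNIV. Var v * g v)"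
proof -
  define V where "V t = (SOME v. lookup t v > 0)" for t :: "'v \<Rightarrow>\<^sub>0 nat"
  have V: "lookup t (V t) > 0" if "t \<in> keys f" for t
  proof -
    have "t \<noteq> 0" using that assms by (auto simp: in_keys_iff)
    then have "\<exists>v. lookup t v > 0" by (metis gr0I lookup_zero poly_mapping_eqI)
    then show ?thesis unfolding V_def by (rule someI_ex)
  qed
  define g where "g v = (\<Sum>t\<in>{t \<in> keys f. V t = v}. monomial (t - monomial v 1) (lookup f t))" for v
  have "(\<Sum>v\<in>UNIV. Var v * g v) =
      (\<Sum>v\<in>UNIV. \<Sum>t\<in>{t \<in> keys f. V t = v}. monomial t (lookup f t))"
  proof (intro sum.cong refl)
    fix v
    have "monomial v 1 + (t - monomial v 1) = t" if "t \<in> keys f" "V t = v" for t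
      using dvds_imp_eq_add[of "monomial v 1" t] V[OF that(1)] that(2)
      by (simp add: add.commute dvds_single_iff)
    then show "Var v * g v = (\<Sum>t\<in>{t \<in> keys f. V t = v}. monomial t (lookup f t))"
      unfolding g_def by (simp add: Var_eq sum_distrib_left mult_single)
  qed
  also have "\<dots> = (\<Sum>t\<in>keys f. monomial t (lookup f t))"
    by (rule sum.group) auto
  finally show ?thesis using poly_eq_sum_monomials[of f] by metis
qed

lemma irrelevant_ideal_iff:
  "f \<in> irrelevant_ideal \<longleftrightarrow> lookup (f :: ('v::finite, 'k::field) poly_ring) 0 = 0"
proof
  interpret module "(*) :: ('v, 'k) poly_ring \<Rightarrow> _" by (rule module_times)
  show "lookup f 0 = 0" if "f \<in> irrelevant_ideal"
    using that unfolding irrelevant_ideal_def ideal_gen_def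
  proof (induction rule: span_induct_alt)
    case (step c x y)
    then obtain v where "x = Var v" by auto
    moreover have "lookup (Var v :: ('v, 'k) poly_ring) 0 = 0"
      by (simp add: Var_eq lookup_single when_def) (metis lookup_single_eq lookup_zero nat.simps(3))
    ultimately show ?case using step by (simp add: lookup_add lookup_mult_zero)
  qed simp
  show "f \<in> irrelevant_ideal" if "lookup f 0 = 0"
  proof -
    from poly_eq_sum_Var[OF that] obtain g where "f = (\<Sum>v\<in>UNIV. Var v * g v)" ..
    also have "\<dots> = (\<Sum>v\<in>UNIV. g v * Var v)" by (simp add: mult.commute)
    also have "\<dots> \<in> span (range Var)"
      by (intro span_sum span_scale span_base) auto
    finally show ?thesis by (simp add: irrelevant_ideal_def ideal_gen_def)
  qed
qed

section \<open>Koszul homology of monomial ideals by multidegree\<close>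

text \<open>The basis element of \<open>A\<close> has multidegree \<open>ind A\<close>, so the part
  of \<open>z\<close> in multidegree \<open>a\<close> has at \<open>A\<close> the coefficient of the
  monomial with exponent \<open>a - ind A\<close>. The guard is needed because subtraction of
  exponents is truncated.\<close>

definition kcoef :: "('v::finite set \<Rightarrow> ('v, 'k::field) poly_ring) \<Rightarrow> ('v \<Rightarrow>\<^sub>0 nat) \<Rightarrow> 'v set \<Rightarrow> 'k"
  where "kcoef z a A = (if dvds (ind A) a then lookup (z A) (a - ind A) else 0)"

lemma dvds_ind_insert:
  "v \<notin> A \<Longrightarrow> dvds (ind (insert v A)) a \<longleftrightarrow> dvds (ind A) a \<and> lookup a v > 0"
  by (auto simp: dvds_def Suc_le_eq split: if_splits)

lemma kcoef_kdiff: "kcoef (kdiff Var z) a A = sdiff (kcoef z a) A"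
proof (cases "dvds (ind A) a")
  case False
  then show ?thesis
    by (auto simp: kcoef_def kdiff_def dvds_ind_insert)
next
  case True
  have "kcoef (kdiff Var z) a A = (\<Sum>v\<in>-A. lookup (ksgn v A * (Var v * z (insert v A))) (a - ind A))"
    using True by (simp add: kcoef_def kdiff_def lookup_sum mult.assoc)
  also have "\<dots> = (\<Sum>v\<in>-A. ksgn v A * 1 * kcoef z a (insert v A))"
  proof (intro sum.cong refl)
    fix v assume v: "v \<in> - A"
    have "a - ind A - monomial v 1 = a - ind (insert v A)"
      using v by (intro poly_mapping_eqI) (auto simp: lookup_minus lookup_single when_def)
    then show "lookup (ksgn v A * (Var v * z (insert v A))) (a - ind A) = ksgn v A * 1 * kcoef z a (insert v A)"
      using v True by (simp add: lookup_ksgn_mult lookup_Var_mult kcoef_def dvds_ind_insert lookup_minus)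
  qed
  finally show ?thesis by (simp add: kdiff_def)
qed

text \<open>The upper Koszul simplicial complex of the monomial ideal \<open>mon T\<close> in degree
  \<open>a\<close>; it is closed under subsets when \<open>T\<close> is up-closed.\<close>

definition kcx :: "('v::finite \<Rightarrow>\<^sub>0 nat) set \<Rightarrow> ('v \<Rightarrow>\<^sub>0 nat) \<Rightarrow> 'v set set"
  where "kcx T a = {A. dvds (ind A) a \<and> a - ind A \<in> T}"

text \<open>Hypotheses on Koszul chains speak only of sets of one cardinality; cutting discards the
  arbitrary values elsewhere.\<close>

definition kcut :: "nat \<Rightarrow> ('v::finite set \<Rightarrow> 'k::zero) \<Rightarrow> 'v set \<Rightarrow> 'k"
  where "kcut p c A = (if card A = p then c A else 0)"

lemma kdiff_kcut:
  "kdiff X (kcut p c) A = (if Suc (card A) = p then kdiff X c A else 0)"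
  by (auto simp: kdiff_def kcut_def)

lemma kdiff_kchain:
  assumes "kchain D p c" "Suc (card A) \<noteq> p"
  shows "kdiff X c A = 0"
  unfolding kdiff_def
proof (rule sum.neutral, rule ballI)
  fix v assume "v \<in> - A"
  then have "card (insert v A) \<noteq> p" using assms(2) by simp
  then have "c (insert v A) = 0" using assms(1) unfolding kchain_def by blast
  then show "ksgn v A * X v * c (insert v A) = 0" by simp
qed

text \<open>The equation is solved in each multidegree separately. Only multidegrees of total degree
  \<open>j\<close> matter, and there are finitely many, so the scalar solutions combine to
  polynomials.\<close>

lemma koszul_assemble:
  fixes z :: "'v::finite set \<Rightarrow> ('v, 'k::field) poly_ring"
  assumes z: "\<And>A. card A = p \<Longrightarrow> homogeneous (z A) (j - int p)"
    and e: "\<And>a. int (monom_degree a) = j \<Longrightarrow>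
      \<exists>e. kchain (kcx T a) (Suc p) e \<and> (\<forall>A. sdiff e A = kcut p (kcoef z a) A)"
  shows "\<exists>y. (\<forall>A. card A = Suc p \<longrightarrow> y A \<in> mon T \<and> homogeneous (y A) (j - int p - 1)) \<and>
    (\<forall>A. card A = p \<longrightarrow> kdiff Var y A = z A)"
proof -
  from e obtain e where e: "\<And>a. int (monom_degree a) = j \<Longrightarrow> kchain (kcx T a) (Suc p) (e a)"
    "\<And>a A. int (monom_degree a) = j \<Longrightarrow> sdiff (e a) A = kcut p (kcoef z a) A"
    by metis
  define y where "y A = Abs_poly_mapping
    (\<lambda>t. if int (monom_degree t) = j - int p - 1 \<and> card A = Suc p then e (t + ind A) A else 0)" for A
  have y: "lookup (y A) t =
    (if int (monom_degree t) = j - int p - 1 \<and> card A = Suc p then e (t + ind A) A else 0)" for A t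
    unfolding y_def by (subst lookup_Abs_homogeneous[where d = "j - int p - 1"]) (auto split: if_splits)
  have "y A \<in> mon T \<and> homogeneous (y A) (j - int p - 1)" if "card A = Suc p" for A
  proof
    show "homogeneous (y A) (j - int p - 1)" by (simp add: homogeneous_iff y)
    show "y A \<in> mon T" unfolding mon_iff
    proof (intro allI impI)
      fix t assume "lookup (y A) t \<noteq> 0"
      then have "int (monom_degree (t + ind A)) = j" "e (t + ind A) A \<noteq> 0"
        using that by (auto simp: y monom_degree_add split: if_splits)
      then have "A \<in> kcx T (t + ind A)" using e(1) by (auto simp: kchain_def)
      then show "t \<in> T" by (simp add: kcx_def)
    qed
  qed
  moreover have "kdiff Var y A = z A" if A: "card A = p" for A
  proof (rule poly_mapping_eqI)
    fix t
    let ?a = "t + ind A"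
    have *: "lookup (kdiff Var y A) t = sdiff (kcoef y ?a) A"
      using kcoef_kdiff[of y ?a A] by (simp add: kcoef_def)
    show "lookup (kdiff Var y A) t = lookup (z A) t"
    proof (cases "int (monom_degree ?a) = j")
      case True
      have "kcoef y ?a (insert v A) = e ?a (insert v A)" if "v \<notin> A" for v
      proof (cases "dvds (ind (insert v A)) ?a")
        case True2: True
        have "card (insert v A) = Suc p" using that A by simp
        moreover have "?a - ind (insert v A) + ind (insert v A) = ?a" by (rule dvds_imp_eq_add[OF True2])
        moreover from this have "int (monom_degree (?a - ind (insert v A))) = j - int p - 1"
          using monom_degree_minus[OF True2] True \<open>card (insert v A) = Suc p\<close> by simp
        ultimately show ?thesis using True2 by (simp add: kcoef_def y)
      next
        case False
        then have "insert v A \<notin> kcx T ?a" by (simp add: kcx_def)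
        then show ?thesis using e(1)[OF True] False unfolding kchain_def kcoef_def by metis
      qed
      then have "sdiff (kcoef y ?a) A = sdiff (e ?a) A" by (intro kdiff_cong)
      also have "\<dots> = lookup (z A) t" using e(2)[OF True] A by (simp add: kcut_def kcoef_def)
      finally show ?thesis using * by simp
    next
      case False
      have "lookup (z A) t = 0"
        using z[OF A] False A by (auto simp: homogeneous_iff monom_degree_add)
      moreover have "kcoef y ?a (insert v A) = 0" if "v \<notin> A" for v
        using False A that monom_degree_minus[of "ind (insert v A)" ?a]
        by (auto simp: kcoef_def y)
      ultimately show ?thesis using * by (simp add: kdiff_def)
    qed
  qed
  ultimately show ?thesis by blast
qed

text \<open>In a multidegree \<open>a\<close> other than 0 any variable with positive exponent is an
  apex of the complex. In multidegree 0 only the constant term for \<open>p = 0\<close> survives,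
  which \<open>z0\<close> excludes.\<close>

lemma koszul_acyclic:
  fixes z :: "'v::finite set \<Rightarrow> ('v, 'k::field) poly_ring"
  assumes z: "\<And>A. card A = p \<Longrightarrow> homogeneous (z A) (j - int p)"
    and cyc: "\<And>A. Suc (card A) = p \<Longrightarrow> kdiff Var z A = 0"
    and z0: "p = 0 \<Longrightarrow> lookup (z {}) 0 = 0"
  shows "\<exists>y. (\<forall>A. card A = Suc p \<longrightarrow> homogeneous (y A) (j - int p - 1)) \<and>
    (\<forall>A. card A = p \<longrightarrow> kdiff Var y A = z A)"
proof -
  have "\<exists>e. kchain (kcx UNIV a) (Suc p) e \<and> (\<forall>A. sdiff e A = kcut p (kcoef z a) A)" for a
  proof (cases "a = 0")
    case True
    have "kcut p (kcoef z a) A = 0" for A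
    proof (cases "dvds (ind A) a")
      case True2: True
      then have "A = {}" using True by (auto simp: dvds_def split: if_splits)
      then show ?thesis using z0 True by (auto simp: kcut_def kcoef_def)
    qed (simp add: kcut_def kcoef_def)
    then show ?thesis by (intro exI[of _ "\<lambda>_. 0"]) (simp add: kchain_def)
  next
    case False
    then obtain v where v: "lookup a v > 0" by (metis gr0I lookup_zero poly_mapping_eqI)
    have "insert v A \<in> kcx UNIV a" if "A \<in> kcx UNIV a" for A
      using that v by (cases "v \<in> A") (auto simp: kcx_def dvds_ind_insert insert_absorb)
    then have "\<not> khom TYPE('k) (kcx UNIV a) p" by (rule not_khom_cone)
    moreover have "kchain (kcx UNIV a) p (kcut p (kcoef z a))"
      by (auto simp: kchain_def kcut_def kcoef_def kcx_def split: if_splits)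
    moreover have "sdiff (kcut p (kcoef z a)) A = 0" for A
      using cyc[of A] by (auto simp: kdiff_kcut kcoef_kdiff[symmetric]) (simp add: kcoef_def)
    ultimately show ?thesis unfolding khom_def by blast
  qed
  then show ?thesis using koszul_assemble[where T = UNIV, OF z] by (auto simp: mon_def)
qed

section \<open>Koszul homology of the syzygies of a minimal graded free resolution\<close>

lemma kdiff_matrix:
  "kdiff X (\<lambda>B. \<Sum>b\<in>S. m b * u B b) A = (\<Sum>b\<in>S. m b * kdiff X (\<lambda>B. u B b) A)"
proof -
  have "kdiff X (\<lambda>B. \<Sum>b\<in>S. m b * u B b) A = (\<Sum>v\<in>-A. \<Sum>b\<in>S. m b * (ksgn v A * X v * u (insert v A) b))"
    unfolding kdiff_def by (simp add: sum_distrib_left mult_ac)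
  also have "\<dots> = (\<Sum>b\<in>S. m b * kdiff X (\<lambda>B. u B b) A)"
    unfolding kdiff_def by (subst sum.swap) (simp add: sum_distrib_left)
  finally show ?thesis .
qed

text \<open>Matrices and vectors are replaced by functions of indices, meaningful only below
  \<open>rows i\<close> and \<open>r i\<close>, so that no dimensions have to be carried along.
  Minimality starts at \<open>M 1\<close>; the entries of \<open>M 0\<close> are generators of
  \<open>J\<close>.\<close>

locale min_graded_res =
  fixes J :: "('v::finite, 'k::field) poly_ring set"
    and d :: "nat \<Rightarrow> nat \<Rightarrow> int"
    and M :: "nat \<Rightarrow> nat \<Rightarrow> nat \<Rightarrow> ('v, 'k) poly_ring"
    and r :: "nat \<Rightarrow> nat"
    and rows :: "nat \<Rightarrow> nat"
  assumes rows_0: "rows 0 = 1" and rows_Suc: "rows (Suc i) = r i"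
    and hom: "\<lbrakk>a < rows i; b < r i\<rbrakk> \<Longrightarrow> homogeneous (M i a b) (d i b - row_shift d i a)"
    and image_0: "f \<in> J \<longleftrightarrow> (\<exists>u. f = (\<Sum>b<r 0. M 0 0 b * u b))"
    and exact: "(\<forall>a<rows i. (\<Sum>b<r i. M i a b * v b) = 0) \<longleftrightarrow>
      (\<exists>u. \<forall>b<r i. v b = (\<Sum>e<r (Suc i). M (Suc i) b e * u e))"
    and minimal: "\<lbrakk>a < rows (Suc i); b < r (Suc i)\<rbrakk> \<Longrightarrow> lookup (M (Suc i) a b) 0 = 0"
begin

text \<open>The \<open>i\<close>-th syzygy module as the image of the \<open>i\<close>-th map; for
  \<open>i = 0\<close> it is \<open>J\<close> itself.\<close>

definition syz :: "nat \<Rightarrow> (nat \<Rightarrow> ('v, 'k) poly_ring) \<Rightarrow> bool"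
  where "syz i y \<longleftrightarrow> (\<exists>u. \<forall>a<rows i. y a = (\<Sum>b<r i. M i a b * u b))"

definition homv :: "nat \<Rightarrow> int \<Rightarrow> (nat \<Rightarrow> ('v, 'k) poly_ring) \<Rightarrow> bool"
  where "homv i e y \<longleftrightarrow> (\<forall>a<rows i. homogeneous (y a) (e - row_shift d i a))"

text \<open>The Koszul homology of the \<open>i\<close>-th syzygy module is nonzero in homological
  degree \<open>p\<close> and internal degree \<open>j\<close>. A basis element of the exterior
  power has degree \<open>p\<close>, so coefficients have degree \<open>j - p\<close>, those of a
  bounding chain one less.\<close>

definition syz_hom :: "nat \<Rightarrow> nat \<Rightarrow> int \<Rightarrow> bool"
  where "syz_hom i p j \<longleftrightarrow> (\<exists>z :: 'v set \<Rightarrow> nat \<Rightarrow> ('v, 'k) poly_ring.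
    (\<forall>A. card A = p \<longrightarrow> syz i (z A) \<and> homv i (j - int p) (z A)) \<and>
    (\<forall>A. Suc (card A) = p \<longrightarrow> (\<forall>a<rows i. kdiff Var (\<lambda>B. z B a) A = 0)) \<and>
    \<not> (\<exists>y. (\<forall>A. card A = Suc p \<longrightarrow> syz i (y A) \<and> homv i (j - int p - 1) (y A)) \<and>
           (\<forall>A. card A = p \<longrightarrow> (\<forall>a<rows i. kdiff Var (\<lambda>B. y B a) A = z A a))))"

lemma syz_homE:
  assumes "syz_hom i p j"
  obtains z :: "'v set \<Rightarrow> nat \<Rightarrow> ('v, 'k) poly_ring" where
    "\<And>A. card A = p \<Longrightarrow> syz i (z A)" "\<And>A. card A = p \<Longrightarrow> homv i (j - int p) (z A)"
    "\<And>A a. Suc (card A) = p \<Longrightarrow> a < rows i \<Longrightarrow> kdiff Var (\<lambda>B. z B a) A = 0"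
    "\<And>y. (\<And>A. card A = Suc p \<Longrightarrow> syz i (y A)) \<Longrightarrow>
      (\<And>A. card A = Suc p \<Longrightarrow> homv i (j - int p - 1) (y A)) \<Longrightarrow>
      (\<And>A a. card A = p \<Longrightarrow> a < rows i \<Longrightarrow> kdiff Var (\<lambda>B. y B a) A = z A a) \<Longrightarrow> False"
proof -
  from assms[unfolded syz_hom_def] obtain z where
    z: "(\<forall>A. card A = p \<longrightarrow> syz i (z A) \<and> homv i (j - int p) (z A)) \<and>
    (\<forall>A. Suc (card A) = p \<longrightarrow> (\<forall>a<rows i. kdiff Var (\<lambda>B. z B a) A = 0)) \<and>
    \<not> (\<exists>y. (\<forall>A. card A = Suc p \<longrightarrow> syz i (y A) \<and> homv i (j - int p - 1) (y A)) \<and>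
           (\<forall>A. card A = p \<longrightarrow> (\<forall>a<rows i. kdiff Var (\<lambda>B. y B a) A = z A a)))" ..
  note z1 = conjunct1[OF z] and z2 = conjunct1[OF conjunct2[OF z]] and z3 = conjunct2[OF conjunct2[OF z]]
  show thesis
  proof (rule that[of z])
    show "syz i (z A)" "homv i (j - int p) (z A)" if "card A = p" for A
      using z1[rule_format, OF that] by simp_all
    show "kdiff Var (\<lambda>B. z B a) A = 0" if "Suc (card A) = p" "a < rows i" for A a
      using z2[rule_format, OF that] .
    show False if "\<And>A. card A = Suc p \<Longrightarrow> syz i (y A)" "\<And>A. card A = Suc p \<Longrightarrow> homv i (j - int p - 1) (y A)"
      "\<And>A a. card A = p \<Longrightarrow> a < rows i \<Longrightarrow> kdiff Var (\<lambda>B. y B a) A = z A a" for y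
      by (rule notE[OF z3 exI[of _ y]]) (intro conjI allI impI that)
  qed
qed

lemma syz_homI:
  assumes "\<And>A. card A = p \<Longrightarrow> syz i (z A)" "\<And>A. card A = p \<Longrightarrow> homv i (j - int p) (z A)"
    "\<And>A a. Suc (card A) = p \<Longrightarrow> a < rows i \<Longrightarrow> kdiff Var (\<lambda>B. z B a) A = 0"
    "\<And>y. (\<And>A. card A = Suc p \<Longrightarrow> syz i (y A)) \<Longrightarrow>
      (\<And>A. card A = Suc p \<Longrightarrow> homv i (j - int p - 1) (y A)) \<Longrightarrow>
      (\<And>A a. card A = p \<Longrightarrow> a < rows i \<Longrightarrow> kdiff Var (\<lambda>B. y B a) A = z A a) \<Longrightarrow> False"
  shows "syz_hom i p j"
  unfolding syz_hom_def
proof (intro exI[of _ z] conjI notI)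
  show "\<forall>A. card A = p \<longrightarrow> syz i (z A) \<and> homv i (j - int p) (z A)"
    by (intro allI impI conjI assms(1,2))
  show "\<forall>A. Suc (card A) = p \<longrightarrow> (\<forall>a<rows i. kdiff Var (\<lambda>B. z B a) A = 0)"
    by (intro allI impI assms(3))
  assume "\<exists>y. (\<forall>A. card A = Suc p \<longrightarrow> syz i (y A) \<and> homv i (j - int p - 1) (y A)) \<and>
           (\<forall>A. card A = p \<longrightarrow> (\<forall>a<rows i. kdiff Var (\<lambda>B. y B a) A = z A a))"
  then obtain y where y: "(\<forall>A. card A = Suc p \<longrightarrow> syz i (y A) \<and> homv i (j - int p - 1) (y A)) \<and>
    (\<forall>A. card A = p \<longrightarrow> (\<forall>a<rows i. kdiff Var (\<lambda>B. y B a) A = z A a))" ..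
  note y1 = conjunct1[OF y, rule_format] and y2 = conjunct2[OF y, rule_format]
  show False
    by (rule assms(4)[of y]) (rule conjunct1[OF y1] conjunct2[OF y1] y2; assumption)+
qed

lemma row_shift_Suc: "row_shift d (Suc i) a = d i a"
  by (simp add: row_shift_def)

lemma syz_Suc: "syz (Suc i) y \<longleftrightarrow> (\<forall>a<rows i. (\<Sum>b<r i. M i a b * y b) = 0)"
  unfolding syz_def rows_Suc using exact[of i y] by simp

lemma syz_imp_lookup_zero: "syz (Suc i) y \<Longrightarrow> b < r i \<Longrightarrow> lookup (y b) 0 = 0"
  unfolding syz_def rows_Suc using minimal[of b i]
  by (auto simp: lookup_sum lookup_mult_zero rows_Suc)

lemma syz_image: "syz i (\<lambda>a. \<Sum>b<r i. M i a b * u b)"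
  unfolding syz_def by blast

lemma homv_Suc: "homv (Suc i) e u \<longleftrightarrow> (\<forall>b<r i. homogeneous (u b) (e - d i b))"
  by (simp add: homv_def rows_Suc row_shift_Suc)

lemma homv_image:
  assumes "\<And>b. b < r i \<Longrightarrow> homogeneous (u b) (e - d i b)"
  shows "homv i e (\<lambda>a. \<Sum>b<r i. M i a b * u b)"
  unfolding homv_def
proof (intro allI impI homogeneous_sum)
  fix a b assume "a < rows i" "b \<in> {..<r i}"
  then have "homogeneous (M i a b * u b) ((d i b - row_shift d i a) + (e - d i b))"
    using assms hom by (intro homogeneous_mult) auto
  then show "homogeneous (M i a b * u b) (e - row_shift d i a)" by simp
qed

text \<open>Any preimage works after each of its entries is replaced by the homogeneous component of
  the right degree.\<close>

lemma syz_lift: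
  assumes "syz i y" "homv i e y"
  shows "\<exists>u. (\<forall>a<rows i. y a = (\<Sum>b<r i. M i a b * u b)) \<and> homv (Suc i) e u"
proof -
  obtain u where u: "\<forall>a<rows i. y a = (\<Sum>b<r i. M i a b * u b)" using assms(1) syz_def by blast
  have "y a = (\<Sum>b<r i. M i a b * hcomp (e - d i b) (u b))" if a: "a < rows i" for a
  proof -
    let ?s = "row_shift d i a"
    have "y a = hcomp (e - ?s) (y a)" using assms(2) a by (simp add: homv_def hcomp_id)
    also have "\<dots> = (\<Sum>b<r i. hcomp (e - ?s) (M i a b * u b))" using u a by (simp add: hcomp_sum)
    also have "\<dots> = (\<Sum>b<r i. M i a b * hcomp (e - d i b) (u b))"
    proof (intro sum.cong refl)
      fix b assume "b \<in> {..<r i}"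
      then show "hcomp (e - ?s) (M i a b * u b) = M i a b * hcomp (e - d i b) (u b)"
        using hcomp_mult[OF hom[OF a, of b], of "e - ?s" "u b"] by simp
    qed
    finally show ?thesis .
  qed
  then show ?thesis
    by (intro exI[of _ "\<lambda>b. hcomp (e - d i b) (u b)"]) (simp add: homv_Suc homogeneous_hcomp)
qed

lemma free_acyclic:
  fixes x :: "'v set \<Rightarrow> nat \<Rightarrow> ('v, 'k) poly_ring"
  assumes h: "\<And>A. card A = p \<Longrightarrow> homv (Suc i) (j - int p) (x A)"
    and c: "\<And>A b. Suc (card A) = p \<Longrightarrow> b < r i \<Longrightarrow> kdiff Var (\<lambda>B. x B b) A = 0"
    and z: "\<And>b. p = 0 \<Longrightarrow> b < r i \<Longrightarrow> lookup (x {} b) 0 = 0"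
  shows "\<exists>t. (\<forall>A. card A = Suc p \<longrightarrow> homv (Suc i) (j - int p - 1) (t A)) \<and>
    (\<forall>A. card A = p \<longrightarrow> (\<forall>b<r i. kdiff Var (\<lambda>B. t B b) A = x A b))"
proof -
  have "\<exists>y. (\<forall>A. card A = Suc p \<longrightarrow> homogeneous (y A) ((j - d i b) - int p - 1)) \<and>
    (\<forall>A. card A = p \<longrightarrow> kdiff Var y A = x A b)" if "b < r i" for b
  proof (rule koszul_acyclic)
    show "homogeneous (x A b) ((j - d i b) - int p)" if "card A = p" for A
      using h[OF that] \<open>b < r i\<close> by (simp add: homv_Suc algebra_simps)
  qed (use c z that in auto)
  then obtain y where y: "\<And>b A. b < r i \<Longrightarrow> card A = Suc p \<Longrightarrow> homogeneous (y b A) ((j - d i b) - int p - 1)"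
    "\<And>b A. b < r i \<Longrightarrow> card A = p \<Longrightarrow> kdiff Var (y b) A = x A b" by metis
  show ?thesis
  proof (intro exI[of _ "\<lambda>A b. y b A"] conjI allI impI)
    fix A :: "'v set" assume "card A = Suc p"
    then show "homv (Suc i) (j - int p - 1) (\<lambda>b. y b A)"
      using y(1) by (simp add: homv_Suc algebra_simps)
  qed (use y(2) in simp)
qed

text \<open>The connecting homomorphism of 0 -> Syz(i+1) -> F(i) -> Syz(i) -> 0 is injective, as the
  free module is acyclic in positive Koszul degree: lift a cycle to F(i) and differentiate.\<close>

lemma syz_hom_Suc_imp:
  assumes "syz_hom i (Suc p) j"
  shows "syz_hom (Suc i) p j"
proof (rule syz_homE[OF assms])
  fix z :: "'v set \<Rightarrow> nat \<Rightarrow> ('v, 'k) poly_ring"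
  assume
    z: "\<And>A. card A = Suc p \<Longrightarrow> syz i (z A)" "\<And>A. card A = Suc p \<Longrightarrow> homv i (j - int (Suc p)) (z A)"
      "\<And>A a. Suc (card A) = Suc p \<Longrightarrow> a < rows i \<Longrightarrow> kdiff Var (\<lambda>B. z B a) A = 0"
    and n: "\<And>y. (\<And>A. card A = Suc (Suc p) \<Longrightarrow> syz i (y A)) \<Longrightarrow>
      (\<And>A. card A = Suc (Suc p) \<Longrightarrow> homv i (j - int (Suc p) - 1) (y A)) \<Longrightarrow>
      (\<And>A a. card A = Suc p \<Longrightarrow> a < rows i \<Longrightarrow> kdiff Var (\<lambda>B. y B a) A = z A a) \<Longrightarrow> False"
  have "\<exists>u. card A = Suc p \<longrightarrow>
    (\<forall>a<rows i. z A a = (\<Sum>b<r i. M i a b * u b)) \<and> homv (Suc i) (j - int (Suc p)) u" for A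
    using syz_lift[OF z(1,2)[of A]] by blast
  then obtain l where l: "\<And>A a. card A = Suc p \<Longrightarrow> a < rows i \<Longrightarrow> (\<Sum>b<r i. M i a b * l A b) = z A a"
    "\<And>A. card A = Suc p \<Longrightarrow> homv (Suc i) (j - int (Suc p)) (l A)" by metis
  show ?thesis
  proof (rule syz_homI[where z = "\<lambda>A b. kdiff Var (\<lambda>B. l B b) A"])
    fix A :: "'v set" assume A: "card A = p"
    show "syz (Suc i) (\<lambda>b. kdiff Var (\<lambda>B. l B b) A)"
      unfolding syz_Suc
    proof (intro allI impI)
      fix a assume a: "a < rows i"
      have "(\<Sum>b<r i. M i a b * kdiff Var (\<lambda>B. l B b) A) = kdiff Var (\<lambda>B. \<Sum>b<r i. M i a b * l B b) A"
        by (simp add: kdiff_matrix)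
      also have "\<dots> = kdiff Var (\<lambda>B. z B a) A"
        by (intro kdiff_cong) (use l(1) A a in simp)
      finally show "(\<Sum>b<r i. M i a b * kdiff Var (\<lambda>B. l B b) A) = 0" using z(3)[OF _ a] A by simp
    qed
  next
    fix A :: "'v set" assume A: "card A = p"
    show "homv (Suc i) (j - int p) (\<lambda>b. kdiff Var (\<lambda>B. l B b) A)"
      unfolding homv_Suc
    proof (intro allI impI homogeneous_kdiff)
      fix b v assume "b < r i" "v \<notin> A"
      then show "homogeneous (l (insert v A) b) (j - int p - d i b - 1)"
        using l(2)[of "insert v A"] A by (simp add: homv_Suc algebra_simps)
    qed
  next
    fix A :: "'v set" and a
    show "kdiff Var (\<lambda>B. kdiff Var (\<lambda>B. l B a) B) A = 0" by simp
  next
    fix y :: "'v set \<Rightarrow> nat \<Rightarrow> ('v, 'k) poly_ring"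
    assume y: "\<And>A. card A = Suc p \<Longrightarrow> syz (Suc i) (y A)"
      "\<And>A. card A = Suc p \<Longrightarrow> homv (Suc i) (j - int p - 1) (y A)"
      and "\<And>A b. card A = p \<Longrightarrow> b < rows (Suc i) \<Longrightarrow> kdiff Var (\<lambda>B. y B b) A = kdiff Var (\<lambda>B. l B b) A"
    then have y3: "\<And>A b. card A = p \<Longrightarrow> b < r i \<Longrightarrow> kdiff Var (\<lambda>B. y B b) A = kdiff Var (\<lambda>B. l B b) A"
      by (simp add: rows_Suc)
    \<comment> \<open>If the image of \<open>z\<close> bounds \<open>y\<close>, then
      \<open>l - y\<close> is a cycle in the free module and bounds some \<open>t\<close>; the image
      of \<open>t\<close> then bounds \<open>z\<close>.\<close>
    have "\<exists>t. (\<forall>A. card A = Suc (Suc p) \<longrightarrow> homv (Suc i) (j - int (Suc p) - 1) (t A)) \<and>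
      (\<forall>A. card A = Suc p \<longrightarrow> (\<forall>b<r i. kdiff Var (\<lambda>B. t B b) A = l A b - y A b))"
    proof (rule free_acyclic)
      fix A :: "'v set" assume "card A = Suc p"
      then show "homv (Suc i) (j - int (Suc p)) (\<lambda>b. l A b - y A b)"
        using l(2)[of A] y(2)[of A] by (auto simp: homv_Suc algebra_simps intro!: homogeneous_diff)
    qed (use y3 in \<open>auto simp: kdiff_diff\<close>)
    then obtain t where t: "\<And>A. card A = Suc (Suc p) \<Longrightarrow> homv (Suc i) (j - int (Suc p) - 1) (t A)"
      "\<And>A b. card A = Suc p \<Longrightarrow> b < r i \<Longrightarrow> kdiff Var (\<lambda>B. t B b) A = l A b - y A b" by blast
    have "kdiff Var (\<lambda>B. \<Sum>b<r i. M i a b * t B b) A = z A a" if A: "card A = Suc p" and a: "a < rows i" for A a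
    proof -
      have "kdiff Var (\<lambda>B. \<Sum>b<r i. M i a b * t B b) A = (\<Sum>b<r i. M i a b * l A b - M i a b * y A b)"
        using t(2)[OF A] by (simp add: kdiff_matrix right_diff_distrib)
      also have "\<dots> = z A a" using l(1)[OF A a] y(1)[OF A] a by (simp add: sum_subtractf syz_Suc)
      finally show ?thesis .
    qed
    moreover have "homv i (j - int (Suc p) - 1) (\<lambda>a. \<Sum>b<r i. M i a b * t A b)" if "card A = Suc (Suc p)" for A
      using t(1)[OF that] by (intro homv_image) (simp add: homv_Suc)
    ultimately show False
      by (intro n[of "\<lambda>A a. \<Sum>b<r i. M i a b * t A b"] syz_image)
  qed
qed

text \<open>The same connecting homomorphism is surjective: a cycle of Syz(i+1) bounds in F(i), and
  the image of the bounding chain is a cycle of Syz(i).\<close>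

lemma syz_hom_imp_Suc:
  assumes "syz_hom (Suc i) p j"
  shows "syz_hom i (Suc p) j"
proof (rule syz_homE[OF assms])
  fix z :: "'v set \<Rightarrow> nat \<Rightarrow> ('v, 'k) poly_ring"
  assume
    z: "\<And>A. card A = p \<Longrightarrow> syz (Suc i) (z A)" "\<And>A. card A = p \<Longrightarrow> homv (Suc i) (j - int p) (z A)"
      "\<And>A a. Suc (card A) = p \<Longrightarrow> a < rows (Suc i) \<Longrightarrow> kdiff Var (\<lambda>B. z B a) A = 0"
    and n: "\<And>y. (\<And>A. card A = Suc p \<Longrightarrow> syz (Suc i) (y A)) \<Longrightarrow>
      (\<And>A. card A = Suc p \<Longrightarrow> homv (Suc i) (j - int p - 1) (y A)) \<Longrightarrow>
      (\<And>A a. card A = p \<Longrightarrow> a < rows (Suc i) \<Longrightarrow> kdiff Var (\<lambda>B. y B a) A = z A a) \<Longrightarrow> False"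
  \<comment> \<open>For \<open>p = 0\<close> this is where minimality enters: syzygies have no
    constant terms.\<close>
  have "\<exists>t. (\<forall>A. card A = Suc p \<longrightarrow> homv (Suc i) (j - int p - 1) (t A)) \<and>
    (\<forall>A. card A = p \<longrightarrow> (\<forall>b<r i. kdiff Var (\<lambda>B. t B b) A = z A b))"
    by (rule free_acyclic) (use z syz_imp_lookup_zero[OF z(1)[of "{}"]] in \<open>auto simp: rows_Suc\<close>)
  then obtain t where t: "\<And>A. card A = Suc p \<Longrightarrow> homv (Suc i) (j - int p - 1) (t A)"
    "\<And>A b. card A = p \<Longrightarrow> b < r i \<Longrightarrow> kdiff Var (\<lambda>B. t B b) A = z A b" by blast
  show ?thesis
  proof (rule syz_homI[where z = "\<lambda>A a. \<Sum>b<r i. M i a b * t A b"])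
    fix A :: "'v set" assume A: "card A = Suc p"
    show "syz i (\<lambda>a. \<Sum>b<r i. M i a b * t A b)" by (rule syz_image)
  next
    fix A :: "'v set" assume A: "card A = Suc p"
    show "homv i (j - int (Suc p)) (\<lambda>a. \<Sum>b<r i. M i a b * t A b)"
      using t(1)[OF A] by (intro homv_image) (simp add: homv_Suc algebra_simps)
  next
    fix A :: "'v set" and a assume A: "Suc (card A) = Suc p" and a: "a < rows i"
    have "kdiff Var (\<lambda>B. \<Sum>b<r i. M i a b * t B b) A = (\<Sum>b<r i. M i a b * z A b)"
      using t(2) A by (simp add: kdiff_matrix)
    then show "kdiff Var (\<lambda>B. \<Sum>b<r i. M i a b * t B b) A = 0"
      using z(1)[of A] A a by (simp add: syz_Suc)
  next
    fix y :: "'v set \<Rightarrow> nat \<Rightarrow> ('v, 'k) poly_ring"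
    assume y: "\<And>A. card A = Suc (Suc p) \<Longrightarrow> syz i (y A)"
      "\<And>A. card A = Suc (Suc p) \<Longrightarrow> homv i (j - int (Suc p) - 1) (y A)"
      "\<And>A a. card A = Suc p \<Longrightarrow> a < rows i \<Longrightarrow> kdiff Var (\<lambda>B. y B a) A = (\<Sum>b<r i. M i a b * t A b)"
    have "\<exists>u. card A = Suc (Suc p) \<longrightarrow>
      (\<forall>a<rows i. y A a = (\<Sum>b<r i. M i a b * u b)) \<and> homv (Suc i) (j - int (Suc p) - 1) u" for A
      using syz_lift[OF y(1,2)[of A]] by blast
    then obtain l where l: "\<And>A a. card A = Suc (Suc p) \<Longrightarrow> a < rows i \<Longrightarrow> (\<Sum>b<r i. M i a b * l A b) = y A a"
      "\<And>A. card A = Suc (Suc p) \<Longrightarrow> homv (Suc i) (j - int (Suc p) - 1) (l A)" by metis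
    \<comment> \<open>Subtracting the boundary of the lift \<open>l\<close> moves \<open>t\<close>
      into Syz(i+1) without changing its own boundary \<open>z\<close>.\<close>
    let ?W = "\<lambda>A b. t A b - kdiff Var (\<lambda>B. l B b) A"
    have "syz (Suc i) (?W A)" if A: "card A = Suc p" for A
      unfolding syz_Suc
    proof (intro allI impI)
      fix a assume a: "a < rows i"
      have "(\<Sum>b<r i. M i a b * ?W A b) = (\<Sum>b<r i. M i a b * t A b) - kdiff Var (\<lambda>B. \<Sum>b<r i. M i a b * l B b) A"
        by (simp add: kdiff_matrix right_diff_distrib sum_subtractf)
      also have "kdiff Var (\<lambda>B. \<Sum>b<r i. M i a b * l B b) A = kdiff Var (\<lambda>B. y B a) A"
        by (intro kdiff_cong) (use l(1) A a in simp)
      finally show "(\<Sum>b<r i. M i a b * ?W A b) = 0" using y(3)[OF A a] by simp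
    qed
    moreover have "homv (Suc i) (j - int p - 1) (?W A)" if A: "card A = Suc p" for A
    proof -
      have "homogeneous (kdiff Var (\<lambda>B. l B b) A) (j - int p - 1 - d i b)" if b: "b < r i" for b
      proof (rule homogeneous_kdiff)
        fix v assume "v \<notin> A"
        then show "homogeneous (l (insert v A) b) (j - int p - 1 - d i b - 1)"
          using l(2)[of "insert v A"] A b by (simp add: homv_Suc algebra_simps)
      qed
      then show ?thesis
        using t(1)[OF A] by (auto simp: homv_Suc intro!: homogeneous_diff)
    qed
    moreover have "kdiff Var (\<lambda>B. ?W B b) A = z A b" if "card A = p" "b < rows (Suc i)" for A b
      using t(2)[of A b] that by (simp add: kdiff_diff rows_Suc)
    ultimately show False by (rule n[of ?W])
  qed
qed

lemma syz_hom_shift: "syz_hom i p j \<longleftrightarrow> syz_hom 0 (p + i) j"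
proof (induction i arbitrary: p)
  case (Suc i)
  then show ?case using syz_hom_Suc_imp[of i p j] syz_hom_imp_Suc[of i p j] by auto
qed simp

text \<open>Graded Nakayama: in Koszul degree 0 the homology is the syzygy module modulo the
  irrelevant ideal, and minimality makes the columns of the map a basis of it.\<close>

lemma syz_hom_0: "syz_hom i 0 j \<longleftrightarrow> (\<exists>b<r i. d i b = j)"
proof
  assume h: "syz_hom i 0 j"
  show "\<exists>b<r i. d i b = j"
  proof (rule syz_homE[OF h])
    fix z :: "'v set \<Rightarrow> nat \<Rightarrow> ('v, 'k) poly_ring"
    assume
      z0: "\<And>A. card A = 0 \<Longrightarrow> syz i (z A)" "\<And>A. card A = 0 \<Longrightarrow> homv i (j - int 0) (z A)"
        "\<And>A a. Suc (card A) = 0 \<Longrightarrow> a < rows i \<Longrightarrow> kdiff Var (\<lambda>B. z B a) A = 0" and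
      n: "\<And>y. (\<And>A. card A = Suc 0 \<Longrightarrow> syz i (y A)) \<Longrightarrow>
        (\<And>A. card A = Suc 0 \<Longrightarrow> homv i (j - int 0 - 1) (y A)) \<Longrightarrow>
        (\<And>A a. card A = 0 \<Longrightarrow> a < rows i \<Longrightarrow> kdiff Var (\<lambda>B. y B a) A = z A a) \<Longrightarrow> False"
    have z: "syz i (z {})" "homv i j (z {})" using z0[of "{}"] by simp_all
    obtain u where u: "\<And>a. a < rows i \<Longrightarrow> z {} a = (\<Sum>b<r i. M i a b * u b)" and hu: "homv (Suc i) j u"
      using syz_lift[OF z] by blast
    show "\<exists>b<r i. d i b = j"
    proof (rule ccontr)
      assume no: "\<not> (\<exists>b<r i. d i b = j)"
      \<comment> \<open>With no shift equal to \<open>j\<close>, every \<open>u b\<close> is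
        homogeneous of nonzero degree, has no constant term, and is therefore a Koszul
        boundary.\<close>
      have "\<exists>t. (\<forall>A. card A = Suc 0 \<longrightarrow> homv (Suc i) (j - int 0 - 1) (t A)) \<and>
        (\<forall>A. card A = 0 \<longrightarrow> (\<forall>b<r i. kdiff Var (\<lambda>B. t B b) A = (\<lambda>A :: 'v set. u) A b))"
      proof (rule free_acyclic)
        fix b assume b: "b < r i"
        then have "homogeneous (u b) (j - d i b)" "j - d i b \<noteq> 0" using hu no by (auto simp: homv_Suc)
        then show "lookup (u b) 0 = 0" unfolding homogeneous_iff by (metis monom_degree_zero of_nat_0)
      qed (use hu in auto)
      then obtain t where t: "\<And>A. card A = Suc 0 \<Longrightarrow> homv (Suc i) (j - 1) (t A)"
        and t': "\<And>A b. card A = 0 \<Longrightarrow> b < r i \<Longrightarrow> kdiff Var (\<lambda>B. t B b) A = u b" by auto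
      have "homv i (j - int 0 - 1) (\<lambda>a. \<Sum>b<r i. M i a b * t A b)" if "card A = Suc 0" for A
        using t(1)[OF that] by (intro homv_image) (simp add: homv_Suc)
      moreover have "kdiff Var (\<lambda>B. \<Sum>b<r i. M i a b * t B b) A = z A a" if "card A = 0" "a < rows i" for A a
        using that t'[OF that(1)] u[OF that(2)] by (simp add: kdiff_matrix)
      ultimately show False by (intro n[of "\<lambda>A a. \<Sum>b<r i. M i a b * t A b"] syz_image)
    qed
  qed
next
  assume "\<exists>b<r i. d i b = j"
  then obtain b where b: "b < r i" "d i b = j" by blast
  have *: "(\<Sum>c<r i. M i a c * (if c = b then 1 else 0)) = M i a b" for a
    using b by (simp add: if_distrib cong: if_cong)
  show "syz_hom i 0 j"
  proof (rule syz_homI[where z = "\<lambda>A a. M i a b"])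
    show "syz i (\<lambda>a. M i a b)" using syz_image[of i "\<lambda>c. if c = b then 1 else 0"] * by simp
    show "homv i (j - int 0) (\<lambda>a. M i a b)" using hom b by (auto simp: homv_def)
  next
    fix A :: "'v set" and a assume "Suc (card A) = 0"
    then show "kdiff Var (\<lambda>B. M i a b) A = 0" by simp
  next
    fix y :: "'v set \<Rightarrow> nat \<Rightarrow> ('v, 'k) poly_ring"
    assume y: "\<And>A. card A = Suc 0 \<Longrightarrow> syz i (y A)"
      and y0: "\<And>A a. card A = 0 \<Longrightarrow> a < rows i \<Longrightarrow> kdiff Var (\<lambda>B. y B a) A = M i a b"
    from y obtain u where u: "\<And>A a. card A = Suc 0 \<Longrightarrow> a < rows i \<Longrightarrow> y A a = (\<Sum>b<r i. M i a b * u A b)"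
      unfolding syz_def by metis
    \<comment> \<open>If column \<open>b\<close> were a combination of columns with coefficients in
      the irrelevant ideal, \<open>w\<close> would be a syzygy whose entry \<open>b\<close> has
      constant term 1, against minimality.\<close>
    define w where "w c = (if c = b then 1 else 0) - kdiff Var (\<lambda>B. u B c) {}" for c
    have "(\<Sum>c<r i. M i a c * w c) = 0" if a: "a < rows i" for a
    proof -
      have "(\<Sum>c<r i. M i a c * w c) = M i a b - kdiff Var (\<lambda>B. \<Sum>c<r i. M i a c * u B c) {}"
        unfolding w_def right_diff_distrib sum_subtractf kdiff_matrix * ..
      also have "kdiff Var (\<lambda>B. \<Sum>c<r i. M i a c * u B c) {} = kdiff Var (\<lambda>B. y B a) {}"
        by (intro kdiff_cong) (use u a in simp)
      finally show ?thesis using y0[of "{}", OF _ a] by simp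
    qed
    then have "syz (Suc i) w" by (simp add: syz_Suc)
    then have "lookup (w b) 0 = 0" using b by (intro syz_imp_lookup_zero)
    moreover have "lookup (kdiff Var (\<lambda>B. u B b) {}) 0 = 0"
      by (simp add: kdiff_def lookup_sum lookup_ksgn_mult lookup_Var_mult mult.assoc)
    ultimately show False by (simp add: w_def lookup_minus)
  qed
qed

text \<open>The Koszul complex of a monomial ideal splits by multidegree, and the summand of
  multidegree \<open>a\<close> is the scalar complex on \<open>kcx T a\<close>.\<close>

lemma syz_hom_monomial_ideal:
  assumes "J = mon T"
  shows "syz_hom 0 p j \<longleftrightarrow> (\<exists>a. int (monom_degree a) = j \<and> khom TYPE('k) (kcx T a) p)" (is "?L \<longleftrightarrow> ?R")
proof
  have syz0: "syz 0 y \<longleftrightarrow> y 0 \<in> mon T" for y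
    using image_0[of "y 0"] by (simp add: syz_def rows_0 assms)
  have homv0: "homv 0 e y \<longleftrightarrow> homogeneous (y 0) e" for e y
    by (simp add: homv_def rows_0 row_shift_def)
  {
    assume h: ?L
    show ?R
    proof (rule syz_homE[OF h])
      fix z :: "'v set \<Rightarrow> nat \<Rightarrow> ('v, 'k) poly_ring"
      assume z': "\<And>A. card A = p \<Longrightarrow> syz 0 (z A)" "\<And>A. card A = p \<Longrightarrow> homv 0 (j - int p) (z A)"
          "\<And>A a. Suc (card A) = p \<Longrightarrow> a < rows 0 \<Longrightarrow> kdiff Var (\<lambda>B. z B a) A = 0"
        and n: "\<And>y. (\<And>A. card A = Suc p \<Longrightarrow> syz 0 (y A)) \<Longrightarrow>
          (\<And>A. card A = Suc p \<Longrightarrow> homv 0 (j - int p - 1) (y A)) \<Longrightarrow>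
          (\<And>A a. card A = p \<Longrightarrow> a < rows 0 \<Longrightarrow> kdiff Var (\<lambda>B. y B a) A = z A a) \<Longrightarrow> False"
      define x where "x A = z A 0" for A
      have z: "\<And>A. card A = p \<Longrightarrow> x A \<in> mon T" "\<And>A. card A = p \<Longrightarrow> homogeneous (x A) (j - int p)"
        "\<And>A. Suc (card A) = p \<Longrightarrow> kdiff Var x A = 0"
        using z' by (simp_all add: syz0 homv0 rows_0 x_def[abs_def])
      show ?R
      proof (rule ccontr)
        assume no: "\<not> ?R"
        have ex: "\<exists>e. kchain (kcx T a) (Suc p) e \<and> (\<forall>A. sdiff e A = kcut p (kcoef x a) A)"
          if "int (monom_degree a) = j" for a
        proof -
          have "\<not> khom TYPE('k) (kcx T a) p" using no that by blast
          moreover have "kchain (kcx T a) p (kcut p (kcoef x a))"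
            using z(1) by (auto simp: kchain_def kcut_def kcoef_def kcx_def mon_iff split: if_splits)
          moreover have "sdiff (kcut p (kcoef x a)) A = 0" for A
            using z(3)[of A] by (auto simp: kdiff_kcut kcoef_kdiff[symmetric]) (simp add: kcoef_def)
          ultimately show ?thesis unfolding khom_def by blast
        qed
        have "\<exists>y. (\<forall>A. card A = Suc p \<longrightarrow> y A \<in> mon T \<and> homogeneous (y A) (j - int p - 1)) \<and>
            (\<forall>A. card A = p \<longrightarrow> kdiff Var y A = x A)"
          by (rule koszul_assemble) (fact z(2) ex)+
        then obtain y where y: "(\<forall>A. card A = Suc p \<longrightarrow> y A \<in> mon T \<and> homogeneous (y A) (j - int p - 1)) \<and>
            (\<forall>A. card A = p \<longrightarrow> kdiff Var y A = x A)" ..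
        show False
          by (rule n[of "\<lambda>A _. y A"]) (use y in \<open>simp_all add: syz0 homv0 rows_0 x_def\<close>)
      qed
    qed
  }
  assume ?R
  then obtain a where a: "int (monom_degree a) = j" and "khom TYPE('k) (kcx T a) p" by blast
  then obtain c :: "'v set \<Rightarrow> 'k" where c: "kchain (kcx T a) p c" "\<And>A. sdiff c A = 0"
    "\<not> (\<exists>e. kchain (kcx T a) (Suc p) e \<and> (\<forall>A. sdiff e A = c A))"
    unfolding khom_def by blast
  \<comment> \<open>The scalar cycle \<open>c\<close> placed in multidegree \<open>a\<close>; by
    \<open>kz\<close> it has no other component.\<close>
  define z where "z A = monomial (a - ind A) (c A)" for A
  have supp: "c A \<noteq> 0 \<Longrightarrow> dvds (ind A) a \<and> a - ind A \<in> T \<and> card A = p" for A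
    using c(1) by (auto simp: kchain_def kcx_def)
  have kz: "kcoef z b A = (if a = b then c A else 0)" for b A
  proof (cases "a = b \<or> \<not> dvds (ind A) b \<or> c A = 0")
    case True
    then show ?thesis using supp[of A] by (auto simp: kcoef_def z_def)
  next
    case False
    then have "a - ind A \<noteq> b - ind A"
      using dvds_imp_eq_add[of "ind A" a] dvds_imp_eq_add[of "ind A" b] supp[of A] by metis
    then show ?thesis using False by (simp add: kcoef_def z_def lookup_single_not_eq)
  qed
  show ?L
  proof (rule syz_homI[where z = "\<lambda>A _. z A"])
    fix A :: "'v set"
    show "syz 0 (\<lambda>_. z A)" using supp[of A] by (auto simp: syz0 z_def mon_iff lookup_single when_def)
    show "homv 0 (j - int p) (\<lambda>_. z A)"
      using supp[of A] monom_degree_minus[of "ind A" a] a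
      by (auto simp: homv0 z_def homogeneous_iff lookup_single when_def)
  next
    fix A :: "'v set"
    show "kdiff Var (\<lambda>B. z B) A = 0"
    proof (rule poly_mapping_eqI)
      fix t
      have "lookup (kdiff Var z A) t = sdiff (kcoef z (t + ind A)) A"
        using kcoef_kdiff[of z "t + ind A" A] by (simp add: kcoef_def)
      also have "\<dots> = 0" using c(2)[of A] by (cases "a = t + ind A") (simp_all add: kz[abs_def])
      finally show "lookup (kdiff Var (\<lambda>B. z B) A) t = lookup 0 t" by simp
    qed
  next
    fix x :: "'v set \<Rightarrow> nat \<Rightarrow> ('v, 'k) poly_ring"
    assume x: "\<And>A. card A = Suc p \<Longrightarrow> syz 0 (x A)" "\<And>A. card A = Suc p \<Longrightarrow> homv 0 (j - int p - 1) (x A)"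
      "\<And>A a. card A = p \<Longrightarrow> a < rows 0 \<Longrightarrow> kdiff Var (\<lambda>B. x B a) A = z A"
    define y where "y A = x A 0" for A
    have y: "\<And>A. card A = Suc p \<Longrightarrow> y A \<in> mon T" "\<And>A. card A = p \<Longrightarrow> kdiff Var y A = z A"
      using x(1,3) by (simp_all add: syz0 rows_0 y_def[abs_def])
    have "kchain (kcx T a) (Suc p) (kcut (Suc p) (kcoef y a))"
      using y(1) by (auto simp: kchain_def kcut_def kcoef_def kcx_def mon_iff split: if_splits)
    moreover have "sdiff (kcut (Suc p) (kcoef y a)) A = c A" for A
    proof (cases "card A = p")
      case True
      then show ?thesis using y(2)[OF True] kz[of a A]
        by (auto simp: kdiff_kcut kcoef_kdiff[symmetric]) (auto simp: kcoef_def split: if_splits)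
    next
      case False
      then show ?thesis using supp[of A] by (auto simp: kdiff_kcut)
    qed
    ultimately show False using c(3) by blast
  qed
qed

text \<open>The right-hand side does not mention the resolution. So all minimal resolutions share
  the same sets of shifts, which is all that regularity depends on.\<close>

lemma shift_iff:
  assumes "J = mon T"
  shows "(\<exists>b<r i. d i b = j) \<longleftrightarrow> (\<exists>a. int (monom_degree a) = j \<and> khom TYPE('k) (kcx T a) i)"
  using syz_hom_0[of i j] syz_hom_shift[of i 0 j] syz_hom_monomial_ideal[OF assms, of i j] by simp

end

section \<open>Dickson's lemma\<close>

text \<open>Subsequences are refined one coordinate at a time; monotonicity in the coordinates
  already treated is inherited.\<close>

lemma dickson_subseq:
  fixes f :: "nat \<Rightarrow> 'a \<Rightarrow> nat"
  assumes "finite S"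
  shows "\<exists>\<phi> :: nat \<Rightarrow> nat. strict_mono \<phi> \<and> (\<forall>a\<in>S. mono (\<lambda>n. f (\<phi> n) a))"
  using assms
proof (induction S rule: finite_induct)
  case empty
  show ?case by (intro exI[of _ "\<lambda>n. n"]) (simp add: strict_mono_def)
next
  case (insert a S)
  then obtain \<phi> :: "nat \<Rightarrow> nat" where \<phi>: "strict_mono \<phi>" "\<forall>a\<in>S. mono (\<lambda>n. f (\<phi> n) a)" by blast
  define g where "g n = f (\<phi> n) a" for n
  obtain \<psi> :: "nat \<Rightarrow> nat" where \<psi>: "strict_mono \<psi>" "monoseq (\<lambda>n. g (\<psi> n))"
    using seq_monosub[of g] by blast
  have "\<exists>\<chi> :: nat \<Rightarrow> nat. strict_mono \<chi> \<and> mono (\<lambda>n. g (\<chi> n))"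
  proof (cases "incseq (\<lambda>n. g (\<psi> n))")
    case True
    then show ?thesis using \<psi>(1) by blast
  next
    case False
    then have dec: "decseq (\<lambda>n. g (\<psi> n))" using \<psi>(2) by (simp add: monoseq_iff)
    \<comment> \<open>A weakly decreasing sequence of naturals is constant from the index of its
      least value on.\<close>
    obtain N where N: "\<And>n. g (\<psi> N) \<le> g (\<psi> n)"
      using ex_has_least_nat[of "\<lambda>_. True" 0 "\<lambda>n. g (\<psi> n)"] by auto
    have "g (\<psi> (N + n)) = g (\<psi> N)" for n
      using N[of "N + n"] decseqD[OF dec, of N "N + n"] by simp
    then have "mono (\<lambda>n. g (\<psi> (N + n)))" by (simp add: mono_def)
    moreover have "strict_mono (\<lambda>n. \<psi> (N + n))" using \<psi>(1) by (simp add: strict_mono_def)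
    ultimately show ?thesis by (intro exI[of _ "\<lambda>n. \<psi> (N + n)"]) simp
  qed
  then obtain \<chi> :: "nat \<Rightarrow> nat" where \<chi>: "strict_mono \<chi>" "mono (\<lambda>n. g (\<chi> n))" by blast
  have "mono (\<lambda>n. f (\<phi> (\<chi> n)) b)" if "b \<in> insert a S" for b
    using that
  proof
    assume "b = a"
    then show ?thesis using \<chi>(2) by (simp add: g_def)
  next
    assume "b \<in> S"
    then have "mono (\<lambda>n. f (\<phi> n) b)" using \<phi>(2) by blast
    then show ?thesis using strict_mono_mono[OF \<chi>(1)] by (simp add: mono_def)
  qed
  moreover have "strict_mono (\<lambda>n. \<phi> (\<chi> n))" using \<phi>(1) \<chi>(1) by (simp add: strict_mono_def)
  ultimately show ?case by blast
qed

lemma dickson_pair: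
  fixes f :: "nat \<Rightarrow> 'a::finite \<Rightarrow> nat"
  shows "\<exists>i j. i < j \<and> f i \<le> f j"
proof -
  obtain \<phi> :: "nat \<Rightarrow> nat" where \<phi>: "strict_mono \<phi>" "\<forall>a. mono (\<lambda>n. f (\<phi> n) a)"
    using dickson_subseq[of UNIV f] by auto
  have "\<phi> 0 < \<phi> 1" using \<phi>(1) by (simp add: strict_mono_def)
  moreover have "f (\<phi> 0) \<le> f (\<phi> 1)" using \<phi>(2) by (simp add: le_fun_def mono_def)
  ultimately show ?thesis by blast
qed

lemma dickson_antichain_finite:
  fixes S :: "'b set" and h :: "'b \<Rightarrow> 'a::finite \<Rightarrow> nat"
  assumes "\<And>s t. s \<in> S \<Longrightarrow> t \<in> S \<Longrightarrow> h s \<le> h t \<Longrightarrow> s = t"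
  shows "finite S"
proof (rule ccontr)
  assume "infinite S"
  then obtain f :: "nat \<Rightarrow> 'b" where f: "inj f" "range f \<subseteq> S"
    using infinite_countable_subset by blast
  obtain i j where "i < j" "h (f i) \<le> h (f j)" using dickson_pair[of "\<lambda>n. h (f n)"] by blast
  then show False using assms[of "f i" "f j"] f by (auto dest: injD)
qed

lemma dickson:
  fixes S :: "('a::finite \<Rightarrow> nat) set"
  shows "\<exists>F. finite F \<and> F \<subseteq> S \<and> (\<forall>s\<in>S. \<exists>t\<in>F. t \<le> s)"
proof -
  define F where "F = {t \<in> S. \<forall>s\<in>S. s \<le> t \<longrightarrow> s = t}"
  have "finite F"
    by (rule dickson_antichain_finite[of _ id]) (auto simp: F_def)
  moreover have "\<exists>t\<in>F. t \<le> s" if "s \<in> S" for s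
    using that
  proof (induction "sum s UNIV" arbitrary: s rule: less_induct)
    case less
    show ?case
    proof (cases "s \<in> F")
      case False
      then obtain t where t: "t \<in> S" "t \<le> s" "t \<noteq> s" using less.prems by (auto simp: F_def)
      then obtain a where "t a \<noteq> s a" by blast
      then have "t a < s a" using t(2) by (simp add: le_fun_def less_le)
      then have "sum t UNIV < sum s UNIV"
        using t(2) by (intro sum_strict_mono_ex1) (auto simp: le_fun_def)
      then show ?thesis using less.hyps[of t] t by (meson order_trans)
    qed auto
  qed
  ultimately show ?thesis by (intro exI[of _ F]) (auto simp: F_def)
qed

lemma dickson_expo:
  fixes S :: "('v::finite \<Rightarrow>\<^sub>0 nat) set"
  shows "\<exists>F. finite F \<and> F \<subseteq> S \<and> (\<forall>s\<in>S. \<exists>t\<in>F. dvds t s)"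
proof -
  obtain F where F: "finite F" "F \<subseteq> lookup ` S" "\<forall>s\<in>lookup ` S. \<exists>t\<in>F. t \<le> s"
    using dickson[of "lookup ` S"] by blast
  then obtain G where G: "finite G" "G \<subseteq> S" "F = lookup ` G"
    by (metis finite_subset_image)
  show ?thesis
    using F(3) G by (intro exI[of _ G]) (auto simp: dvds_def le_fun_def)
qed

section \<open>Minimal generators of multigraded modules\<close>

text \<open>A multigraded submodule of a free module of finite rank is encoded by the family of its
  coefficient spaces: \<open>Z \<delta>\<close> consists of the coefficient vectors of the elements of multidegree
  \<open>\<delta>\<close>, and multiplication by monomials becomes inclusion.\<close>

definition mgraded :: "(('v::finite \<Rightarrow>\<^sub>0 nat) \<Rightarrow> (nat \<Rightarrow> 'k::field) set) \<Rightarrow> bool"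
  where "mgraded Z \<longleftrightarrow> (\<exists>m. \<forall>\<delta>. \<forall>u\<in>Z \<delta>. \<forall>b\<ge>m. u b = 0) \<and> (\<forall>\<delta>. (\<lambda>_. 0) \<in> Z \<delta>) \<and>
    (\<forall>\<delta> c. \<forall>u\<in>Z \<delta>. \<forall>u'\<in>Z \<delta>. (\<lambda>b. u b + c * u' b) \<in> Z \<delta>) \<and>
    (\<forall>\<delta> \<delta>'. dvds \<delta> \<delta>' \<longrightarrow> Z \<delta> \<subseteq> Z \<delta>')"

lemma mgraded_axpy: "mgraded Z \<Longrightarrow> u \<in> Z \<delta> \<Longrightarrow> u' \<in> Z \<delta> \<Longrightarrow> (\<lambda>b. u b + c * u' b) \<in> Z \<delta>"
  by (auto simp: mgraded_def)

lemma mgraded_mono: "mgraded Z \<Longrightarrow> u \<in> Z \<delta> \<Longrightarrow> dvds \<delta> \<delta>' \<Longrightarrow> u \<in> Z \<delta>'"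
  unfolding mgraded_def by blast

lemma mgraded_zero: "mgraded Z \<Longrightarrow> (\<lambda>_. 0) \<in> Z \<delta>"
  by (simp add: mgraded_def)

lemma mgraded_sum:
  assumes "mgraded Z" "finite S" "\<And>s. s \<in> S \<Longrightarrow> c s \<noteq> 0 \<Longrightarrow> u s \<in> Z \<delta>"
  shows "(\<lambda>a. \<Sum>s\<in>S. c s * u s a) \<in> Z \<delta>"
  using assms(2,3)
proof (induction S rule: finite_induct)
  case empty
  then show ?case using mgraded_zero[OF assms(1)] by simp
next
  case (insert s S)
  then have IH: "(\<lambda>a. \<Sum>s\<in>S. c s * u s a) \<in> Z \<delta>" by simp
  show ?case
  proof (cases "c s = 0")
    case False
    then show ?thesis
      using insert mgraded_axpy[OF assms(1) IH, of "u s" "c s"] by (simp add: add.commute)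
  qed (use insert IH in simp)
qed

definition generates :: "(('v::finite \<Rightarrow>\<^sub>0 nat) \<times> (nat \<Rightarrow> 'k::field)) set \<Rightarrow>
    (('v \<Rightarrow>\<^sub>0 nat) \<Rightarrow> (nat \<Rightarrow> 'k) set) \<Rightarrow> bool"
  where "generates G Z \<longleftrightarrow> finite G \<and> (\<forall>g\<in>G. snd g \<in> Z (fst g)) \<and>
    (\<forall>\<delta>. \<forall>u\<in>Z \<delta>. \<exists>c. (\<forall>g\<in>G. c g \<noteq> 0 \<longrightarrow> dvds (fst g) \<delta>) \<and> (\<forall>b. u b = (\<Sum>g\<in>G. c g * snd g b)))"

lemma ex_generates:
  fixes Z :: "('v::finite \<Rightarrow>\<^sub>0 nat) \<Rightarrow> (nat \<Rightarrow> 'k::field) set"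
  assumes Z: "mgraded Z"
  shows "\<exists>G. generates G Z"
proof -
  from Z[unfolded mgraded_def, THEN conjunct1] obtain m where "\<forall>\<delta>. \<forall>u\<in>Z \<delta>. \<forall>b\<ge>m. u b = 0" ..
  then have m: "\<And>\<delta> u b. u \<in> Z \<delta> \<Longrightarrow> b \<ge> m \<Longrightarrow> u b = 0" by blast
  \<comment> \<open>Division by leading positions: \<open>S l\<close> is an order filter, so finitely many elements with leading
    position \<open>l\<close> suffice to cancel that coefficient.\<close>
  define S where "S l = {\<gamma>. \<exists>u\<in>Z \<gamma>. u l \<noteq> 0 \<and> (\<forall>b<l. u b = 0)}" for l
  have "\<forall>l. \<exists>F. finite F \<and> F \<subseteq> S l \<and> (\<forall>s\<in>S l. \<exists>t\<in>F. dvds t s)"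
    using dickson_expo by blast
  from choice[OF this] obtain F where "\<forall>l. finite (F l) \<and> F l \<subseteq> S l \<and> (\<forall>s\<in>S l. \<exists>t\<in>F l. dvds t s)" ..
  then have F: "\<And>l. finite (F l)" "\<And>l. F l \<subseteq> S l" "\<And>l s. s \<in> S l \<Longrightarrow> \<exists>t\<in>F l. dvds t s"
    by blast+
  define U where "U l \<gamma> = (SOME u. u \<in> Z \<gamma> \<and> u l \<noteq> 0 \<and> (\<forall>b<l. u b = 0))" for l \<gamma>
  have "U l \<gamma> \<in> Z \<gamma> \<and> U l \<gamma> l \<noteq> 0 \<and> (\<forall>b<l. U l \<gamma> b = 0)" if "\<gamma> \<in> S l" for l \<gamma>
    unfolding U_def by (rule someI_ex[of "\<lambda>u. u \<in> Z \<gamma> \<and> u l \<noteq> 0 \<and> (\<forall>b<l. u b = 0)"]) (use that in \<open>auto simp: S_def\<close>)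
  then have U: "\<And>l \<gamma>. \<gamma> \<in> S l \<Longrightarrow> U l \<gamma> \<in> Z \<gamma>" "\<And>l \<gamma>. \<gamma> \<in> S l \<Longrightarrow> U l \<gamma> l \<noteq> 0"
    "\<And>l \<gamma> b. \<gamma> \<in> S l \<Longrightarrow> b < l \<Longrightarrow> U l \<gamma> b = 0" by blast+
  define G where "G = (\<Union>l<m. (\<lambda>\<gamma>. (\<gamma>, U l \<gamma>)) ` F l)"
  have fin: "finite G" using F(1) by (simp add: G_def)
  \<comment> \<open>Induction on the number of positions that may still be nonzero: the first
    \<open>m - n\<close> entries of \<open>u\<close> are already cleared.\<close>
  have gen: "\<exists>c. (\<forall>g\<in>G. c g \<noteq> 0 \<longrightarrow> dvds (fst g) \<delta>) \<and> (\<forall>b. u b = (\<Sum>g\<in>G. c g * snd g b))"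
    if "u \<in> Z \<delta>" "\<forall>b<m-n. u b = 0" for n u \<delta>
    using that
  proof (induction n arbitrary: u)
    case 0
    then have "u b = 0" for b using m[of u \<delta> b] by (cases "b < m") auto
    then show ?case by (intro exI[of _ "\<lambda>_. 0"]) simp
  next
    case (Suc n)
    show ?case
    proof (cases "Suc n \<le> m \<and> u (m - Suc n) \<noteq> 0")
      case False
      have "\<forall>b<m-n. u b = 0"
      proof (intro allI impI)
        fix b assume "b < m - n"
        then consider "b < m - Suc n" | "b = m - Suc n" "Suc n \<le> m" by linarith
        then show "u b = 0" using Suc.prems False by cases auto
      qed
      then show ?thesis using Suc by blast
    next
      case True
      define l where "l = m - Suc n"
      have l: "l < m" "m - n = Suc l" "u l \<noteq> 0" using True by (auto simp: l_def)
      have "\<delta> \<in> S l" using Suc.prems l by (auto simp: S_def l_def)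
      then obtain \<gamma> where \<gamma>: "\<gamma> \<in> F l" "dvds \<gamma> \<delta>" using F(3) by blast
      have \<gamma>S: "\<gamma> \<in> S l" using \<gamma> F(2) by blast
      let ?g = "(\<gamma>, U l \<gamma>)"
      define k where "k = u l / U l \<gamma> l"
      define u' where "u' b = u b + (- k) * U l \<gamma> b" for b
      have gG: "?g \<in> G" using \<gamma> l by (auto simp: G_def)
      have "u' \<in> Z \<delta>"
        unfolding u'_def using mgraded_axpy[OF Z Suc.prems(1) mgraded_mono[OF Z U(1)[OF \<gamma>S] \<gamma>(2)]] .
      moreover have "\<forall>b<m-n. u' b = 0"
        using l Suc.prems(2) U(2,3)[OF \<gamma>S] by (auto simp: u'_def k_def less_Suc_eq l_def[symmetric])
      ultimately obtain c where c: "\<forall>g\<in>G. c g \<noteq> 0 \<longrightarrow> dvds (fst g) \<delta>" "\<And>b. u' b = (\<Sum>g\<in>G. c g * snd g b)"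
        using Suc.IH by blast
      define c' where "c' g = c g + (if g = ?g then k else 0)" for g
      have "u b = (\<Sum>g\<in>G. c' g * snd g b)" for b
      proof -
        have "(\<Sum>g\<in>G. c' g * snd g b) = u' b + (\<Sum>g\<in>G. if g = ?g then k * snd g b else 0)"
          unfolding c(2) c'_def sum.distrib[symmetric] by (intro sum.cong) (auto simp: algebra_simps)
        also have "(\<Sum>g\<in>G. if g = ?g then k * snd g b else 0) = k * U l \<gamma> b"
          using gG fin by simp
        finally show ?thesis by (simp add: u'_def)
      qed
      moreover have "\<forall>g\<in>G. c' g \<noteq> 0 \<longrightarrow> dvds (fst g) \<delta>"
        using c(1) \<gamma>(2) by (auto simp: c'_def)
      ultimately show ?thesis by blast
    qed
  qed
  have "\<forall>g\<in>G. snd g \<in> Z (fst g)" using U(1) F(2) by (auto simp: G_def)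
  then have "generates G Z"
    unfolding generates_def using fin gen[where n = m] by auto
  then show ?thesis ..
qed

text \<open>Least cardinality suffices: in a relation of degree \<open>\<delta>\<close> with a nonzero coefficient at a generator
  of degree \<open>\<delta>\<close>, that generator could be dropped.\<close>

lemma ex_min_generates:
  fixes Z :: "('v::finite \<Rightarrow>\<^sub>0 nat) \<Rightarrow> (nat \<Rightarrow> 'k::field) set"
  assumes Z: "mgraded Z"
  shows "\<exists>G. generates G Z \<and> (\<forall>c \<delta>. (\<forall>g\<in>G. c g \<noteq> 0 \<longrightarrow> dvds (fst g) \<delta>) \<longrightarrow>
    (\<forall>b. (\<Sum>g\<in>G. c g * snd g b) = 0) \<longrightarrow> (\<forall>g\<in>G. c g \<noteq> 0 \<longrightarrow> fst g \<noteq> \<delta>))"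
proof -
  obtain G where G: "generates G Z" and least: "\<And>H. generates H Z \<Longrightarrow> card G \<le> card H"
    using ex_generates[OF Z] ex_has_least_nat[of "\<lambda>G. generates G Z" _ card] by blast
  have fin: "finite G" using G by (simp add: generates_def)
  have False if c: "\<forall>g\<in>G. c g \<noteq> 0 \<longrightarrow> dvds (fst g) \<delta>" "\<forall>b. (\<Sum>g\<in>G. c g * snd g b) = 0"
    and g0: "g0 \<in> G" "c g0 \<noteq> 0" "fst g0 = \<delta>" for c \<delta> g0
  proof -
    have "generates (G - {g0}) Z"
      unfolding generates_def
    proof (intro conjI allI ballI)
      fix \<delta>' u assume "u \<in> Z \<delta>'"
      then obtain e where e: "\<forall>g\<in>G. e g \<noteq> 0 \<longrightarrow> dvds (fst g) \<delta>'" "\<forall>b. u b = (\<Sum>g\<in>G. e g * snd g b)"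
        using G unfolding generates_def by blast
      define k where "k = e g0 / c g0"
      define e' where "e' g = e g - k * c g" for g
      have "u b = (\<Sum>g\<in>G - {g0}. e' g * snd g b)" for b
      proof -
        have "(\<Sum>g\<in>G. e' g * snd g b) = u b - k * (\<Sum>g\<in>G. c g * snd g b)"
          using e(2) by (simp add: e'_def left_diff_distrib sum_subtractf sum_distrib_left mult.assoc)
        also have "\<dots> = u b" using c(2) by simp
        finally have "u b = (\<Sum>g\<in>G. e' g * snd g b)" ..
        also have "\<dots> = (\<Sum>g\<in>G - {g0}. e' g * snd g b)"
          using fin g0 by (simp add: sum.remove e'_def k_def)
        finally show ?thesis .
      qed
      \<comment> \<open>The relation is subtracted only if \<open>e g0\<close> is nonzero; then its
        degree \<delta> divides \<delta>', so it introduces no inadmissible generator.\<close>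
      moreover have "dvds (fst g) \<delta>'" if "g \<in> G - {g0}" "e' g \<noteq> 0" for g
      proof (cases "e g = 0")
        case True
        then have "e g0 \<noteq> 0" "c g \<noteq> 0" using that(2) by (auto simp: e'_def k_def)
        then have "dvds \<delta> \<delta>'" "dvds (fst g) \<delta>" using e(1) c(1) g0 that(1) by auto
        then show ?thesis using dvds_trans by blast
      qed (use e(1) that in auto)
      ultimately show "\<exists>c. (\<forall>g\<in>G - {g0}. c g \<noteq> 0 \<longrightarrow> dvds (fst g) \<delta>') \<and>
          (\<forall>b. u b = (\<Sum>g\<in>G - {g0}. c g * snd g b))" by (intro exI[of _ e']) blast
    qed (use G fin in \<open>auto simp: generates_def\<close>)
    then show False using least[of "G - {g0}"] card_Diff1_less[OF fin g0(1)] by simp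
  qed
  then show ?thesis using G by (intro exI[of _ G]) blast
qed

text \<open>A list, so that positions can serve as column indices. The last conjunct is minimality
  in the form used later: a relation of degree \<delta> has no coefficient at a generator of degree
  \<delta>, that is, no constant entry.\<close>

definition min_gens :: "(('v::finite \<Rightarrow>\<^sub>0 nat) \<times> (nat \<Rightarrow> 'k::field)) list \<Rightarrow>
    (('v \<Rightarrow>\<^sub>0 nat) \<Rightarrow> (nat \<Rightarrow> 'k) set) \<Rightarrow> bool"
  where "min_gens L Z \<longleftrightarrow>
    (\<forall>b<length L. snd (L ! b) \<in> Z (fst (L ! b))) \<and>
    (\<forall>\<delta>. \<forall>u\<in>Z \<delta>. \<exists>c. (\<forall>b<length L. c b \<noteq> 0 \<longrightarrow> dvds (fst (L ! b)) \<delta>) \<and>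
      (\<forall>a. u a = (\<Sum>b<length L. c b * snd (L ! b) a))) \<and>
    (\<forall>\<delta> c. (\<forall>b<length L. c b \<noteq> 0 \<longrightarrow> dvds (fst (L ! b)) \<delta>) \<longrightarrow>
      (\<forall>a. (\<Sum>b<length L. c b * snd (L ! b) a) = 0) \<longrightarrow>
      (\<forall>b<length L. c b \<noteq> 0 \<longrightarrow> fst (L ! b) \<noteq> \<delta>))"

lemma ex_min_gens:
  fixes Z :: "('v::finite \<Rightarrow>\<^sub>0 nat) \<Rightarrow> (nat \<Rightarrow> 'k::field) set"
  assumes Z: "mgraded Z"
  shows "\<exists>L. min_gens L Z"
proof -
  obtain G where G: "generates G Z" and min: "\<And>c \<delta> g. (\<forall>g\<in>G. c g \<noteq> 0 \<longrightarrow> dvds (fst g) \<delta>) \<Longrightarrow>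
    (\<forall>b. (\<Sum>g\<in>G. c g * snd g b) = 0) \<Longrightarrow> g \<in> G \<Longrightarrow> c g \<noteq> 0 \<Longrightarrow> fst g \<noteq> \<delta>"
    using ex_min_generates[OF Z] by blast
  obtain L where L: "set L = G" "distinct L"
    using G finite_distinct_list[of G] by (auto simp: generates_def)
  have bij: "bij_betw ((!) L) {..<length L} G" using bij_betw_nth[OF L(2), of "{..<length L}" G] L by simp
  have nthG: "L ! b \<in> G" if "b < length L" for b using that L by auto
  have sum: "(\<Sum>b<length L. h (L ! b)) = sum h G" for h :: "_ \<Rightarrow> 'k"
    using sum.reindex_bij_betw[OF bij] by simp
  show ?thesis
    unfolding min_gens_def
  proof (intro exI[of _ L] conjI allI impI ballI)
    fix b assume "b < length L"
    then show "snd (L ! b) \<in> Z (fst (L ! b))" using G nthG by (simp add: generates_def)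
  next
    fix \<delta> u assume "u \<in> Z \<delta>"
    then obtain c where c: "\<forall>g\<in>G. c g \<noteq> 0 \<longrightarrow> dvds (fst g) \<delta>" "\<forall>b. u b = (\<Sum>g\<in>G. c g * snd g b)"
      using G unfolding generates_def by blast
    then show "\<exists>c. (\<forall>b<length L. c b \<noteq> 0 \<longrightarrow> dvds (fst (L ! b)) \<delta>) \<and>
        (\<forall>a. u a = (\<Sum>b<length L. c b * snd (L ! b) a))"
      using nthG sum[of "\<lambda>g. c g * snd g _"] by (intro exI[of _ "\<lambda>b. c (L ! b)"]) simp
  next
    fix \<delta> c b
    assume c: "\<forall>b<length L. c b \<noteq> 0 \<longrightarrow> dvds (fst (L ! b)) \<delta>"
      "\<forall>a. (\<Sum>b<length L. c b * snd (L ! b) a) = 0" and b: "b < length L" "c b \<noteq> 0"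
    define e where "e g = c (inv_into {..<length L} ((!) L) g)" for g
    have e: "e (L ! b) = c b" if "b < length L" for b
      using that bij inv_into_f_f[of "(!) L" "{..<length L}" b] by (simp add: e_def bij_betw_def)
    have "(\<Sum>g\<in>G. e g * snd g a) = 0" for a
      using c(2) e sum[of "\<lambda>g. e g * snd g a", symmetric] by simp
    moreover have "\<forall>g\<in>G. e g \<noteq> 0 \<longrightarrow> dvds (fst g) \<delta>"
    proof (intro ballI impI)
      fix g assume "g \<in> G" "e g \<noteq> 0"
      moreover from this obtain i where "i < length L" "g = L ! i" using L(1) by (metis in_set_conv_nth)
      ultimately show "dvds (fst g) \<delta>" using c(1) e by auto
    qed
    ultimately show "fst (L ! b) \<noteq> \<delta>" using min[of e \<delta> "L ! b"] e b nthG by simp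
  qed
qed

section \<open>Existence of minimal graded free resolutions of monomial ideals\<close>

text \<open>The relations of degree \<delta> among the generators, again as scalar vectors, so that
  the construction can be iterated. The scalar \<open>u b\<close> stands for \<open>u b\<close>
  times the monomial of exponent \<delta> minus the degree of generator \<open>b\<close>.\<close>

definition ker_family :: "(('v::finite \<Rightarrow>\<^sub>0 nat) \<times> (nat \<Rightarrow> 'k::field)) list \<Rightarrow> ('v \<Rightarrow>\<^sub>0 nat) \<Rightarrow> (nat \<Rightarrow> 'k) set"
  where "ker_family L \<delta> = {u. (\<forall>b. u b \<noteq> 0 \<longrightarrow> b < length L \<and> dvds (fst (L ! b)) \<delta>) \<and>
    (\<forall>a. (\<Sum>b<length L. u b * snd (L ! b) a) = 0)}"

lemma mgraded_ker_family: "mgraded (ker_family L)"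
  unfolding mgraded_def
proof (intro conjI allI ballI impI subsetI)
  show "\<exists>m. \<forall>\<delta>. \<forall>u\<in>ker_family L \<delta>. \<forall>b\<ge>m. u b = 0"
    by (rule exI[of _ "length L"]) (fastforce simp: ker_family_def)
  fix \<delta> :: "'a \<Rightarrow>\<^sub>0 nat" and c u u' assume u: "u \<in> ker_family L \<delta>" "u' \<in> ker_family L \<delta>"
  have "b < length L \<and> dvds (fst (L ! b)) \<delta>" if "u b + c * u' b \<noteq> 0" for b
  proof -
    have "u b \<noteq> 0 \<or> u' b \<noteq> 0" using that by auto
    then show ?thesis using u by (auto simp: ker_family_def)
  qed
  moreover have "(\<Sum>b<length L. (u b + c * u' b) * snd (L ! b) a) = 0" for a
  proof -
    have "(\<Sum>b<length L. (u b + c * u' b) * snd (L ! b) a) =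
      (\<Sum>b<length L. u b * snd (L ! b) a) + c * (\<Sum>b<length L. u' b * snd (L ! b) a)"
      by (simp add: algebra_simps sum.distrib sum_distrib_left)
    then show ?thesis using u by (simp add: ker_family_def)
  qed
  ultimately show "(\<lambda>b. u b + c * u' b) \<in> ker_family L \<delta>" by (simp add: ker_family_def)
next
  fix \<delta> \<delta>' :: "'a \<Rightarrow>\<^sub>0 nat" and u assume "dvds \<delta> \<delta>'" "u \<in> ker_family L \<delta>"
  then show "u \<in> ker_family L \<delta>'" using dvds_trans by (fastforce simp: ker_family_def)
qed (simp add: ker_family_def)

definition mono_entry :: "(nat \<Rightarrow> 'v \<Rightarrow>\<^sub>0 nat) \<Rightarrow> (('v::finite \<Rightarrow>\<^sub>0 nat) \<times> (nat \<Rightarrow> 'k::field)) list \<Rightarrow> nat \<Rightarrow> nat \<Rightarrow> ('v, 'k) poly_ring"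
  where "mono_entry \<rho> L a b = monomial (fst (L ! b) - \<rho> a) (snd (L ! b) a)"

text \<open>The basis vector with index \<open>a\<close> has multidegree \<open>\<rho> a\<close>;
  this extracts the part of \<open>v\<close> of multidegree \<delta> as a scalar vector.\<close>

definition vcoef :: "nat \<Rightarrow> (nat \<Rightarrow> 'v \<Rightarrow>\<^sub>0 nat) \<Rightarrow> (nat \<Rightarrow> ('v::finite, 'k::field) poly_ring) \<Rightarrow> ('v \<Rightarrow>\<^sub>0 nat) \<Rightarrow> nat \<Rightarrow> 'k"
  where "vcoef m \<rho> v \<delta> a = (if a < m \<and> dvds (\<rho> a) \<delta> then lookup (v a) (\<delta> - \<rho> a) else 0)"

abbreviation colcoef :: "(('v::finite \<Rightarrow>\<^sub>0 nat) \<times> (nat \<Rightarrow> 'k::field)) list \<Rightarrow> (nat \<Rightarrow> ('v, 'k) poly_ring) \<Rightarrow> ('v \<Rightarrow>\<^sub>0 nat) \<Rightarrow> nat \<Rightarrow> 'k"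
  where "colcoef L \<equiv> vcoef (length L) (\<lambda>b. fst (L ! b))"

text \<open>A multigraded map acts on each multidegree through one scalar matrix. Hypothesis
  \<open>U\<close> makes the truncated subtraction in \<open>mono_entry\<close> exact wherever the
  scalar is nonzero.\<close>

lemma vcoef_matrix:
  fixes L :: "(('v::finite \<Rightarrow>\<^sub>0 nat) \<times> (nat \<Rightarrow> 'k::field)) list"
  assumes U: "\<And>b a. b < length L \<Longrightarrow> snd (L ! b) a \<noteq> 0 \<Longrightarrow> a < m \<and> dvds (\<rho> a) (fst (L ! b))"
    and v: "\<And>a. a < m \<Longrightarrow> v a = (\<Sum>b<length L. mono_entry \<rho> L a b * y b)"
  shows "vcoef m \<rho> v \<delta> a = (\<Sum>b<length L. colcoef L y \<delta> b * snd (L ! b) a)"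
proof (cases "a < m \<and> dvds (\<rho> a) \<delta>")
  case True
  have "lookup (mono_entry \<rho> L a b * y b) (\<delta> - \<rho> a) = colcoef L y \<delta> b * snd (L ! b) a"
    if b: "b < length L" for b
  proof (cases "snd (L ! b) a = 0")
    case False
    then have d: "dvds (\<rho> a) (fst (L ! b))" using U b by blast
    then have "dvds (fst (L ! b) - \<rho> a) (\<delta> - \<rho> a) \<longleftrightarrow> dvds (fst (L ! b)) \<delta>"
      using True unfolding dvds_def lookup_minus by (metis diff_le_mono le_diff_iff)
    moreover have "\<delta> - \<rho> a - (fst (L ! b) - \<rho> a) = \<delta> - fst (L ! b)"
      using d True by (intro poly_mapping_eqI) (simp add: dvds_def lookup_minus)
    ultimately show ?thesis using b by (simp add: mono_entry_def lookup_single_mult vcoef_def mult.commute[of "snd (L ! b) a"])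
  qed (simp add: mono_entry_def)
  then show ?thesis using True v by (simp add: vcoef_def lookup_sum)
next
  case False
  have "colcoef L y \<delta> b * snd (L ! b) a = 0" if b: "b < length L" for b
  proof (rule ccontr)
    assume "colcoef L y \<delta> b * snd (L ! b) a \<noteq> 0"
    then have "snd (L ! b) a \<noteq> 0" "dvds (fst (L ! b)) \<delta>" by (auto simp: vcoef_def split: if_splits)
    then have "a < m" "dvds (\<rho> a) \<delta>" using U[OF b] dvds_trans by blast+
    then show False using False by simp
  qed
  then have "(\<Sum>b<length L. colcoef L y \<delta> b * snd (L ! b) a) = 0"
    by (intro sum.neutral) simp
  moreover have "vcoef m \<rho> v \<delta> a = 0" using False by (auto simp: vcoef_def)
  ultimately show ?thesis by simp
qed

lemma vcoef_add: "a < m \<Longrightarrow> vcoef m \<rho> v (t + \<rho> a) a = lookup (v a) t"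
  by (simp add: vcoef_def)

lemma image_family_iff:
  fixes L :: "(('v::finite \<Rightarrow>\<^sub>0 nat) \<times> (nat \<Rightarrow> 'k::field)) list"
  assumes Z: "mgraded Z" and L: "min_gens L Z"
    and supp: "\<And>\<delta> u a. u \<in> Z \<delta> \<Longrightarrow> u a \<noteq> 0 \<Longrightarrow> a < m \<and> dvds (\<rho> a) \<delta>"
  shows "(\<exists>y. \<forall>a<m. v a = (\<Sum>b<length L. mono_entry \<rho> L a b * y b)) \<longleftrightarrow> (\<forall>\<delta>. vcoef m \<rho> v \<delta> \<in> Z \<delta>)"
proof
  have LZ: "snd (L ! b) \<in> Z (fst (L ! b))" if "b < length L" for b
    using L that by (simp add: min_gens_def)
  have U: "a < m \<and> dvds (\<rho> a) (fst (L ! b))" if "b < length L" "snd (L ! b) a \<noteq> 0" for a b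
    using supp[OF LZ] that by blast
  {
    assume "\<exists>y. \<forall>a<m. v a = (\<Sum>b<length L. mono_entry \<rho> L a b * y b)"
    then obtain y where y: "\<forall>a<m. v a = (\<Sum>b<length L. mono_entry \<rho> L a b * y b)" ..
    show "\<forall>\<delta>. vcoef m \<rho> v \<delta> \<in> Z \<delta>"
    proof
      fix \<delta>
      have "vcoef m \<rho> v \<delta> = (\<lambda>a. \<Sum>b<length L. colcoef L y \<delta> b * snd (L ! b) a)"
        using vcoef_matrix[of L m \<rho> v y \<delta>] U y by blast
      also have "\<dots> \<in> Z \<delta>"
      proof (rule mgraded_sum[OF Z])
        fix b assume "b \<in> {..<length L}" "colcoef L y \<delta> b \<noteq> 0"
        then show "snd (L ! b) \<in> Z \<delta>"
          using mgraded_mono[OF Z LZ] by (auto simp: vcoef_def split: if_splits)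
      qed simp
      finally show "vcoef m \<rho> v \<delta> \<in> Z \<delta>" .
    qed
  }
  assume v: "\<forall>\<delta>. vcoef m \<rho> v \<delta> \<in> Z \<delta>"
  \<comment> \<open>The coefficients are chosen to be 0 in multidegrees where \<open>v\<close> has
    no part. This leaves finitely many nonzero ones, so that \<open>y\<close> below consists of
    polynomials.\<close>
  have ex: "\<exists>c. (\<forall>b<length L. c b \<noteq> 0 \<longrightarrow> dvds (fst (L ! b)) \<delta> \<and> vcoef m \<rho> v \<delta> \<noteq> (\<lambda>_. 0)) \<and>
      (\<forall>a. vcoef m \<rho> v \<delta> a = (\<Sum>b<length L. c b * snd (L ! b) a))" for \<delta>
  proof (cases "vcoef m \<rho> v \<delta> = (\<lambda>_. 0)")
    case True
    then show ?thesis by (intro exI[of _ "\<lambda>_. 0"]) simp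
  next
    case False
    then show ?thesis
      using L[unfolded min_gens_def, THEN conjunct2, THEN conjunct1, rule_format, OF v[rule_format, of \<delta>]]
      by blast
  qed
  from choice[OF allI, OF ex] obtain c where
    "\<forall>\<delta>. (\<forall>b<length L. c \<delta> b \<noteq> 0 \<longrightarrow> dvds (fst (L ! b)) \<delta> \<and> vcoef m \<rho> v \<delta> \<noteq> (\<lambda>_. 0)) \<and>
      (\<forall>a. vcoef m \<rho> v \<delta> a = (\<Sum>b<length L. c \<delta> b * snd (L ! b) a))" ..
  then have c: "\<And>\<delta> b. b < length L \<Longrightarrow> c \<delta> b \<noteq> 0 \<Longrightarrow> dvds (fst (L ! b)) \<delta>"
    "\<And>\<delta> b. b < length L \<Longrightarrow> c \<delta> b \<noteq> 0 \<Longrightarrow> vcoef m \<rho> v \<delta> \<noteq> (\<lambda>_. 0)"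
    "\<And>\<delta> a. vcoef m \<rho> v \<delta> a = (\<Sum>b<length L. c \<delta> b * snd (L ! b) a)" by blast+
  have fin: "finite {\<delta>. vcoef m \<rho> v \<delta> \<noteq> (\<lambda>_. 0)}"
  proof (rule finite_subset)
    show "{\<delta>. vcoef m \<rho> v \<delta> \<noteq> (\<lambda>_. 0)} \<subseteq> (\<Union>a<m. (\<lambda>t. t + \<rho> a) ` keys (v a))"
    proof
      fix \<delta> assume "\<delta> \<in> {\<delta>. vcoef m \<rho> v \<delta> \<noteq> (\<lambda>_. 0)}"
      then obtain a where "vcoef m \<rho> v \<delta> a \<noteq> 0" by force
      then have a: "a < m" "dvds (\<rho> a) \<delta>" "\<delta> - \<rho> a \<in> keys (v a)"
        by (auto simp: vcoef_def in_keys_iff split: if_splits)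
      then have "\<delta> \<in> (\<lambda>t. t + \<rho> a) ` keys (v a)"
        using dvds_imp_eq_add[of "\<rho> a" \<delta>] by (metis image_eqI)
      then show "\<delta> \<in> (\<Union>a<m. (\<lambda>t. t + \<rho> a) ` keys (v a))" using a(1) by blast
    qed
  qed simp
  define y where "y b = Abs_poly_mapping (\<lambda>t. if b < length L then c (t + fst (L ! b)) b else 0)" for b
  have y: "lookup (y b) t = c (t + fst (L ! b)) b" if "b < length L" for b t
  proof -
    have "{t. c (t + fst (L ! b)) b \<noteq> 0} \<subseteq> (\<lambda>t. t + fst (L ! b)) -` {\<delta>. vcoef m \<rho> v \<delta> \<noteq> (\<lambda>_. 0)}"
      using c(2)[OF that] by auto
    moreover have "finite ((\<lambda>t. t + fst (L ! b)) -` {\<delta>. vcoef m \<rho> v \<delta> \<noteq> (\<lambda>_. 0)})"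
      by (rule finite_vimageI[OF fin]) (simp add: inj_on_def)
    ultimately have "finite {t. c (t + fst (L ! b)) b \<noteq> 0}" using finite_subset by blast
    then show ?thesis using that by (simp add: y_def)
  qed
  have yc: "colcoef L y \<delta> b = c \<delta> b" if "b < length L" for b \<delta>
  proof (cases "dvds (fst (L ! b)) \<delta>")
    case True
    then show ?thesis using that y[OF that] dvds_imp_eq_add[OF True] by (simp add: vcoef_def)
  next
    case False
    then show ?thesis using c(1)[OF that] by (auto simp: vcoef_def)
  qed
  show "\<exists>y. \<forall>a<m. v a = (\<Sum>b<length L. mono_entry \<rho> L a b * y b)"
  proof (intro exI[of _ y] allI impI poly_mapping_eqI)
    fix a t assume a: "a < m"
    let ?w = "\<lambda>a. \<Sum>b<length L. mono_entry \<rho> L a b * y b"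
    have "lookup (v a) t = vcoef m \<rho> v (t + \<rho> a) a" using a by (simp add: vcoef_add)
    also have "\<dots> = (\<Sum>b<length L. colcoef L y (t + \<rho> a) b * snd (L ! b) a)"
      using c(3) yc by simp
    also have "\<dots> = vcoef m \<rho> ?w (t + \<rho> a) a" by (rule vcoef_matrix[symmetric]) (use U in auto)
    also have "\<dots> = lookup (?w a) t" using a by (rule vcoef_add)
    finally show "lookup (v a) t = lookup (?w a) t" .
  qed
qed

lemma kernel_family_iff:
  fixes L :: "(('v::finite \<Rightarrow>\<^sub>0 nat) \<times> (nat \<Rightarrow> 'k::field)) list"
  assumes U: "\<And>b a. b < length L \<Longrightarrow> snd (L ! b) a \<noteq> 0 \<Longrightarrow> a < m \<and> dvds (\<rho> a) (fst (L ! b))"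
  shows "(\<forall>a<m. (\<Sum>b<length L. mono_entry \<rho> L a b * y b) = 0) \<longleftrightarrow>
    (\<forall>\<delta>. colcoef L y \<delta> \<in> ker_family L \<delta>)"
proof -
  let ?w = "\<lambda>a. \<Sum>b<length L. mono_entry \<rho> L a b * y b"
  let ?y = "colcoef L y"
  have "(\<forall>a<m. ?w a = 0) \<longleftrightarrow> (\<forall>\<delta> a. vcoef m \<rho> ?w \<delta> a = 0)"
  proof
    assume r: "\<forall>\<delta> a. vcoef m \<rho> ?w \<delta> a = 0"
    show "\<forall>a<m. ?w a = 0"
    proof (intro allI impI poly_mapping_eqI)
      fix a t assume "a < m"
      then show "lookup (?w a) t = lookup 0 t" using vcoef_add[of a m \<rho> ?w t] r by simp
    qed
  qed (simp add: vcoef_def)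
  also have "\<dots> \<longleftrightarrow> (\<forall>\<delta> a. (\<Sum>b<length L. ?y \<delta> b * snd (L ! b) a) = 0)"
    using vcoef_matrix[of L m \<rho> ?w y] U by simp
  also have "\<dots> \<longleftrightarrow> (\<forall>\<delta>. ?y \<delta> \<in> ker_family L \<delta>)"
    by (auto simp: ker_family_def) (auto simp: vcoef_def split: if_splits)
  finally show ?thesis .
qed

definition ideal_family :: "('v::finite \<Rightarrow>\<^sub>0 nat) set \<Rightarrow> ('v \<Rightarrow>\<^sub>0 nat) \<Rightarrow> (nat \<Rightarrow> 'k::field) set"
  where "ideal_family T \<delta> = {u. \<forall>a. u a \<noteq> 0 \<longrightarrow> a = 0 \<and> \<delta> \<in> T}"

lemma mgraded_ideal_family:
  fixes T :: "('v::finite \<Rightarrow>\<^sub>0 nat) set"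
  assumes "up_closed T"
  shows "mgraded (ideal_family T :: _ \<Rightarrow> (nat \<Rightarrow> 'k::field) set)"
  unfolding mgraded_def
proof (intro conjI allI ballI impI subsetI)
  show "\<exists>m. \<forall>\<delta>. \<forall>u\<in>ideal_family T \<delta>. \<forall>b\<ge>m. u b = (0 :: 'k)"
    by (rule exI[of _ 1]) (fastforce simp: ideal_family_def)
  fix \<delta> :: "'v \<Rightarrow>\<^sub>0 nat" and c :: 'k and u u' :: "nat \<Rightarrow> 'k" assume "u \<in> ideal_family T \<delta>" "u' \<in> ideal_family T \<delta>"
  then show "(\<lambda>b. u b + c * u' b) \<in> ideal_family T \<delta>"
    unfolding ideal_family_def mem_Collect_eq by (metis add.left_neutral mult_zero_right)
next
  fix \<delta> \<delta>' :: "'v \<Rightarrow>\<^sub>0 nat" and u :: "nat \<Rightarrow> 'k" assume "dvds \<delta> \<delta>'" "u \<in> ideal_family T \<delta>"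
  then show "u \<in> ideal_family T \<delta>'" using up_closedD[OF assms] by (auto simp: ideal_family_def)
qed (simp add: ideal_family_def)

section \<open>Translation between matrices and systems of entries\<close>

lemma mult_mat_vec_vec:
  "A *\<^sub>v vec (dim_col A) v = vec (dim_row A) (\<lambda>a. \<Sum>b<dim_col A. A $$ (a, b) * v b)"
  by (intro eq_vecI) (auto simp: scalar_prod_def atLeast0LessThan intro!: sum.cong)

lemma mat_image_iff: "x \<in> mat_image A \<longleftrightarrow> (\<exists>u. x = A *\<^sub>v vec (dim_col A) u)"
proof
  assume "x \<in> mat_image A"
  then obtain w where w: "x = A *\<^sub>v w" "w \<in> carrier_vec (dim_col A)" by (auto simp: mat_image_def)
  then have "w = vec (dim_col A) (($) w)" by auto
  then show "\<exists>u. x = A *\<^sub>v vec (dim_col A) u" using w(1) by metis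
next
  assume "\<exists>u. x = A *\<^sub>v vec (dim_col A) u"
  then show "x \<in> mat_image A" unfolding mat_image_def by (metis (mono_tags, lifting) mem_Collect_eq vec_carrier)
qed

lemma mat_kernel_eq_image_iff:
  fixes A B :: "'a::comm_ring_1 mat"
  assumes B: "dim_row B = dim_col A"
  shows "mat_kernel A = mat_image B \<longleftrightarrow>
    (\<forall>v. (\<forall>a<dim_row A. (\<Sum>b<dim_col A. A $$ (a, b) * v b) = 0) \<longleftrightarrow>
      (\<exists>u. \<forall>b<dim_col A. v b = (\<Sum>e<dim_col B. B $$ (b, e) * u e)))"
proof -
  let ?n = "dim_col A"
  have k: "vec ?n v \<in> mat_kernel A \<longleftrightarrow> (\<forall>a<dim_row A. (\<Sum>b<?n. A $$ (a, b) * v b) = 0)" for v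
    unfolding mat_kernel_def mem_Collect_eq mult_mat_vec_vec by (auto simp: vec_eq_iff)
  have i: "vec ?n v \<in> mat_image B \<longleftrightarrow> (\<exists>u. \<forall>b<?n. v b = (\<Sum>e<dim_col B. B $$ (b, e) * u e))" for v
    unfolding mat_image_iff mult_mat_vec_vec using B by (simp add: vec_eq_iff)
  have c: "x \<in> mat_kernel A \<Longrightarrow> dim_vec x = ?n" "x \<in> mat_image B \<Longrightarrow> dim_vec x = ?n" for x
    using B by (auto simp: mat_kernel_def mat_image_def)
  have "mat_kernel A = mat_image B \<longleftrightarrow> (\<forall>v. vec ?n v \<in> mat_kernel A \<longleftrightarrow> vec ?n v \<in> mat_image B)"
  proof
    assume r: "\<forall>v. vec ?n v \<in> mat_kernel A \<longleftrightarrow> vec ?n v \<in> mat_image B"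
    have "x \<in> mat_kernel A \<longleftrightarrow> x \<in> mat_image B" for x
    proof (cases "dim_vec x = ?n")
      case True
      then have "x = vec ?n (($) x)" by auto
      then show ?thesis using r by metis
    qed (use c in blast)
    then show "mat_kernel A = mat_image B" by blast
  qed simp
  then show ?thesis unfolding k i .
qed

lemma mat_image_row_iff:
  fixes A :: "'a::comm_ring_1 mat"
  assumes "dim_row A = 1"
  shows "f \<in> {v $ 0 | v. v \<in> mat_image A} \<longleftrightarrow> (\<exists>u. f = (\<Sum>b<dim_col A. A $$ (0, b) * u b))"
proof -
  have "f \<in> {v $ 0 | v. v \<in> mat_image A} \<longleftrightarrow> (\<exists>u. f = (A *\<^sub>v vec (dim_col A) u) $ 0)"
    unfolding mem_Collect_eq mat_image_iff by blast
  then show ?thesis unfolding mult_mat_vec_vec using assms by simp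
qed

lemma minimal_resolution_iff:
  "minimal_graded_free_resolution J d A \<longleftrightarrow>
    min_graded_res J d (\<lambda>i a b. A i $$ (a, b)) (\<lambda>i. dim_col (A i)) (\<lambda>i. dim_row (A i))"
    (is "?L \<longleftrightarrow> ?R")
proof -
  let ?dims = "dim_row (A 0) = 1 \<and> (\<forall>i. dim_row (A (Suc i)) = dim_col (A i))"
  have l: "?L \<Longrightarrow> ?dims" unfolding minimal_graded_free_resolution_def graded_free_resolution_def by blast
  have r: "?R \<Longrightarrow> ?dims" by (simp add: min_graded_res_def)
  show ?thesis
  proof (cases ?dims)
    case True
    then have k: "mat_kernel (A i) = mat_image (A (Suc i)) \<longleftrightarrow>
      (\<forall>v. (\<forall>a<dim_row (A i). (\<Sum>b<dim_col (A i). A i $$ (a, b) * v b) = 0) \<longleftrightarrow>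
      (\<exists>u. \<forall>b<dim_col (A i). v b = (\<Sum>e<dim_col (A (Suc i)). A (Suc i) $$ (b, e) * u e)))" for i
      by (intro mat_kernel_eq_image_iff) simp
    have im: "{v $ 0 | v. v \<in> mat_image (A 0)} = J \<longleftrightarrow>
      (\<forall>f. f \<in> J \<longleftrightarrow> (\<exists>u. f = (\<Sum>b<dim_col (A 0). A 0 $$ (0, b) * u b)))"
      unfolding set_eq_iff mat_image_row_iff[OF conjunct1[OF True]] by blast
    show ?thesis
      unfolding minimal_graded_free_resolution_def graded_free_resolution_def min_graded_res_def
        irrelevant_ideal_iff k im
      using True by blast
  qed (use l r in blast)
qed

lemma min_graded_res_cong:
  assumes "min_graded_res J d M r q"
    and eq: "\<And>i a b. a < q i \<Longrightarrow> b < r i \<Longrightarrow> M' i a b = M i a b"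
  shows "min_graded_res J d M' r q"
proof -
  interpret min_graded_res J d M r q by fact
  have sum: "(\<Sum>b<r i. M' i a b * v b) = (\<Sum>b<r i. M i a b * v b)" if "a < q i" for i a v
    using eq that by (intro sum.cong) auto
  show ?thesis
  proof
    show "q 0 = 1" "q (Suc i) = r i" for i by (rule rows_0 rows_Suc)+
    show "homogeneous (M' i a b) (d i b - row_shift d i a)" if "a < q i" "b < r i" for i a b
      using hom eq that by simp
    show "f \<in> J \<longleftrightarrow> (\<exists>u. f = (\<Sum>b<r 0. M' 0 0 b * u b))" for f
      using image_0 sum[of 0 0] rows_0 by simp
    show "(\<forall>a<q i. (\<Sum>b<r i. M' i a b * v b) = 0) \<longleftrightarrow>
      (\<exists>u. \<forall>b<r i. v b = (\<Sum>e<r (Suc i). M' (Suc i) b e * u e))" for i v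
      using exact[of i v] sum[of _ i] sum[of _ "Suc i"] rows_Suc by simp
    show "lookup (M' (Suc i) a b) 0 = 0" if "a < q (Suc i)" "b < r (Suc i)" for i a b
      using minimal eq that by simp
  qed
qed

text \<open>Minimal generators of the ideal, then of their relations, and so on forever. Termination
  is not claimed: once a kernel vanishes, later modules may simply have rank 0.\<close>

lemma ex_minimal_resolution:
  fixes T :: "('v::finite \<Rightarrow>\<^sub>0 nat) set"
  assumes T: "up_closed T"
  shows "\<exists>d A. minimal_graded_free_resolution (mon T :: ('v, 'k::field) poly_ring set) d A"
proof -
  define gens where "gens Z = (SOME L. min_gens L Z)" for Z :: "('v \<Rightarrow>\<^sub>0 nat) \<Rightarrow> (nat \<Rightarrow> 'k) set"
  have gens: "min_gens (gens Z) Z" if "mgraded Z" for Z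
    unfolding gens_def using ex_min_gens[OF that] by (rule someI_ex)
  define L where "L = rec_nat (gens (ideal_family T)) (\<lambda>_ L. gens (ker_family L))"
  have L0: "L 0 = gens (ideal_family T)" and LS: "L (Suc i) = gens (ker_family (L i))" for i
    by (simp_all add: L_def)
  define Z where "Z i = (case i of 0 \<Rightarrow> ideal_family T | Suc j \<Rightarrow> ker_family (L j))" for i
  define m where "m i = (case i of 0 \<Rightarrow> 1 | Suc j \<Rightarrow> length (L j))" for i
  define \<rho> where "\<rho> i a = (case i of 0 \<Rightarrow> 0 | Suc j \<Rightarrow> fst (L j ! a))" for i a
  have Zg: "mgraded (Z i)" for i
    using mgraded_ideal_family[OF T] mgraded_ker_family by (cases i) (simp_all add: Z_def)
  have LZ: "min_gens (L i) (Z i)" for i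
    using gens[OF Zg[of i]] by (cases i) (simp_all add: Z_def L0 LS)
  have supp: "a < m i \<and> dvds (\<rho> i a) \<delta>" if "u \<in> Z i \<delta>" "u a \<noteq> 0" for i \<delta> u a
    using that by (cases i) (auto simp: Z_def m_def \<rho>_def ideal_family_def ker_family_def)
  have U: "a < m i \<and> dvds (\<rho> i a) (fst (L i ! b))" if "b < length (L i)" "snd (L i ! b) a \<noteq> 0" for i a b
    using supp[of "snd (L i ! b)"] LZ[of i] that by (auto simp: min_gens_def)
  define M where "M i a b = mono_entry (\<rho> i) (L i) a b" for i a b
  define d where "d i b = int (monom_degree (fst (L i ! b)))" for i b
  have "min_graded_res (mon T) d M (\<lambda>i. length (L i)) m"
  proof
    show "m 0 = 1" "m (Suc i) = length (L i)" for i by (simp_all add: m_def)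
  next
    fix a i b assume "a < m i" "b < length (L i)"
    have rs: "row_shift d i a = int (monom_degree (\<rho> i a))"
      by (cases i) (simp_all add: row_shift_def \<rho>_def d_def)
    show "homogeneous (M i a b) (d i b - row_shift d i a)"
    proof (cases "snd (L i ! b) a = 0")
      case False
      then have "dvds (\<rho> i a) (fst (L i ! b))" using U \<open>b < length (L i)\<close> by blast
      then show ?thesis using False monom_degree_minus[of "\<rho> i a" "fst (L i ! b)"]
        by (simp add: M_def mono_entry_def homogeneous_def rs d_def)
    qed (simp add: M_def mono_entry_def)
  next
    fix f :: "('v, 'k) poly_ring"
    have "(\<exists>u. f = (\<Sum>b<length (L 0). M 0 0 b * u b)) \<longleftrightarrow>
      (\<exists>u. \<forall>a<m 0. (\<lambda>_. f) a = (\<Sum>b<length (L 0). mono_entry (\<rho> 0) (L 0) a b * u b))"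
      by (simp add: m_def M_def)
    also have "\<dots> \<longleftrightarrow> (\<forall>\<delta>. vcoef (m 0) (\<rho> 0) (\<lambda>_. f) \<delta> \<in> Z 0 \<delta>)"
      by (rule image_family_iff[OF Zg LZ supp])
    also have "\<dots> \<longleftrightarrow> f \<in> mon T"
      by (auto simp: Z_def ideal_family_def vcoef_def \<rho>_def m_def mon_iff)
    finally show "f \<in> mon T \<longleftrightarrow> (\<exists>u. f = (\<Sum>b<length (L 0). M 0 0 b * u b))" by simp
  next
    fix i and v :: "nat \<Rightarrow> ('v, 'k) poly_ring"
    have e: "m (Suc i) = length (L i)" "\<rho> (Suc i) = (\<lambda>b. fst (L i ! b))" "Z (Suc i) = ker_family (L i)"
      by (simp_all add: m_def \<rho>_def Z_def fun_eq_iff)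
    have "(\<forall>a<m i. (\<Sum>b<length (L i). M i a b * v b) = 0) \<longleftrightarrow>
      (\<forall>\<delta>. vcoef (m (Suc i)) (\<rho> (Suc i)) v \<delta> \<in> Z (Suc i) \<delta>)"
      unfolding M_def e by (rule kernel_family_iff[OF U])
    also have "\<dots> \<longleftrightarrow> (\<exists>u. \<forall>a<m (Suc i). v a = (\<Sum>e<length (L (Suc i)). M (Suc i) a e * u e))"
      unfolding M_def by (rule image_family_iff[OF Zg LZ supp, symmetric])
    finally show "(\<forall>a<m i. (\<Sum>b<length (L i). M i a b * v b) = 0) \<longleftrightarrow>
      (\<exists>u. \<forall>b<length (L i). v b = (\<Sum>e<length (L (Suc i)). M (Suc i) b e * u e))" by (simp add: e)
  next
    fix a i b assume b: "b < length (L (Suc i))"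
    \<comment> \<open>A nonzero constant entry forces row and column to have the same multidegree.
      The column is then a relation that uses a generator of its own degree, which
      \<open>min_gens\<close> forbids.\<close>
    show "lookup (M (Suc i) a b) 0 = 0"
    proof (rule ccontr)
      let ?\<delta> = "fst (L (Suc i) ! b)" and ?u = "snd (L (Suc i) ! b)"
      assume "lookup (M (Suc i) a b) 0 \<noteq> 0"
      then have ne: "?u a \<noteq> 0" and "?\<delta> - \<rho> (Suc i) a = 0"
        by (auto simp: M_def mono_entry_def lookup_single when_def split: if_splits)
      moreover have a: "a < length (L i)" "dvds (\<rho> (Suc i) a) ?\<delta>"
        using U[OF b ne] by (auto simp: m_def)
      ultimately have eq: "fst (L i ! a) = ?\<delta>"
        using dvds_imp_eq_add[of "\<rho> (Suc i) a" ?\<delta>] by (simp add: \<rho>_def)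
      have "?u \<in> ker_family (L i) ?\<delta>" using LZ[of "Suc i"] b by (simp add: min_gens_def Z_def)
      then have "\<forall>b<length (L i). ?u b \<noteq> 0 \<longrightarrow> dvds (fst (L i ! b)) ?\<delta>"
        "\<forall>a. (\<Sum>b<length (L i). ?u b * snd (L i ! b) a) = 0" by (auto simp: ker_family_def)
      then show False using LZ[of i] a(1) ne eq unfolding min_gens_def by blast
    qed
  qed
  then have "min_graded_res (mon T) d (\<lambda>i a b. mat (m i) (length (L i)) (\<lambda>(a, b). M i a b) $$ (a, b))
      (\<lambda>i. dim_col (mat (m i) (length (L i)) (\<lambda>(a, b). M i a b)))
      (\<lambda>i. dim_row (mat (m i) (length (L i)) (\<lambda>(a, b). M i a b)))"
    by (simp add: min_graded_res_cong)
  then show ?thesis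
    using minimal_resolution_iff[of "mon T" d "\<lambda>i. mat (m i) (length (L i)) (\<lambda>(a, b). M i a b)"] by blast
qed

section \<open>Betti numbers and regularity of monomial ideals\<close>

text \<open>Existence turns the arbitrary choice inside \<open>betti\<close> into some minimal
  resolution, and \<open>shift_iff\<close> applies to every one of them.\<close>

lemma betti_mon_iff:
  fixes T :: "('v::finite \<Rightarrow>\<^sub>0 nat) set"
  assumes T: "up_closed T"
  shows "betti (mon T :: ('v, 'k::field) poly_ring set) i j \<noteq> 0 \<longleftrightarrow>
    (\<exists>a. int (monom_degree a) = j \<and> khom TYPE('k) (kcx T a) i)"
proof -
  let ?P = "\<lambda>(d, A). minimal_graded_free_resolution (mon T :: ('v, 'k) poly_ring set) d A"
  define R where "R = (SOME (d, A). minimal_graded_free_resolution (mon T :: ('v, 'k) poly_ring set) d A)"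
  obtain d A where R: "R = (d, A)" by (cases R)
  have "?P R" unfolding R_def by (rule someI_ex) (use ex_minimal_resolution[OF T, where 'k = 'k] in auto)
  then interpret min_graded_res "mon T" d "\<lambda>i a b. A i $$ (a, b)" "\<lambda>i. dim_col (A i)" "\<lambda>i. dim_row (A i)"
    using R minimal_resolution_iff by blast
  have "betti (mon T :: ('v, 'k) poly_ring set) i j = card {b. b < dim_col (A i) \<and> d i b = j}"
    unfolding betti_def R_def[symmetric] R by simp
  then show ?thesis
    using shift_iff[OF refl, of i j] by (auto simp: card_eq_0_iff)
qed

lemma regularity_mon:
  fixes T :: "('v::finite \<Rightarrow>\<^sub>0 nat) set"
  assumes T: "up_closed T"
  shows "regularity (mon T :: ('v, 'k::field) poly_ring set) =
    Max {int (monom_degree a) - int p | a p. khom TYPE('k) (kcx T a) p}"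
    and "finite {int (monom_degree a) - int p | a p. khom TYPE('k) (kcx T a) p}"
proof -
  let ?S = "{int (monom_degree a) - int p | a p. khom TYPE('k) (kcx T a) p}"
  let ?B = "{j - int i | i j. betti (mon T :: ('v, 'k) poly_ring set) i j \<noteq> 0}"
  have eq: "?B = ?S" unfolding betti_mon_iff[OF T] by blast
  show "regularity (mon T :: ('v, 'k) poly_ring set) = Max ?S" unfolding regularity_def eq ..
  obtain d A where "minimal_graded_free_resolution (mon T :: ('v, 'k) poly_ring set) d A"
    using ex_minimal_resolution[OF T, where 'k = 'k] by blast
  then interpret min_graded_res "mon T" d "\<lambda>i a b. A i $$ (a, b)" "\<lambda>i. dim_col (A i)" "\<lambda>i. dim_row (A i)"
    using minimal_resolution_iff by blast
  \<comment> \<open>Homological degrees are bounded by \<open>khom_card_le\<close>, and each module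
    of the resolution has finite rank.\<close>
  have "?S \<subseteq> (\<Union>p\<le>card (UNIV :: 'v set). (\<lambda>b. d p b - int p) ` {..<dim_col (A p)})"
  proof
    fix x assume "x \<in> ?S"
    then obtain a p where x: "x = int (monom_degree a) - int p" "khom TYPE('k) (kcx T a) p" by blast
    then obtain b where "b < dim_col (A p)" "d p b = int (monom_degree a)"
      using shift_iff[OF refl, of p "int (monom_degree a)"] by blast
    then show "x \<in> (\<Union>p\<le>card (UNIV :: 'v set). (\<lambda>b. d p b - int p) ` {..<dim_col (A p)})"
      using khom_card_le[OF x(2)] x(1) by force
  qed
  then show "finite ?S" by (rule finite_subset) simp
qed

section \<open>Powers and symbolic powers of the edge ideal\<close>

lemma up_closed_add: "up_closed T \<Longrightarrow> t \<in> T \<Longrightarrow> s + t \<in> T"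
  by (erule up_closedD) auto

lemma is_ideal_mon:
  assumes "up_closed T"
  shows "is_ideal (mon T :: ('v, 'k::field) poly_ring set)"
  unfolding is_ideal_def
proof (rule module.subspaceI[OF module_times])
  show "(0 :: ('v, 'k) poly_ring) \<in> mon T" by (simp add: mon_def)
  show "x + y \<in> mon T" if "x \<in> mon T" "y \<in> mon T" for x y :: "('v, 'k) poly_ring"
    using that keys_add[of x y] by (auto simp: mon_def)
  show "c * x \<in> mon T" if "x \<in> mon T" for c x :: "('v, 'k) poly_ring"
    using that keys_mult[of c x] up_closed_add[OF assms] by (fastforce simp: mon_def)
qed

lemma ideal_gen_subset:
  "S \<subseteq> J \<Longrightarrow> is_ideal J \<Longrightarrow> ideal_gen S \<subseteq> J"
  unfolding ideal_gen_def is_ideal_def using module.span_minimal[OF module_times] by blast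

lemma mon_subset_ideal_gen:
  fixes S :: "('v, 'k::field) poly_ring set"
  assumes "\<And>t c. t \<in> T \<Longrightarrow> \<exists>g\<in>S. \<exists>h. monomial t c = h * g"
  shows "mon T \<subseteq> ideal_gen S"
proof
  interpret module "(*) :: ('v, 'k) poly_ring \<Rightarrow> _" by (rule module_times)
  fix f :: "('v, 'k) poly_ring" assume f: "f \<in> mon T"
  have "monomial t (lookup f t) \<in> span S" if "t \<in> keys f" for t
  proof -
    have "t \<in> T" using that f by (auto simp: mon_def)
    then obtain g h where "g \<in> S" "monomial t (lookup f t) = h * g" using assms by blast
    then show ?thesis using span_scale[OF span_base] by metis
  qed
  then have "(\<Sum>t\<in>keys f. monomial t (lookup f t)) \<in> span S" by (rule span_sum)
  then show "f \<in> ideal_gen S" using poly_eq_sum_monomials[of f] by (simp add: ideal_gen_def)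
qed

lemma monomial_split: "monomial (s + t) (c :: 'k::field) = monomial s c * monomial t 1"
  by (simp add: mult_single)

definition uphull :: "('v \<Rightarrow>\<^sub>0 nat) set \<Rightarrow> ('v \<Rightarrow>\<^sub>0 nat) set"
  where "uphull G = {t. \<exists>g\<in>G. dvds g t}"

lemma up_closed_uphull: "up_closed (uphull G)"
  using dvds_trans by (fastforce simp: up_closed_def uphull_def)

lemma ideal_gen_monomials:
  "ideal_gen ((\<lambda>g. monomial g 1) ` G) = (mon (uphull G) :: ('v, 'k::field) poly_ring set)"
proof
  show "ideal_gen ((\<lambda>g. monomial g 1) ` G) \<subseteq> (mon (uphull G) :: ('v, 'k) poly_ring set)"
    by (rule ideal_gen_subset[OF _ is_ideal_mon[OF up_closed_uphull]]) (auto simp: mon_def uphull_def, use dvds_refl in blast)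
  show "(mon (uphull G) :: ('v, 'k) poly_ring set) \<subseteq> ideal_gen ((\<lambda>g. monomial g 1) ` G)"
  proof (rule mon_subset_ideal_gen)
    fix t and c :: 'k assume "t \<in> uphull G"
    then obtain g where g: "g \<in> G" "dvds g t" by (auto simp: uphull_def)
    then have "monomial t c = monomial (t - g) c * monomial g 1"
      using dvds_imp_eq_add[OF g(2)] monomial_split[of "t - g" g c] by simp
    then show "\<exists>p\<in>(\<lambda>g. monomial g 1) ` G. \<exists>h. monomial t c = h * p" using g by blast
  qed
qed

definition setadd :: "('v \<Rightarrow>\<^sub>0 nat) set \<Rightarrow> ('v \<Rightarrow>\<^sub>0 nat) set \<Rightarrow> ('v \<Rightarrow>\<^sub>0 nat) set"
  where "setadd S T = {s + t | s t. s \<in> S \<and> t \<in> T}"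

lemma up_closed_setadd:
  assumes "up_closed T"
  shows "up_closed (setadd S T)"
  unfolding up_closed_def
proof (intro allI impI)
  fix r r' assume "r \<in> setadd S T" "dvds r r'"
  then obtain s t where "s \<in> S" "t \<in> T" "r = s + t" by (auto simp: setadd_def)
  then have "r' = s + ((r' - r) + t)" using dvds_imp_eq_add[OF \<open>dvds r r'\<close>] by (simp add: ac_simps)
  then show "r' \<in> setadd S T" using \<open>s \<in> S\<close> up_closed_add[OF assms \<open>t \<in> T\<close>] by (auto simp: setadd_def)
qed

lemma ideal_mult_mon:
  assumes "up_closed T"
  shows "ideal_mult (mon S) (mon T) = (mon (setadd S T) :: ('v, 'k::field) poly_ring set)"
  unfolding ideal_mult_def
proof
  show "ideal_gen {a * b | a b. a \<in> mon S \<and> b \<in> mon T} \<subseteq> (mon (setadd S T) :: ('v, 'k) poly_ring set)"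
  proof (rule ideal_gen_subset[OF _ is_ideal_mon[OF up_closed_setadd[OF assms]]])
    show "{a * b | a b. a \<in> mon S \<and> b \<in> mon T} \<subseteq> (mon (setadd S T) :: ('v, 'k) poly_ring set)"
      using keys_mult by (fastforce simp: mon_def setadd_def)
  qed
  show "(mon (setadd S T) :: ('v, 'k) poly_ring set) \<subseteq> ideal_gen {a * b | a b. a \<in> mon S \<and> b \<in> mon T}"
  proof (rule mon_subset_ideal_gen)
    fix r and c :: 'k assume "r \<in> setadd S T"
    then obtain s t where st: "s \<in> S" "t \<in> T" "r = s + t" by (auto simp: setadd_def)
    have "monomial s 1 * monomial t 1 \<in> {a * b | a b. a \<in> (mon S :: ('v, 'k) poly_ring set) \<and> b \<in> mon T}"
      using st by (fastforce simp: mon_def)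
    moreover have "monomial r c = monomial 0 c * (monomial s 1 * monomial t 1)"
      by (simp add: st mult_single)
    ultimately show "\<exists>g\<in>{a * b | a b. a \<in> mon S \<and> b \<in> mon T}. \<exists>h. monomial r c = h * g" by blast
  qed
qed

definition edge_expo :: "('v \<Rightarrow> nat) \<Rightarrow> 'v \<times> 'v \<Rightarrow> ('v \<Rightarrow>\<^sub>0 nat)"
  where "edge_expo w e = monomial (fst e) 1 + monomial (snd e) (w (snd e))"

primrec pow_expo :: "('v \<times> 'v) set \<Rightarrow> ('v \<Rightarrow> nat) \<Rightarrow> nat \<Rightarrow> ('v \<Rightarrow>\<^sub>0 nat) set" where
  "pow_expo E w 0 = UNIV"
| "pow_expo E w (Suc k) = setadd (uphull (edge_expo w ` E)) (pow_expo E w k)"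

lemma up_closed_pow_expo: "up_closed (pow_expo E w k)"
  by (induction k) (auto simp: up_closed_setadd, simp add: up_closed_def)

lemma Var_power: "Var v ^ n = monomial (monomial v n) 1"
proof (induction n)
  case (Suc n)
  have "monomial v 1 + monomial v n = monomial v (Suc n)" by (simp add: single_add[symmetric])
  then show ?case using Suc by (simp add: Var_eq mult_single)
qed simp

lemma edge_ideal_eq: "edge_ideal E w = (mon (uphull (edge_expo w ` E)) :: ('v, 'k::field) poly_ring set)"
proof -
  have "{Var u * Var v ^ w v | u v. (u, v) \<in> E} =
      (\<lambda>g. monomial g 1 :: ('v, 'k) poly_ring) ` edge_expo w ` E"
    unfolding Var_power by (force simp: Var_eq mult_single edge_expo_def)
  then show ?thesis unfolding edge_ideal_def using ideal_gen_monomials by metis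
qed

lemma ideal_power_edge_ideal:
  "ideal_power (edge_ideal E w) k = (mon (pow_expo E w k) :: ('v, 'k::field) poly_ring set)"
proof (induction k)
  case 0
  then show ?case by (simp add: mon_def)
next
  case (Suc k)
  then show ?case by (simp add: edge_ideal_eq ideal_mult_mon[OF up_closed_pow_expo])
qed

section \<open>Cancelling factors modulo monomial ideals\<close>

lemma lookup_mult_keys:
  "lookup (p * f) r = (\<Sum>a\<in>keys p. if dvds a r then lookup p a * lookup f (r - a) else 0)"
  for p :: "('v, 'k::field) poly_ring"
proof -
  have "lookup (p * f) r = lookup (\<Sum>t\<in>keys p. monomial t (lookup p t) * f) r"
    by (subst poly_eq_sum_monomials[of p]) (simp add: sum_distrib_right)
  then show ?thesis by (simp add: lookup_sum lookup_single_mult)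
qed

lemma mult_lookup_unique:
  fixes p f :: "('v, 'k::field) poly_ring"
  assumes "lookup p s \<noteq> 0" "lookup f t \<noteq> 0"
    and uniq: "\<And>s' t'. lookup p s' \<noteq> 0 \<Longrightarrow> lookup f t' \<noteq> 0 \<Longrightarrow> s' + t' = s + t \<Longrightarrow> s' = s"
  shows "lookup (p * f) (s + t) \<noteq> 0"
proof -
  have "lookup (p * f) (s + t) = (\<Sum>a\<in>{s}. lookup p a * lookup f (s + t - a))"
    unfolding lookup_mult_keys
  proof (rule sum.mono_neutral_cong_right)
    show "\<forall>a\<in>keys p - {s}. (if dvds a (s + t) then lookup p a * lookup f (s + t - a) else 0) = 0"
    proof
      fix a assume a: "a \<in> keys p - {s}"
      show "(if dvds a (s + t) then lookup p a * lookup f (s + t - a) else 0) = 0"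
      proof (cases "dvds a (s + t) \<and> lookup f (s + t - a) \<noteq> 0")
        case True
        then show ?thesis using uniq[of a "s + t - a"] a dvds_imp_eq_add[of a "s + t"]
          by (auto simp: in_keys_iff add.commute)
      qed auto
    qed
  qed (use assms in \<open>auto simp: in_keys_iff\<close>)
  then show ?thesis using assms by simp
qed

text \<open>\<open>mon (off_expo i)\<close> is the ideal generated by the variables other than \<open>i\<close>.\<close>

definition off_expo :: "'v \<Rightarrow> ('v \<Rightarrow>\<^sub>0 nat) set"
  where "off_expo i = {t. \<exists>j. j \<noteq> i \<and> lookup t j > 0}"

lemma up_closed_off_expo: "up_closed (off_expo i)"
  by (fastforce simp: up_closed_def off_expo_def dvds_def intro: less_le_trans)

text \<open>An \<open>s\<close> outside the prime has pure powers of variable \<open>i\<close> among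
  its terms; take the highest. Among the terms of \<open>f\<close> outside \<open>T\<close> take
  those of least degree \<open>od\<close> in the other variables, then one with the largest exponent
  of \<open>i\<close>. The product of the two terms arises in only one way modulo \<open>T\<close>,
  so it survives in \<open>s * f\<close>, and by \<open>inv\<close> it is outside
  \<open>T\<close>.\<close>

lemma mon_primary:
  fixes s f :: "('v::finite, 'k::field) poly_ring"
  assumes T: "up_closed T"
    and inv: "\<And>t t'. (\<forall>j. j \<noteq> i \<longrightarrow> lookup t j = lookup t' j) \<Longrightarrow> t \<in> T \<Longrightarrow> t' \<in> T"
    and s: "s \<notin> mon (off_expo i)" and sf: "s * f \<in> mon T"
  shows "f \<in> mon T"
proof (rule ccontr)
  assume "f \<notin> mon T"
  define B where "B = {t \<in> keys f. t \<notin> T}"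
  define S where "S = {a \<in> keys s. a \<notin> off_expo i}"
  define od where "od t = (\<Sum>j\<in>-{i}. lookup t j)" for t :: "'v \<Rightarrow>\<^sub>0 nat"
  have od_add: "od (a + b) = od a + od b" for a b by (simp add: od_def lookup_add sum.distrib)
  have od_0: "od a = 0 \<longleftrightarrow> a \<notin> off_expo i" for a by (auto simp: od_def off_expo_def Ball_def)
  have "B \<noteq> {}" "finite B" using \<open>f \<notin> mon T\<close> by (auto simp: B_def mon_def)
  have "S \<noteq> {}" "finite S" using s by (auto simp: S_def mon_def)
  define m where "m = Min (od ` B)"
  have mB: "m \<le> od t" if "t \<in> B" for t using that \<open>finite B\<close> by (simp add: m_def)
  define B' where "B' = {t \<in> B. od t = m}"
  have "m \<in> od ` B" unfolding m_def using \<open>B \<noteq> {}\<close> \<open>finite B\<close> by (intro Min_in) auto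
  then have "B' \<noteq> {}" "finite B'" using \<open>finite B\<close> by (auto simp: B'_def)
  obtain t where t: "t \<in> B'" "\<And>t'. t' \<in> B' \<Longrightarrow> lookup t' i \<le> lookup t i"
  proof -
    have "Max ((\<lambda>t. lookup t i) ` B') \<in> (\<lambda>t. lookup t i) ` B'"
      using \<open>B' \<noteq> {}\<close> \<open>finite B'\<close> by (intro Max_in) auto
    then obtain t where "t \<in> B'" "lookup t i = Max ((\<lambda>t. lookup t i) ` B')" by auto
    then show thesis using that[of t] \<open>finite B'\<close> by simp
  qed
  obtain a where a: "a \<in> S" "\<And>a'. a' \<in> S \<Longrightarrow> lookup a' i \<le> lookup a i"
  proof -
    have "Max ((\<lambda>t. lookup t i) ` S) \<in> (\<lambda>t. lookup t i) ` S"
      using \<open>S \<noteq> {}\<close> \<open>finite S\<close> by (intro Max_in) auto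
    then obtain t where "t \<in> S" "lookup t i = Max ((\<lambda>t. lookup t i) ` S)" by auto
    then show thesis using that[of t] \<open>finite S\<close> by simp
  qed
  have od_a: "od a = 0" using a(1) od_0 by (simp add: S_def)
  have tT: "t \<notin> T" using t(1) by (simp add: B'_def B_def)
  have atT: "a + t \<notin> T"
    using inv[of "a + t" t] tT od_a by (auto simp: lookup_add od_def)
  have "lookup (s * f) (a + t) \<noteq> 0"
  proof (rule mult_lookup_unique)
    show "lookup s a \<noteq> 0" using a(1) by (simp add: S_def in_keys_iff)
    show "lookup f t \<noteq> 0" using t(1) by (simp add: B'_def B_def in_keys_iff)
    fix a' t' assume *: "lookup s a' \<noteq> 0" "lookup f t' \<noteq> 0" "a' + t' = a + t"
    have "t' \<notin> T" using up_closed_add[OF T, of t' a'] atT *(3) by auto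
    then have t'B: "t' \<in> B" using *(2) by (simp add: B_def in_keys_iff)
    have "od a' + od t' = od t" using arg_cong[OF *(3), of od] by (simp add: od_add od_a)
    moreover have "od t = m" using t(1) by (simp add: B'_def)
    ultimately have "od a' = 0" "od t' = m" using mB[OF t'B] by auto
    then have "a' \<in> S" "t' \<in> B'" using *(1) t'B od_0 by (simp_all add: S_def in_keys_iff B'_def)
    then have le: "lookup a' i \<le> lookup a i" "lookup t' i \<le> lookup t i" using a(2) t(2) by auto
    have "lookup a' i + lookup t' i = lookup a i + lookup t i"
      using arg_cong[OF *(3), of "\<lambda>x. lookup x i"] by (simp add: lookup_add)
    then have "lookup a' i = lookup a i" using le by simp
    moreover have "lookup a' j = lookup a j" if "j \<noteq> i" for j
      using \<open>od a' = 0\<close> od_a that by (auto simp: od_def)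
    ultimately show "a' = a" by (intro poly_mapping_eqI) metis
  qed
  then show False using sf atT by (auto simp: mon_iff)
qed

lemma is_prime_ideal_off: "is_prime_ideal (mon (off_expo i) :: ('v::finite, 'k::field) poly_ring set)"
  unfolding is_prime_ideal_def
proof (intro conjI allI impI)
  show "is_ideal (mon (off_expo i) :: ('v, 'k) poly_ring set)" by (rule is_ideal_mon[OF up_closed_off_expo])
  have "(1 :: ('v, 'k) poly_ring) \<notin> mon (off_expo i)" by (simp add: mon_def off_expo_def)
  then show "mon (off_expo i) \<noteq> (UNIV :: ('v, 'k) poly_ring set)" by blast
  fix a b :: "('v, 'k) poly_ring" assume ab: "a * b \<in> mon (off_expo i)"
  show "a \<in> mon (off_expo i) \<or> b \<in> mon (off_expo i)"
  proof (rule disjCI)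
    assume b: "b \<notin> mon (off_expo i)"
    show "a \<in> mon (off_expo i)"
      by (rule mon_primary[OF up_closed_off_expo _ b ab[unfolded mult.commute[of a]]]) (auto simp: off_expo_def)
  qed
qed

lemma colon_monomial: "{g. g * monomial q 1 \<in> mon T} = (mon {t. t + q \<in> T} :: ('v, 'k::field) poly_ring set)"
proof -
  have l: "lookup (g * monomial q 1) r = (if dvds q r then lookup g (r - q) else 0)"
    for g :: "('v, 'k) poly_ring" and r
    using lookup_single_mult[of q 1 g r] by (simp add: mult.commute)
  show ?thesis
  proof (intro Set.set_eqI iffI CollectI)
    fix g :: "('v, 'k) poly_ring" assume "g \<in> {g. g * monomial q 1 \<in> mon T}"
    then have "lookup (g * monomial q 1) (t + q) \<noteq> 0 \<Longrightarrow> t + q \<in> T" for t by (auto simp: mon_iff)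
    then show "g \<in> mon {t. t + q \<in> T}" by (auto simp: mon_iff l)
  next
    fix g :: "('v, 'k) poly_ring" assume g: "g \<in> mon {t. t + q \<in> T}"
    show "g * monomial q 1 \<in> mon T"
      unfolding mon_iff
    proof (intro allI impI)
      fix r assume "lookup (g * monomial q 1) r \<noteq> 0"
      then have "dvds q r" "lookup g (r - q) \<noteq> 0" by (auto simp: l split: if_splits)
      then show "r \<in> T" using g dvds_imp_eq_add[of q r] by (auto simp: mon_iff)
    qed
  qed
qed

text \<open>A term of \<open>f\<close> outside \<open>T\<close> of least degree, multiplied by the
  constant term of \<open>s\<close>, cannot be cancelled in \<open>s * f\<close>.\<close>

lemma contraction_irrelevant:
  fixes s f :: "('v::finite, 'k::field) poly_ring"
  assumes T: "up_closed T" and s: "lookup s 0 \<noteq> 0" and sf: "s * f \<in> mon T"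
  shows "f \<in> mon T"
proof (rule ccontr)
  assume "f \<notin> mon T"
  define B where "B = {t \<in> keys f. t \<notin> T}"
  have "B \<noteq> {}" using \<open>f \<notin> mon T\<close> by (auto simp: B_def mon_def)
  then obtain t where t: "t \<in> B" "\<And>t'. t' \<in> B \<Longrightarrow> monom_degree t \<le> monom_degree t'"
    using ex_has_least_nat[of "\<lambda>t. t \<in> B" _ monom_degree] by blast
  have "lookup (s * f) (0 + t) \<noteq> 0"
  proof (rule mult_lookup_unique[OF s])
    show "lookup f t \<noteq> 0" using t(1) by (simp add: B_def in_keys_iff)
    fix a' t' assume *: "lookup s a' \<noteq> 0" "lookup f t' \<noteq> 0" "a' + t' = 0 + t"
    have "t' \<notin> T" using up_closed_add[OF T, of t' a'] t(1) *(3) by (auto simp: B_def)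
    then have "monom_degree t \<le> monom_degree t'" using *(2) by (intro t(2)) (simp add: B_def in_keys_iff)
    moreover have "monom_degree a' + monom_degree t' = monom_degree t"
      using *(3) monom_degree_add[of a' t'] by simp
    ultimately show "a' = 0" by (simp add: monom_degree_eq_0_iff[symmetric])
  qed
  then show False using sf t(1) by (auto simp: mon_iff B_def)
qed

locale complete_wog =
  fixes E :: "('v::finite \<times> 'v) set" and w :: "'v \<Rightarrow> nat"
  assumes complete: "weighted_oriented_complete_graph E w"
begin

lemma irrefl: "(v, v) \<notin> E"
  and asym: "(u, v) \<in> E \<Longrightarrow> (v, u) \<notin> E"
  and total: "u \<noteq> v \<Longrightarrow> (u, v) \<notin> E \<Longrightarrow> (v, u) \<in> E"
  and w_pos: "w v \<ge> 1"
  and source: "(\<And>u. (u, v) \<notin> E) \<Longrightarrow> w v = 1"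
  using complete
  unfolding weighted_oriented_complete_graph_def weighted_oriented_graph_def is_source_def by blast+

definition W :: "'v \<Rightarrow> 'v \<Rightarrow> nat"
  where "W i j = (if (i, j) \<in> E then w j else 1)"

lemma W_pos: "W i j \<ge> 1"
  using w_pos by (simp add: W_def)

text \<open>Setting \<open>x\<^sub>i = 1\<close> turns the edge ideal into the complete intersection generated by the
  \<open>x\<^sub>j ^ W i j\<close>. The \<open>k\<close>-th power of the latter contains the monomial with exponent \<open>t\<close> iff
  \<open>lev i t \<ge> k\<close>.\<close>

definition lev :: "'v \<Rightarrow> ('v \<Rightarrow>\<^sub>0 nat) \<Rightarrow> nat"
  where "lev i t = (\<Sum>j\<in>-{i}. lookup t j div W i j)"

definition lev_expo :: "nat \<Rightarrow> 'v \<Rightarrow> ('v \<Rightarrow>\<^sub>0 nat) set"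
  where "lev_expo k i = {t. k \<le> lev i t}"

abbreviation gens_expo :: "('v \<Rightarrow>\<^sub>0 nat) set"
  where "gens_expo \<equiv> uphull (edge_expo w ` E)"

lemma lookup_edge_expo:
  "(a, b) \<in> E \<Longrightarrow> lookup (edge_expo w (a, b)) v = (if v = a then 1 else if v = b then w b else 0)"
  using irrefl by (auto simp: edge_expo_def lookup_add lookup_single when_def)

lemma gens_expo_iff: "t \<in> gens_expo \<longleftrightarrow> (\<exists>a b. (a, b) \<in> E \<and> lookup t a \<ge> 1 \<and> lookup t b \<ge> w b)"
proof
  assume "t \<in> gens_expo"
  then obtain a b where e: "(a, b) \<in> E" "dvds (edge_expo w (a, b)) t" by (auto simp: uphull_def)
  then have "a \<noteq> b" using irrefl by auto
  then show "\<exists>a b. (a, b) \<in> E \<and> lookup t a \<ge> 1 \<and> lookup t b \<ge> w b"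
    using e lookup_edge_expo[OF e(1), of a] lookup_edge_expo[OF e(1), of b] unfolding dvds_def by metis
next
  assume "\<exists>a b. (a, b) \<in> E \<and> lookup t a \<ge> 1 \<and> lookup t b \<ge> w b"
  then obtain a b where "(a, b) \<in> E" "lookup t a \<ge> 1" "lookup t b \<ge> w b" by blast
  then have "dvds (edge_expo w (a, b)) t" by (simp add: dvds_def lookup_edge_expo)
  then show "t \<in> gens_expo" using \<open>(a, b) \<in> E\<close> by (auto simp: uphull_def)
qed

lemma lev_mono: "dvds s t \<Longrightarrow> lev i s \<le> lev i t"
  unfolding lev_def dvds_def by (intro sum_mono div_le_mono) auto

lemma up_closed_lev_expo: "up_closed (lev_expo k i)"
  using lev_mono le_trans unfolding up_closed_def lev_expo_def by blast

lemma lev_add: "lev i s + lev i t \<le> lev i (s + t)"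
proof -
  have "lookup s j div W i j + lookup t j div W i j \<le> (lookup s j + lookup t j) div W i j" for j
    by (subst div_add1_eq) simp
  then show ?thesis unfolding lev_def lookup_add sum.distrib[symmetric] by (intro sum_mono)
qed

lemma lev_ge: "j \<noteq> i \<Longrightarrow> lookup t j div W i j \<le> lev i t"
  unfolding lev_def by (rule member_le_sum) auto

text \<open>The head \<open>b\<close> of the edge contributes, since its exponent reaches
  \<open>w b\<close>. If the head is \<open>i\<close>, the tail contributes instead, with weight 1
  because the edge points into \<open>i\<close>.\<close>

lemma lev_gens: "t \<in> gens_expo \<Longrightarrow> 1 \<le> lev i t"
proof -
  assume "t \<in> gens_expo"
  then obtain a b where e: "(a, b) \<in> E" "lookup t a \<ge> 1" "lookup t b \<ge> w b"
    by (auto simp: gens_expo_iff)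
  have "\<exists>j. j \<noteq> i \<and> lookup t j \<ge> W i j"
  proof (cases "b = i")
    case True
    then have "a \<noteq> i" "(i, a) \<notin> E" using e irrefl asym by auto
    then show ?thesis using e by (intro exI[of _ a]) (simp add: W_def)
  next
    case False
    then show ?thesis using e(3) w_pos[of b] by (intro exI[of _ b]) (auto simp: W_def)
  qed
  then obtain j where j: "j \<noteq> i" "lookup t j \<ge> W i j" by blast
  then have "1 \<le> lookup t j div W i j" using W_pos[of i j] by (simp add: Suc_le_eq div_greater_zero_iff)
  then show ?thesis using lev_ge[OF j(1), of t] by linarith
qed

lemma pow_expo_subset_lev: "pow_expo E w k \<subseteq> lev_expo k i"
proof (induction k)
  case (Suc k)
  show ?case
  proof
    fix r assume "r \<in> pow_expo E w (Suc k)"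
    then obtain s t where "s \<in> gens_expo" "t \<in> pow_expo E w k" "r = s + t" by (auto simp: setadd_def)
    then have "1 \<le> lev i s" "k \<le> lev i t" using lev_gens Suc by (auto simp: lev_expo_def)
    then show "r \<in> lev_expo (Suc k) i" using lev_add[of i s t] \<open>r = s + t\<close> by (simp add: lev_expo_def)
  qed
qed (simp add: lev_expo_def)

text \<open>Each unit of level at some \<open>j\<close> pays for one generator: the factor
  \<open>w i\<close> at \<open>i\<close> and \<open>W i j\<close> at \<open>j\<close> suffice for
  the edge between \<open>i\<close> and \<open>j\<close> in either orientation.\<close>

lemma lev_in_pow_expo: "k \<le> lev i t \<Longrightarrow> monomial i (k * w i) + t \<in> pow_expo E w k"
proof (induction k arbitrary: t)
  case (Suc k)
  have "\<exists>j. j \<noteq> i \<and> lookup t j div W i j \<noteq> 0"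
  proof (rule ccontr)
    assume "\<not> (\<exists>j. j \<noteq> i \<and> lookup t j div W i j \<noteq> 0)"
    then have "lev i t = 0" by (auto simp: lev_def)
    then show False using Suc.prems by simp
  qed
  then obtain j where j: "j \<noteq> i" "lookup t j \<ge> W i j" using W_pos by (auto simp: not_less div_eq_0_iff)
  define t' where "t' = t - monomial j (W i j)"
  have t: "t = monomial j (W i j) + t'"
    unfolding t'_def using j(2) dvds_imp_eq_add[of "monomial j (W i j)" t] by (simp add: dvds_single_iff add.commute)
  have "lev i t = lev i t' + 1"
  proof -
    have "lookup t l div W i l = lookup t' l div W i l + (if l = j then 1 else 0)" for l
      using W_pos[of i j] by (auto simp: t lookup_add lookup_single when_def)
    then show ?thesis using j(1) by (simp add: lev_def sum.distrib)
  qed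
  then have IH: "monomial i (k * w i) + t' \<in> pow_expo E w k" using Suc by simp
  have "monomial i (w i) + monomial j (W i j) \<in> gens_expo"
  proof (cases "(i, j) \<in> E")
    case True
    then show ?thesis unfolding gens_expo_iff using j(1) w_pos
      by (intro exI[of _ i] exI[of _ j]) (auto simp: lookup_add lookup_single when_def W_def)
  next
    case False
    then have "(j, i) \<in> E" using total j(1) by blast
    then show ?thesis unfolding gens_expo_iff using j(1) False
      by (intro exI[of _ j] exI[of _ i]) (auto simp: lookup_add lookup_single when_def W_def)
  qed
  moreover have "monomial i (Suc k * w i) + t = (monomial i (w i) + monomial j (W i j)) + (monomial i (k * w i) + t')"
    by (simp add: t single_add ac_simps)
  ultimately show ?case using IH by (auto simp: setadd_def)
qed simp

lemma lev_cong: "(\<And>v. v \<noteq> i \<Longrightarrow> lookup s v = lookup t v) \<Longrightarrow> lev i s = lev i t"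
  unfolding lev_def by (intro sum.cong) auto

lemma mon_lev_primary:
  assumes "s \<notin> mon (off_expo i)" "s * f \<in> mon (lev_expo k i)"
  shows "f \<in> mon (lev_expo k i)"
  by (rule mon_primary[OF up_closed_lev_expo _ assms]) (metis lev_cong lev_expo_def mem_Collect_eq)

text \<open>Powers of variable \<open>i\<close> become units in the localisation, which gives one
  inclusion by \<open>lev_in_pow_expo\<close>; the other holds since \<open>lev_expo k i\<close>
  contains the power and is saturated by \<open>mon_lev_primary\<close>.\<close>

lemma contraction_off:
  "local_contraction (mon (off_expo i)) (ideal_power (edge_ideal E w) k)
    = (mon (lev_expo k i) :: ('v, 'k::field) poly_ring set)"
proof -
  have "local_contraction (mon (off_expo i)) (ideal_power (edge_ideal E w) k)
    = {f :: ('v, 'k) poly_ring. \<exists>s. s \<notin> mon (off_expo i) \<and> s * f \<in> mon (pow_expo E w k)}"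
    unfolding ideal_power_edge_ideal
    by (rule local_contraction_eq[OF is_prime_ideal_off is_ideal_mon[OF up_closed_pow_expo]])
  also have "\<dots> = mon (lev_expo k i)"
  proof (intro Set.set_eqI iffI)
    fix f :: "('v, 'k) poly_ring"
    assume "f \<in> {f. \<exists>s. s \<notin> mon (off_expo i) \<and> s * f \<in> mon (pow_expo E w k)}"
    then obtain s where s: "s \<notin> mon (off_expo i)" "s * f \<in> mon (pow_expo E w k)" by blast
    then have "s * f \<in> mon (lev_expo k i)" using pow_expo_subset_lev by (fastforce simp: mon_def)
    then show "f \<in> mon (lev_expo k i)" by (rule mon_lev_primary[OF s(1)])
  next
    fix f :: "('v, 'k) poly_ring" assume f: "f \<in> mon (lev_expo k i)"
    let ?s = "monomial (monomial i (k * w i)) 1 :: ('v, 'k) poly_ring"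
    have "?s \<notin> mon (off_expo i)" by (auto simp: mon_def off_expo_def lookup_single when_def)
    moreover have "?s * f \<in> mon (pow_expo E w k)"
      unfolding mon_iff
    proof (intro allI impI)
      fix r assume "lookup (?s * f) r \<noteq> 0"
      then have r: "dvds (monomial i (k * w i)) r" "lookup f (r - monomial i (k * w i)) \<noteq> 0"
        by (auto simp: lookup_single_mult split: if_splits)
      then have "k \<le> lev i (r - monomial i (k * w i))" using f by (auto simp: mon_iff lev_expo_def)
      then show "r \<in> pow_expo E w k"
        using lev_in_pow_expo dvds_imp_eq_add[OF r(1)] by (metis add.commute)
    qed
    ultimately show "f \<in> {f. \<exists>s. s \<notin> mon (off_expo i) \<and> s * f \<in> mon (pow_expo E w k)}" by blast
  qed
  finally show ?thesis .
qed

lemma off_in_ass_primes: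
  "mon (off_expo i) \<in> ass_primes (edge_ideal E w :: ('v, 'k::field) poly_ring set)"
proof -
  \<comment> \<open>One step short of every generator: an out-neighbour of \<open>i\<close> lacks
    one unit, an in-neighbour is absent while \<open>i\<close> already has exponent
    \<open>w i\<close>. Any variable other than \<open>i\<close> completes an edge, a power of
    \<open>i\<close> completes none.\<close>
  define q where "q = expo (\<lambda>j. if j = i then w i else if (i, j) \<in> E then w j - 1 else 0)"
  have q: "lookup q j = (if j = i then w i else if (i, j) \<in> E then w j - 1 else 0)" for j
    by (simp add: q_def)
  have "t + q \<in> gens_expo \<longleftrightarrow> t \<in> off_expo i" for t
  proof
    assume "t \<in> off_expo i"
    then obtain j where j: "j \<noteq> i" "lookup t j > 0" by (auto simp: off_expo_def)
    show "t + q \<in> gens_expo"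
    proof (cases "(i, j) \<in> E")
      case True
      then show ?thesis unfolding gens_expo_iff using j w_pos[of i] w_pos[of j]
        by (intro exI[of _ i] exI[of _ j]) (auto simp: lookup_add q)
    next
      case False
      then have "(j, i) \<in> E" using total j(1) by blast
      then show ?thesis unfolding gens_expo_iff using j
        by (intro exI[of _ j] exI[of _ i]) (auto simp: lookup_add q)
    qed
  next
    assume "t + q \<in> gens_expo"
    then obtain a b where ab: "(a, b) \<in> E" "lookup t a + lookup q a \<ge> 1" "lookup t b + lookup q b \<ge> w b"
      by (auto simp: gens_expo_iff lookup_add)
    show "t \<in> off_expo i"
    proof (rule ccontr)
      assume "t \<notin> off_expo i"
      then have t0: "j \<noteq> i \<Longrightarrow> lookup t j = 0" for j by (auto simp: off_expo_def)
      show False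
      proof (cases "b = i")
        case True
        then have "a \<noteq> i" "(i, a) \<notin> E" using ab(1) irrefl asym by auto
        then show False using ab(2) t0 by (simp add: q)
      next
        case False
        then show False using ab(3) t0[OF False] w_pos[of b] by (auto simp: q split: if_splits)
      qed
    qed
  qed
  then have "{g. g * monomial q 1 \<in> edge_ideal E w} = (mon (off_expo i) :: ('v, 'k) poly_ring set)"
    unfolding edge_ideal_eq colon_monomial by simp
  then show ?thesis
    unfolding ass_primes_def using is_prime_ideal_off by blast
qed

text \<open>Take \<open>x\<close> all of whose in-neighbours have weight 1. The condition at
  \<open>x\<close> yields a vertex \<open>j\<close> with full exponent \<open>w j\<close> whatever
  its orientation to \<open>x\<close>; the condition at \<open>j\<close> then yields a partner
  \<open>l\<close>, and the edge between them divides the monomial.\<close>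

lemma gens_expo_eq_Inter:
  assumes "out_nbhd_set E (V_plus w) \<noteq> UNIV" and t: "\<And>i. t \<in> lev_expo 1 i"
  shows "t \<in> gens_expo"
proof -
  obtain x where "x \<notin> out_nbhd_set E (V_plus w)" using assms(1) by blast
  then have x: "\<not> w j \<ge> 2" if "(j, x) \<in> E" for j
    using that by (auto simp: out_nbhd_set_def out_nbhd_def V_plus_def)
  have ex: "\<exists>j. j \<noteq> i \<and> lookup t j \<ge> W i j" for i
  proof (rule ccontr)
    assume "\<not> (\<exists>j. j \<noteq> i \<and> lookup t j \<ge> W i j)"
    then have "lev i t = 0" by (auto simp: lev_def not_le)
    then show False using t[of i] by (simp add: lev_expo_def)
  qed
  obtain j where j: "j \<noteq> x" "lookup t j \<ge> W x j" using ex by blast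
  have jw: "lookup t j \<ge> w j"
    using j total[of x j] x[of j] w_pos[of j] by (auto simp: W_def split: if_splits)
  obtain l where l: "l \<noteq> j" "lookup t l \<ge> W j l" using ex by blast
  show ?thesis
  proof (cases "(j, l) \<in> E")
    case True
    then show ?thesis unfolding gens_expo_iff using l(2) jw w_pos[of j]
      by (intro exI[of _ j] exI[of _ l]) (auto simp: W_def)
  next
    case False
    then have "(l, j) \<in> E" using total l(1) by blast
    then show ?thesis unfolding gens_expo_iff using l(2) jw False
      by (intro exI[of _ l] exI[of _ j]) (auto simp: W_def)
  qed
qed

text \<open>A larger prime has a smaller contraction, so it suffices that every associated prime
  lies in some ideal \<open>mon (off_expo i)\<close>. The witness \<open>h\<close> is outside the
  edge ideal, hence outside one of the ideals \<open>mon (lev_expo 1 i)\<close>, and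
  \<open>mon_lev_primary\<close> applies.\<close>

lemma symbolic_power_eq_lev:
  assumes V: "out_nbhd_set E (V_plus w) \<noteq> UNIV"
  shows "symbolic_power (edge_ideal E w) k = (mon {t. \<forall>i. k \<le> lev i t} :: ('v, 'k::field) poly_ring set)"
proof
  let ?I = "edge_ideal E w :: ('v, 'k) poly_ring set"
  have eq: "(mon {t. \<forall>i. k \<le> lev i t} :: ('v, 'k) poly_ring set) = (\<Inter>i. mon (lev_expo k i))"
    by (auto simp: mon_iff lev_expo_def)
  show "symbolic_power ?I k \<subseteq> mon {t. \<forall>i. k \<le> lev i t}"
    unfolding eq symbolic_power_def using off_in_ass_primes contraction_off by blast
  show "mon {t. \<forall>i. k \<le> lev i t} \<subseteq> symbolic_power ?I k"
    unfolding symbolic_power_def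
  proof
    fix f :: "('v, 'k) poly_ring" assume f: "f \<in> mon {t. \<forall>i. k \<le> lev i t}"
    show "f \<in> (\<Inter>P\<in>ass_primes ?I. local_contraction P (ideal_power ?I k))"
    proof
      fix P :: "('v, 'k) poly_ring set" assume "P \<in> ass_primes ?I"
      then obtain h where P: "is_prime_ideal P" "P = {g. g * h \<in> ?I}" by (auto simp: ass_primes_def)
      have "h \<notin> mon gens_expo"
      proof
        assume "h \<in> mon gens_expo"
        then have "g * h \<in> mon gens_expo" for g
          using is_ideal_mon[OF up_closed_uphull, of "edge_expo w ` E"]
            module.subspace_scale[OF module_times] by (auto simp: is_ideal_def)
        then have "P = UNIV" using P(2) by (auto simp: edge_ideal_eq)
        then show False using P(1) by (simp add: is_prime_ideal_def)
      qed
      then obtain t where "lookup h t \<noteq> 0" "t \<notin> gens_expo" by (auto simp: mon_iff)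
      then obtain i where i: "h \<notin> mon (lev_expo 1 i)"
        using gens_expo_eq_Inter[OF V, of t] by (auto simp: mon_iff)
      have "P \<subseteq> mon (off_expo i)"
      proof
        fix g assume "g \<in> P"
        then have "g * h \<in> mon gens_expo" using P(2) by (auto simp: edge_ideal_eq)
        then have gh: "g * h \<in> mon (lev_expo 1 i)" using lev_gens by (auto simp: mon_iff lev_expo_def)
        show "g \<in> mon (off_expo i)"
        proof (rule ccontr)
          assume "g \<notin> mon (off_expo i)"
          then have "h \<in> mon (lev_expo 1 i)" using gh by (rule mon_lev_primary)
          then show False using i by blast
        qed
      qed
      then have "local_contraction (mon (off_expo i)) (ideal_power ?I k) \<subseteq> local_contraction P (ideal_power ?I k)"
        unfolding local_contraction_def by blast
      moreover have "f \<in> mon (lev_expo k i)" using f by (auto simp: mon_iff lev_expo_def)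
      ultimately show "f \<in> local_contraction P (ideal_power ?I k)" unfolding contraction_off by blast
    qed
  qed
qed

lemma symbolic_power_eq_power:
  assumes V: "out_nbhd_set E (V_plus w) = UNIV"
  shows "symbolic_power (edge_ideal E w) k = (mon (pow_expo E w k) :: ('v, 'k::field) poly_ring set)"
proof
  let ?I = "edge_ideal E w :: ('v, 'k) poly_ring set"
  let ?m = "mon {t. t \<noteq> 0} :: ('v, 'k) poly_ring set"
  have m: "f \<in> ?m \<longleftrightarrow> lookup f 0 = 0" for f by (auto simp: mon_iff)
  have prime: "is_prime_ideal ?m"
    unfolding is_prime_ideal_def
  proof (intro conjI allI impI)
    show "is_ideal ?m"
    proof (rule is_ideal_mon)
      show "up_closed {t :: 'v \<Rightarrow>\<^sub>0 nat. t \<noteq> 0}"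
        unfolding up_closed_def using dvds_antisym dvds_zero by blast
    qed
    have "(1 :: ('v, 'k) poly_ring) \<notin> ?m" unfolding m by simp
    then show "?m \<noteq> UNIV" by blast
    show "a * b \<in> ?m \<Longrightarrow> a \<in> ?m \<or> b \<in> ?m" for a b unfolding m by (simp add: lookup_mult_zero)
  qed
  \<comment> \<open>A socle monomial: it misses every generator by one unit at the head, and each
    vertex has an in-neighbour \<open>u\<close> with \<open>w u - 1\<close> at least 1, so any
    variable completes an edge.\<close>
  define q where "q = expo (\<lambda>j. w j - 1)"
  have q: "lookup q j = w j - 1" for j by (simp add: q_def)
  have "t + q \<in> gens_expo \<longleftrightarrow> t \<noteq> 0" for t
  proof
    assume "t + q \<in> gens_expo"
    then obtain a b where ab: "(a, b) \<in> E" "lookup t b + lookup q b \<ge> w b"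
      by (auto simp: gens_expo_iff lookup_add)
    then show "t \<noteq> 0" using w_pos[of b] by (auto simp: q)
  next
    assume "t \<noteq> 0"
    then obtain v where v: "lookup t v > 0" by (metis gr0I lookup_zero poly_mapping_eqI)
    have "v \<in> out_nbhd_set E (V_plus w)" using V by simp
    then obtain u where "(u, v) \<in> E" "w u \<ge> 2" by (auto simp: out_nbhd_set_def out_nbhd_def V_plus_def)
    then show "t + q \<in> gens_expo" unfolding gens_expo_iff using v
      by (intro exI[of _ u] exI[of _ v]) (auto simp: lookup_add q)
  qed
  then have "{g. g * monomial q 1 \<in> ?I} = ?m" unfolding edge_ideal_eq colon_monomial by simp
  then have "?m \<in> ass_primes ?I" unfolding ass_primes_def using prime by blast
  then have "symbolic_power ?I k \<subseteq> local_contraction ?m (ideal_power ?I k)"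
    unfolding symbolic_power_def by blast
  also have "\<dots> \<subseteq> mon (pow_expo E w k)"
    unfolding ideal_power_edge_ideal local_contraction_eq[OF prime is_ideal_mon[OF up_closed_pow_expo]] m
    using contraction_irrelevant[OF up_closed_pow_expo] by blast
  finally show "symbolic_power ?I k \<subseteq> mon (pow_expo E w k)" .
  show "mon (pow_expo E w k) \<subseteq> symbolic_power ?I k"
    unfolding symbolic_power_def
  proof (intro subsetI InterI)
    fix f :: "('v, 'k) poly_ring" and X assume f: "f \<in> mon (pow_expo E w k)"
      and "X \<in> (\<lambda>P. local_contraction P (ideal_power ?I k)) ` ass_primes ?I"
    then obtain P where P: "is_prime_ideal P" "X = local_contraction P (ideal_power ?I k)"
      by (auto simp: ass_primes_def)
    have "1 \<notin> P"
    proof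
      assume "1 \<in> P"
      then have "g \<in> P" for g
        using P(1) module.subspace_scale[OF module_times, of P 1 g] by (simp add: is_prime_ideal_def is_ideal_def)
      then have "P = UNIV" by auto
      then show False using P(1) by (simp add: is_prime_ideal_def)
    qed
    then have "f \<in> {f. \<exists>s. s \<notin> P \<and> s * f \<in> mon (pow_expo E w k)}" using f by (intro CollectI exI[of _ 1]) simp
    then show "f \<in> X"
      unfolding P(2) ideal_power_edge_ideal local_contraction_eq[OF P(1) is_ideal_mon[OF up_closed_pow_expo]] .
  qed
qed

end

section \<open>Vanishing and nonvanishing criteria\<close>

lemma kchain_mono: "kchain D p c \<Longrightarrow> D \<subseteq> D' \<Longrightarrow> kchain D' p c"
  by (auto simp: kchain_def)

text \<open>The complement of \<open>D\<close> in \<open>Pow S\<close> carries the Koszul complex of the quotient ring; it is glued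
  from cones \<open>N j\<close> with apex \<open>j\<close>, and the overlaps are too small to be seen in this degree.\<close>

lemma not_khom_cover:
  fixes D :: "'v::finite set set" and N :: "'v \<Rightarrow> 'v set set"
  assumes S: "S \<noteq> {}" and D: "D \<subseteq> Pow S" and NS: "\<And>j. N j \<subseteq> Pow S"
    and cover: "\<And>A. A \<subseteq> S \<Longrightarrow> A \<notin> D \<longleftrightarrow> (\<exists>j. A \<in> N j)"
    and up: "\<And>A B j. A \<in> N j \<Longrightarrow> A \<subseteq> B \<Longrightarrow> B \<subseteq> S \<Longrightarrow> B \<in> N j"
    and disj: "\<And>A j l. A \<in> N j \<Longrightarrow> A \<in> N l \<Longrightarrow> card A \<le> Suc (Suc p) \<Longrightarrow> j = l"
    and cone: "\<And>A j. A \<in> N j \<Longrightarrow> j \<in> S \<Longrightarrow> A - {j} \<in> N j"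
    and large: "\<And>A j. A \<in> N j \<Longrightarrow> j \<notin> S \<Longrightarrow> card A > Suc p"
  shows "\<not> khom TYPE('k::field) D p"
proof
  assume "khom TYPE('k) D p"
  then obtain c :: "'v set \<Rightarrow> 'k" where c: "kchain D p c" "\<forall>A. sdiff c A = 0"
    and nb: "\<not> (\<exists>e. kchain D (Suc p) e \<and> (\<forall>A. sdiff e A = c A))"
    unfolding khom_def by blast
  obtain v0 where "v0 \<in> S" using S by blast
  then have "\<not> khom TYPE('k) (Pow S) p" by (intro not_khom_cone[of _ v0]) auto
  then obtain e where e: "kchain (Pow S) (Suc p) e" "\<forall>A. sdiff e A = c A"
    unfolding khom_def using kchain_mono[OF c(1) D] c(2) by blast
  \<comment> \<open>The correction of \<open>e\<close>: on each piece \<open>N j\<close> the cone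
    over \<open>e\<close> with apex \<open>j\<close>. By \<open>disj\<close> the piece is unique up
    to cardinality \<open>p + 2\<close>.\<close>
  define y where "y B = (if card B = Suc (Suc p) \<and> (\<exists>j. B \<in> N j) then kcone (SOME j. B \<in> N j) e B else 0)" for B
  have yN: "y B = kcone j e B" if "B \<in> N j" "card B = Suc (Suc p)" for B j
  proof -
    have "(SOME j. B \<in> N j) = j" using that disj[of B] by (intro some_equality) auto
    then show ?thesis using that by (auto simp: y_def)
  qed
  have y: "kchain (Pow S) (Suc (Suc p)) y"
    using NS by (auto simp: kchain_def y_def split: if_splits)
  define e' where "e' A = e A - sdiff y A" for A
  have "sdiff e' A = c A" for A
    using e(2) by (simp add: e'_def[abs_def] kdiff_diff)
  moreover have "kchain D (Suc p) e'"
    unfolding kchain_def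
  proof (intro allI impI)
    fix A assume ne: "e' A \<noteq> 0"
    have "A \<subseteq> S \<and> card A = Suc p"
    proof (cases "e A = 0")
      case False
      then show ?thesis using e(1) by (auto simp: kchain_def)
    next
      case True
      then have ky: "sdiff y A \<noteq> 0" using ne by (simp add: e'_def)
      then have "Suc (card A) = Suc (Suc p)" using kdiff_kchain[OF y] by blast
      moreover obtain v where "y (insert v A) \<noteq> 0"
        using ky sum.neutral[of "- A" "\<lambda>v. ksgn v A * 1 * y (insert v A)"] unfolding kdiff_def by fastforce
      ultimately show ?thesis using y by (auto simp: kchain_def)
    qed
    then have A: "A \<subseteq> S" "card A = Suc p" by blast+
    have "A \<in> D"
    proof (rule ccontr)
      assume "A \<notin> D"
      then obtain j where j: "A \<in> N j" using cover A(1) by blast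
      then have jS: "j \<in> S" using large A(2) by fastforce
      have "y (insert v A) = kcone j e (insert v A)" if v: "v \<notin> A" for v
      proof (cases "v \<in> S")
        case True
        then show ?thesis using v j A by (intro yN up[OF j]) auto
      next
        case False
        then have "\<not> insert v A \<subseteq> S" "\<not> insert v A - {j} \<subseteq> S" using jS by auto
        then have "y (insert v A) = 0" "e (insert v A - {j}) = 0" using y e(1) unfolding kchain_def by blast+
        then show ?thesis by (simp add: kcone_def)
      qed
      then have "sdiff y A = sdiff (kcone j e) A" by (rule kdiff_cong)
      \<comment> \<open>The boundary of \<open>e\<close> is \<open>c\<close>, which vanishes at
        \<open>A - {j}\<close> because this set is still outside \<open>D\<close>. So the correction
        cancels \<open>e\<close> at every such \<open>A\<close>.\<close>
      also have "\<dots> = e A"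
      proof (rule kdiff_kcone)
        have "A - {j} \<in> N j" by (rule cone[OF j jS])
        then have "A - {j} \<notin> D" using cover[of "A - {j}"] A(1) by blast
        then have "c (A - {j}) = 0" using c(1) unfolding kchain_def by blast
        then show "sdiff e (A - {j}) = 0" using e(2) by simp
      qed
      finally show False using ne by (simp add: e'_def)
    qed
    then show "A \<in> D \<and> card A = Suc p" using A by blast
  qed
  ultimately show False using nb by blast
qed

text \<open>Alexander dual to the reduced homology of two disjoint simplices in degree zero.\<close>

lemma khom_two_simplices:
  fixes X Y :: "'v::finite set"
  assumes XY: "X \<inter> Y = {}" "X \<noteq> {}" "Y \<noteq> {}" and n: "card (UNIV :: 'v set) = Suc (Suc p)"
  shows "khom TYPE('k::field) {A. \<not> - A \<subseteq> X \<and> \<not> - A \<subseteq> Y} p"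
proof -
  let ?D = "{A. \<not> - A \<subseteq> X \<and> \<not> - A \<subseteq> Y}"
  define t :: "'v set \<Rightarrow> 'k" where "t B = (if B = UNIV then 1 else 0)" for B
  \<comment> \<open>The half of the boundary of the full simplex formed by the facets opposite to
    \<open>X\<close>. Its boundary \<open>c\<close> lives on codimension-two faces whose missing
    pair has one element in \<open>X\<close> and one outside.\<close>
  define e where "e B = (if B \<in> (\<lambda>x. - {x}) ` X then sdiff t B else 0)" for B
  have top: "sdiff h (- {x}) = ksgn x (- {x}) * h UNIV" for h :: "'v set \<Rightarrow> 'k" and x
  proof -
    have "insert x (- {x}) = UNIV" by auto
    then show ?thesis by (simp add: kdiff_def)
  qed
  have eX: "e (- {x}) = ksgn x (- {x})" if "x \<in> X" for x
    using that top[of t x] by (auto simp: e_def t_def)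
  have enX: "e (- {x}) = 0" if "x \<notin> X" for x
    using that by (auto simp: e_def)
  have cardc: "card (- B) = Suc (Suc p) - card B" for B :: "'v set"
    using n by (simp add: Compl_eq_Diff_UNIV card_Diff_subset)
  have eD: "kchain UNIV (Suc p) e"
    by (auto simp: kchain_def e_def cardc split: if_splits)
  define c where "c = sdiff e"
  have "kchain ?D p c"
    unfolding kchain_def
  proof (intro allI impI)
    fix A assume ne: "c A \<noteq> 0"
    have "\<exists>v\<in>-A. ksgn v A * 1 * e (insert v A) \<noteq> 0"
      using ne sum.neutral[of "- A" "\<lambda>v. ksgn v A * 1 * e (insert v A)"] unfolding c_def kdiff_def by blast
    then obtain v where v: "v \<notin> A" "e (insert v A) \<noteq> 0" by auto
    then obtain x where x: "x \<in> X" "insert v A = - {x}" by (auto simp: e_def split: if_splits)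
    have vx: "v \<noteq> x" using x(2) by auto
    have A: "- A = {v, x}" using x(2) v(1) by auto
    then have "card (- A) = 2" using vx by simp
    then have "card A = p" using cardc[of "- A"] by simp
    moreover have "\<not> - A \<subseteq> Y" using A x(1) XY(1) by auto
    moreover have "\<not> - A \<subseteq> X"
    proof
      assume sub: "- A \<subseteq> X"
      have "e (insert u A) = sdiff t (insert u A)" if "u \<notin> A" for u
      proof -
        have "\<exists>y\<in>X. insert u A = - {y}"
        proof (cases "u = v")
          case True then show ?thesis using x by blast
        next
          case False
          then have "u = x" using that A by auto
          then have "insert u A = - {v}" using A vx by auto
          then show ?thesis using sub A by auto
        qed
        then show ?thesis by (auto simp: e_def)
      qed
      then have "c A = sdiff (sdiff t) A" unfolding c_def by (rule kdiff_cong)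
      then show False using ne by simp
    qed
    ultimately show "A \<in> ?D \<and> card A = p" by blast
  qed
  moreover have "\<forall>A. sdiff c A = 0" by (simp add: c_def)
  moreover have "\<not> (\<exists>e'. kchain ?D (Suc p) e' \<and> (\<forall>A. sdiff e' A = c A))"
  proof
    assume "\<exists>e'. kchain ?D (Suc p) e' \<and> (\<forall>A. sdiff e' A = c A)"
    then obtain e' where e': "kchain ?D (Suc p) e'" "\<forall>A. sdiff e' A = c A" by blast
    \<comment> \<open>If \<open>e'\<close> also bounds \<open>c\<close>, the difference is a cycle
      of the full simplex, hence a multiple of the boundary of the top face. It vanishes opposite to
      \<open>Y\<close> but not opposite to \<open>X\<close>, which is impossible.\<close>
    define g where "g B = e B - e' B" for B
    have "sdiff g A = sdiff e A - sdiff e' A" for A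
      unfolding g_def[abs_def] by (rule kdiff_diff)
    then have "sdiff g A = 0" for A using e'(2)[rule_format, of A] by (simp add: c_def)
    moreover have "kchain UNIV (Suc p) g"
      unfolding kchain_def
    proof (intro allI impI)
      fix A assume "g A \<noteq> 0"
      then have "e A \<noteq> 0 \<or> e' A \<noteq> 0" by (auto simp: g_def)
      then show "A \<in> UNIV \<and> card A = Suc p" using eD e'(1) unfolding kchain_def by blast
    qed
    moreover have "\<not> khom TYPE('k) (UNIV :: 'v set set) (Suc p)"
      by (rule not_khom_cone) simp
    ultimately obtain h where "\<forall>A. sdiff h A = g A" unfolding khom_def by blast
    then have g: "g (- {x}) = ksgn x (- {x}) * h UNIV" for x using top[of h x] by simp
    have ne: "ksgn x (- {x}) \<noteq> (0 :: 'k)" for x :: 'v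
      using ksgn_square[of x "- {x}", where 'a = 'k] by (metis mult_zero_left zero_neq_one)
    have e'0: "e' (- {x}) = 0" if "x \<in> X \<union> Y" for x
      using e'(1) that unfolding kchain_def by fastforce
    obtain x y where xy: "x \<in> X" "y \<in> Y" using XY by blast
    have "g (- {y}) = 0" using enX[of y] e'0[of y] xy XY(1) by (auto simp: g_def)
    then have "h UNIV = 0" using g[of y] ne[of y] by simp
    then have "g (- {x}) = 0" using g[of x] by simp
    then have "ksgn x (- {x}) = (0 :: 'k)" using eX[OF xy(1)] e'0[of x] xy(1) by (simp add: g_def)
    then show False using ne[of x] by simp
  qed
  ultimately show ?thesis unfolding khom_def by blast
qed

section \<open>The regularity when the irrelevant ideal is not associated\<close>

context complete_wog
begin

definition omega :: nat
  where "omega = Max (range w)"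

lemma w_le_omega: "w v \<le> omega"
  by (simp add: omega_def)

lemma omega_pos: "omega \<ge> 1"
  using w_pos w_le_omega le_trans by blast

definition esum :: "'v \<Rightarrow> 'v \<Rightarrow> nat"
  where "esum i l = (\<Sum>x\<in>out_nbhd E i \<inter> closed_out_nbhd E l. w x - 1)"

definition total_excess :: nat
  where "total_excess = (\<Sum>v\<in>UNIV. w v - 1)"

section \<open>Degree bounds from violated level conditions\<close>

lemma lev_eq_if: "lev i b = (\<Sum>v\<in>UNIV. if v \<noteq> i then lookup b v div W i v else 0)"
  unfolding lev_def by (rule sum.mono_neutral_cong_left) auto

lemma le_mult_div: "m \<ge> 1 \<Longrightarrow> (x :: nat) \<le> m * (x div m) + (m - 1)"
  by (metis Suc_pred' add_le_cancel_left div_mod_decomp less_Suc_eq_le mod_less_divisor mult.commute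
      One_nat_def Suc_le_eq)

lemma le_mult_div': "m \<ge> 1 \<Longrightarrow> m \<le> A \<Longrightarrow> (x :: nat) \<le> A * (x div m) + (m - 1)"
  using le_mult_div[of m x] mult_le_mono1[of m A "x div m"] by linarith

text \<open>Level \<open>j\<close> is counted \<open>A\<close> times and level \<open>l\<close>
  once. Variable \<open>l\<close> is seen only by level \<open>j\<close>, and variable
  \<open>j\<close> only by level \<open>l\<close>, without rounding because the edge points away
  from \<open>j\<close>. The function \<open>r\<close> collects the remainders.\<close>

lemma degree_le_two_levels:
  assumes e: "(j, l) \<in> E"
    and bl: "lookup b l \<le> A * (lookup b l div W j l) + r l"
    and bv: "\<And>v. v \<noteq> j \<Longrightarrow> v \<noteq> l \<Longrightarrow> lookup b v \<le> A * (lookup b v div W j v) + lookup b v div W l v + r v"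
    and k: "lev j b \<le> k" "lev l b \<le> k"
  shows "monom_degree b \<le> (A + 1) * k + (\<Sum>v\<in>-{j}. r v)"
proof -
  have jl: "j \<noteq> l" "(l, j) \<notin> E" using e irrefl asym by auto
  have "monom_degree b \<le> (\<Sum>v\<in>UNIV. A * (if v \<noteq> j then lookup b v div W j v else 0) +
      (if v \<noteq> l then lookup b v div W l v else 0) + (if v \<noteq> j then r v else 0))"
    unfolding monom_degree_def
  proof (rule sum_mono)
    fix v
    consider "v = j" | "v = l" | "v \<noteq> j" "v \<noteq> l" by blast
    then show "lookup b v \<le> A * (if v \<noteq> j then lookup b v div W j v else 0) +
      (if v \<noteq> l then lookup b v div W l v else 0) + (if v \<noteq> j then r v else 0)"
      using jl bl bv by cases (auto simp: W_def)
  qed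
  also have "\<dots> = A * lev j b + lev l b + (\<Sum>v\<in>UNIV. if v \<noteq> j then r v else 0)"
    by (simp only: sum.distrib sum_distrib_left[symmetric] lev_eq_if)
  also have "(\<Sum>v\<in>UNIV. if v \<noteq> j then r v else 0) = (\<Sum>v\<in>-{j}. r v)"
    by (rule sum.mono_neutral_cong_right) auto
  also have "A * lev j b + lev l b \<le> A * k + k" using k by (intro add_mono mult_le_mono) auto
  finally show ?thesis by (simp add: algebra_simps)
qed

text \<open>A vertex that is not a common out-neighbour has weight 1 in one of the two levels, so it
  suffers no rounding loss. The remaining losses, with that of \<open>l\<close> itself, form
  \<open>esum j l\<close>.\<close>

lemma degree_le_edge_omega:
  assumes e: "(j, l) \<in> E" "w l = omega" and k: "lev j b \<le> k" "lev l b \<le> k"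
  shows "monom_degree b \<le> (omega + 1) * k + esum j l"
proof -
  define r where "r v = (if v \<in> out_nbhd E j \<inter> closed_out_nbhd E l then w v - 1 else 0)" for v
  have "monom_degree b \<le> (omega + 1) * k + (\<Sum>v\<in>-{j}. r v)"
  proof (rule degree_le_two_levels[OF e(1) _ _ k])
    have "l \<in> out_nbhd E j \<inter> closed_out_nbhd E l" using e(1) by (simp add: out_nbhd_def closed_out_nbhd_def)
    then show "lookup b l \<le> omega * (lookup b l div W j l) + r l"
      using e le_mult_div[OF omega_pos, of "lookup b l"] by (simp add: W_def r_def)
    fix v assume v: "v \<noteq> j" "v \<noteq> l"
    show "lookup b v \<le> omega * (lookup b v div W j v) + lookup b v div W l v + r v"
    proof (cases "(j, v) \<in> E \<and> (l, v) \<in> E")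
      case True
      then have eq: "W j v = w v" "r v = w v - 1"
        by (simp_all add: W_def r_def out_nbhd_def closed_out_nbhd_def)
      show ?thesis unfolding eq using le_mult_div'[OF w_pos w_le_omega, of "lookup b v" v] by linarith
    next
      case False
      then consider "W j v = 1" | "W l v = 1" by (auto simp: W_def)
      then show ?thesis
        using mult_le_mono1[OF omega_pos, of "lookup b v"] by cases (simp_all add: trans_le_add1)
    qed
  qed
  also have "(\<Sum>v\<in>-{j}. r v) = esum j l"
    unfolding esum_def r_def using irrefl
    by (intro sum.mono_neutral_cong_right) (auto simp: out_nbhd_def)
  finally show ?thesis .
qed

text \<open>A head of smaller weight allows the factor \<open>omega - 1\<close>, hence slope
  \<open>omega\<close> instead of \<open>omega + 1\<close>; the crude remainder is harmless for
  large \<open>k\<close>.\<close>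

lemma degree_le_edge_less:
  assumes e: "(j, l) \<in> E" "w l < omega" and k: "lev j b \<le> k" "lev l b \<le> k"
  shows "monom_degree b \<le> omega * k + total_excess"
proof -
  have o: "omega - 1 \<ge> 1" "omega - 1 + 1 = omega" "w l \<le> omega - 1" using e(2) w_pos[of l] by linarith+
  have "monom_degree b \<le> (omega - 1 + 1) * k + (\<Sum>v\<in>-{j}. w v - 1)"
  proof (rule degree_le_two_levels[OF e(1) _ _ k])
    show "lookup b l \<le> (omega - 1) * (lookup b l div W j l) + (w l - 1)"
      using e le_mult_div'[OF w_pos o(3), of "lookup b l"] by (simp add: W_def)
    fix v assume v: "v \<noteq> j" "v \<noteq> l"
    show "lookup b v \<le> (omega - 1) * (lookup b v div W j v) + lookup b v div W l v + (w v - 1)"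
    proof (cases "(j, v) \<in> E \<and> (l, v) \<in> E")
      case True
      then have eq: "W j v = w v" "W l v = w v" by (simp_all add: W_def)
      have "w v \<le> omega - 1 + 1" using w_le_omega o(2) by simp
      then have "lookup b v \<le> (omega - 1 + 1) * (lookup b v div w v) + (w v - 1)"
        by (rule le_mult_div'[OF w_pos])
      then show ?thesis unfolding eq by (simp only: distrib_right mult_1_left)
    next
      case False
      then consider "W j v = 1" | "W l v = 1" by (auto simp: W_def)
      then show ?thesis
        using mult_le_mono1[OF o(1), of "lookup b v"] by cases (simp_all add: trans_le_add1)
    qed
  qed
  also have "(\<Sum>v\<in>-{j}. w v - 1) \<le> total_excess"
    unfolding total_excess_def by (rule sum_mono2) auto
  finally show ?thesis using o by simp
qed

text \<open>Serves the pieces whose apex is outside the support of the multidegree: there the level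
  sees every variable that occurs.\<close>

lemma degree_le_one_level:
  assumes "lookup b j = 0" "lev j b \<le> k"
  shows "monom_degree b \<le> omega * k + total_excess"
proof -
  have "monom_degree b \<le> (\<Sum>v\<in>UNIV. omega * (if v \<noteq> j then lookup b v div W j v else 0) + (w v - 1))"
    unfolding monom_degree_def
  proof (rule sum_mono)
    fix v
    consider "v = j" | "v \<noteq> j" "W j v = w v" | "v \<noteq> j" "W j v = 1"
      by (cases "(j, v) \<in> E") (auto simp: W_def)
    then show "lookup b v \<le> omega * (if v \<noteq> j then lookup b v div W j v else 0) + (w v - 1)"
      using le_mult_div'[OF w_pos w_le_omega, of "lookup b v" v] assms(1)
        mult_le_mono1[OF omega_pos, of "lookup b v"] by cases (simp_all add: trans_le_add1)
  qed
  also have "\<dots> = omega * lev j b + total_excess"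
    by (simp only: sum.distrib sum_distrib_left[symmetric] lev_eq_if total_excess_def)
  finally show ?thesis using mult_le_mono2[OF assms(2), of omega] by linarith
qed

definition lev_all :: "nat \<Rightarrow> ('v \<Rightarrow>\<^sub>0 nat) set"
  where "lev_all k = {t. \<forall>i. k \<le> lev i t}"

lemma up_closed_lev_all: "up_closed (lev_all k)"
  using lev_mono le_trans unfolding up_closed_def lev_all_def by blast

text \<open>Beyond the bound, no set of size at most \<open>p + 2\<close> can violate two levels at
  once, since this would bound the degree of \<open>a\<close>. The complement of the complex is then
  a union of separated cones \<open>N j\<close>: removing \<open>j\<close> from \<open>A\<close>
  does not affect level \<open>j\<close>.\<close>

lemma khom_lev_all_le:
  assumes k: "k \<ge> 1"
    and M: "\<And>j l. (j, l) \<in> E \<Longrightarrow> w l = omega \<Longrightarrow> esum j l \<le> M"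
    and big: "total_excess \<le> k - 1"
    and kh: "khom TYPE('k::field) (kcx (lev_all k) a) p"
  shows "monom_degree a \<le> (omega + 1) * (k - 1) + M + 2 + p"
proof (rule ccontr)
  define s where "s = (omega + 1) * (k - 1) + M"
  assume "\<not> monom_degree a \<le> (omega + 1) * (k - 1) + M + 2 + p"
  then have ga: "monom_degree a > s + 2 + p" by (simp add: s_def)
  define S where "S = {v. lookup a v > 0}"
  have dv: "dvds (ind A) a \<longleftrightarrow> A \<subseteq> S" for A
    by (auto simp: dvds_def S_def Suc_le_eq split: if_splits)
  define N where "N j = {A. A \<subseteq> S \<and> lev j (a - ind A) \<le> k - 1}" for j
  have deg: "monom_degree a = monom_degree (a - ind A) + card A" if "A \<subseteq> S" for A
    using monom_degree_minus[of "ind A" a] that by (simp add: dv)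
  \<comment> \<open>Here \<open>k\<close> is large enough for the bounds of slope
    \<open>omega\<close> to fall below the one of slope \<open>omega + 1\<close>.\<close>
  have small: "omega * (k - 1) + total_excess \<le> s"
    using big by (simp add: s_def)
  have two: "monom_degree b \<le> s" if "(j, l) \<in> E" "lev j b \<le> k - 1" "lev l b \<le> k - 1" for b j l
  proof (cases "w l = omega")
    case True
    then show ?thesis using degree_le_edge_omega[OF that(1) True that(2,3)] M[OF that(1) True] by (simp add: s_def)
  next
    case False
    then have "w l < omega" using w_le_omega[of l] by simp
    then show ?thesis using degree_le_edge_less[OF that(1) _ that(2,3)] small by linarith
  qed
  have "S \<noteq> {}"
  proof
    assume "S = {}"
    then have "monom_degree a = 0" by (simp add: S_def monom_degree_def)
    then show False using ga by simp
  qed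
  then have "\<not> khom TYPE('k) (kcx (lev_all k) a) p"
  proof (rule not_khom_cover[where N = N])
    show "kcx (lev_all k) a \<subseteq> Pow S" by (auto simp: kcx_def dv)
    show "N j \<subseteq> Pow S" for j by (auto simp: N_def)
    have "lev j t \<le> k - 1 \<longleftrightarrow> \<not> k \<le> lev j t" for j t using k by linarith
    then show "A \<notin> kcx (lev_all k) a \<longleftrightarrow> (\<exists>j. A \<in> N j)" if "A \<subseteq> S" for A
      using that unfolding kcx_def dv N_def lev_all_def by blast
    show "B \<in> N j" if "A \<in> N j" "A \<subseteq> B" "B \<subseteq> S" for A B j
    proof -
      have "dvds (a - ind B) (a - ind A)" using that(2) by (auto simp: dvds_def lookup_minus)
      then show ?thesis using that lev_mono[of "a - ind B" "a - ind A" j] by (simp add: N_def)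
    qed
    show "j = l" if A: "A \<in> N j" "A \<in> N l" "card A \<le> Suc (Suc p)" for A j l
    proof (rule ccontr)
      assume "j \<noteq> l"
      then have "(j, l) \<in> E \<or> (l, j) \<in> E" using total by blast
      then have "monom_degree (a - ind A) \<le> s" using two[of j l] two[of l j] A(1,2) by (auto simp: N_def)
      then show False using deg[of A] A ga by (simp add: N_def)
    qed
    show "A - {j} \<in> N j" if "A \<in> N j" "j \<in> S" for A j
    proof -
      have "lev j (a - ind (A - {j})) = lev j (a - ind A)"
        by (rule lev_cong) (simp add: lookup_minus)
      then show ?thesis using that by (auto simp: N_def)
    qed
    show "Suc p < card A" if A: "A \<in> N j" "j \<notin> S" for A j
    proof (rule ccontr)
      assume "\<not> Suc p < card A"
      have "lookup (a - ind A) j = 0" using A(2) by (simp add: S_def lookup_minus)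
      then have "monom_degree (a - ind A) \<le> s"
        using degree_le_one_level[of "a - ind A" j "k - 1"] A(1) small by (simp add: N_def)
      then show False using deg[of A] A \<open>\<not> Suc p < card A\<close> ga by (simp add: N_def)
    qed
  qed
  then show False using kh by blast
qed

section \<open>A multidegree attaining the bound\<close>

lemma lev_add_ind_iff:
  "Suc (lev i a) \<le> lev i (a + ind B) \<longleftrightarrow>
    (\<exists>v\<in>B. v \<noteq> i \<and> (lookup a v + 1) div W i v \<noteq> lookup a v div W i v)"
proof
  assume le: "Suc (lev i a) \<le> lev i (a + ind B)"
  show "\<exists>v\<in>B. v \<noteq> i \<and> (lookup a v + 1) div W i v \<noteq> lookup a v div W i v"
  proof (rule ccontr)
    assume no: "\<not> ?thesis"
    have "lev i (a + ind B) = lev i a"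
      unfolding lev_def using no by (intro sum.cong) (auto simp: lookup_add)
    then show False using le by simp
  qed
next
  assume "\<exists>v\<in>B. v \<noteq> i \<and> (lookup a v + 1) div W i v \<noteq> lookup a v div W i v"
  then obtain v where v: "v \<in> B" "v \<noteq> i" "(lookup a v + 1) div W i v \<noteq> lookup a v div W i v" by blast
  have mono: "lookup a u div W i u \<le> lookup (a + ind B) u div W i u" for u
    by (intro div_le_mono) (simp add: lookup_add)
  have "lookup a v div W i v < (lookup a v + 1) div W i v"
    using v(3) div_le_mono[of "lookup a v" "lookup a v + 1" "W i v"] by linarith
  then have "lookup a v div W i v < lookup (a + ind B) v div W i v"
    using v(1) by (simp add: lookup_add)
  then have "lev i a < lev i (a + ind B)"
    unfolding lev_def using v mono by (intro sum_strict_mono_ex1) auto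
  then show "Suc (lev i a) \<le> lev i (a + ind B)" by simp
qed

lemma khom_lev_all_attained:
  assumes e: "(i, l) \<in> E" "w l = omega" and k: "k \<ge> omega + 1" and n: "card (UNIV :: 'v set) = Suc (Suc p)"
  shows "\<exists>a. monom_degree a = (omega + 1) * (k - 1) + esum i l + 2 + p \<and>
    khom TYPE('k::field) (kcx (lev_all k) a) p"
proof -
  have il: "i \<noteq> l" "(l, i) \<notin> E" using e(1) irrefl asym by auto
  obtain m where m: "k = Suc m" "m \<ge> omega" using k by (cases k) auto
  let ?C = "\<lambda>v. (i, v) \<in> E \<and> (l, v) \<in> E"
  \<comment> \<open>The exponents turn every estimate of \<open>degree_le_edge_omega\<close>,
    applied with bound \<open>m = k - 1\<close>, into an equality.\<close>
  define f where "f v = (if v = l then omega * k - 1 else if v = i then m else if ?C v then w v - 1 else 0)" for v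
  define b where "b = expo f"
  have b: "lookup b v = f v" for v by (simp add: b_def)
  have fl: "f l = omega * k - 1" and fi: "f i = m" using il by (simp_all add: f_def)
  have ok: "omega * k - 1 = omega * m + (omega - 1)" using omega_pos m by simp
  have divo: "(omega * k - 1) div omega = m" "(omega * k) div omega = k"
  proof -
    show "(omega * k - 1) div omega = m"
      by (rule div_nat_eqI) (use omega_pos ok m(1) in auto)
    show "(omega * k) div omega = k" using omega_pos by simp
  qed
  have "sum f UNIV = f l + (f i + (\<Sum>v\<in>-{i, l}. f v))"
  proof -
    have "UNIV = insert l (insert i (- {i, l}))" by auto
    then have "sum f UNIV = sum f (insert l (insert i (- {i, l})))" by simp
    also have "\<dots> = f l + (f i + (\<Sum>v\<in>-{i, l}. f v))" using il by simp
    finally show ?thesis .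
  qed
  also have "(\<Sum>v\<in>-{i, l}. f v) = (\<Sum>v\<in>{v. ?C v}. w v - 1)"
    unfolding f_def using irrefl il by (intro sum.mono_neutral_cong_right) auto
  also have "f l + (f i + (\<Sum>v\<in>{v. ?C v}. w v - 1)) = (omega + 1) * m + ((omega - 1) + (\<Sum>v\<in>{v. ?C v}. w v - 1))"
    unfolding fl fi ok by simp
  also have "(omega - 1) + (\<Sum>v\<in>{v. ?C v}. w v - 1) = esum i l"
  proof -
    have "out_nbhd E i \<inter> closed_out_nbhd E l = insert l {v. ?C v}"
      using e(1) by (auto simp: out_nbhd_def closed_out_nbhd_def)
    then show ?thesis using irrefl e(2) by (simp add: esum_def)
  qed
  finally have degb: "monom_degree b = (omega + 1) * m + esum i l" by (simp add: b_def)
  have levi: "lev i b = m"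
  proof -
    have "lev i b = (\<Sum>v\<in>{l}. lookup b v div W i v)"
      unfolding lev_def
    proof (rule sum.mono_neutral_right)
      show "\<forall>v\<in>- {i} - {l}. lookup b v div W i v = 0"
        using w_pos by (auto simp: b f_def W_def Suc_le_eq)
    qed (use il in auto)
    then show ?thesis using e divo fl by (simp add: b W_def)
  qed
  have levl: "lev l b = m"
  proof -
    have "lev l b = (\<Sum>v\<in>{i}. lookup b v div W l v)"
      unfolding lev_def
    proof (rule sum.mono_neutral_right)
      show "\<forall>v\<in>- {l} - {i}. lookup b v div W l v = 0"
        using w_pos by (auto simp: b f_def W_def Suc_le_eq)
    qed (use il in auto)
    then show ?thesis using il fi by (simp add: b W_def)
  qed
  \<comment> \<open>The other conditions hold already at \<open>b\<close>: variable \<open>l\<close>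
    gives at least \<open>m\<close> units, and variable \<open>i\<close> gives one more because
    \<open>m\<close> is at least \<open>omega\<close>.\<close>
  have levj: "k \<le> lev j b" if j: "j \<noteq> i" "j \<noteq> l" for j
  proof -
    have "(\<Sum>v\<in>{i, l}. lookup b v div W j v) \<le> lev j b"
      unfolding lev_def using j by (intro sum_mono2) auto
    then have le: "m div W j i + (omega * k - 1) div W j l \<le> lev j b" using il fl fi by (simp add: b)
    have "W j i \<le> m" using w_le_omega[of i] omega_pos m(2) by (auto simp: W_def)
    then have "m div W j i \<ge> 1" using W_pos[of j i] by (simp add: Suc_le_eq div_greater_zero_iff)
    moreover have "(omega * k - 1) div W j l \<ge> m"
    proof (cases "(j, l) \<in> E")
      case True
      then show ?thesis using e(2) divo by (simp add: W_def)
    next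
      case False
      have "m \<le> omega * m + (omega - 1)" using mult_le_mono1[OF omega_pos, of m] by linarith
      then show ?thesis using False ok by (simp add: W_def)
    qed
    ultimately show ?thesis using le m(1) by linarith
  qed
  \<comment> \<open>The variables whose multiplication leaves level \<open>i\<close> unchanged, and
    in \<open>Y\<close> the same for level \<open>l\<close>. They are disjoint because every
    exponent of \<open>b\<close> is maximal for one of the two levels.\<close>
  define X where "X = {v. v = i \<or> (lookup b v + 1) div W i v = lookup b v div W i v}"
  define Y where "Y = {v. v = l \<or> (lookup b v + 1) div W l v = lookup b v div W l v}"
  have "i \<notin> Y" using il fi by (simp add: Y_def b W_def)
  have "l \<notin> X"
  proof -
    have "lookup b l + 1 = omega * k" using fl omega_pos m(1) by (simp add: b)
    then show ?thesis using il e fl divo m(1) by (simp add: X_def b W_def)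
  qed
  have "X \<inter> Y = {}"
  proof (rule ccontr)
    assume "X \<inter> Y \<noteq> {}"
    then obtain v where v: "v \<in> X" "v \<in> Y" by blast
    then have vil: "v \<noteq> i" "v \<noteq> l" using \<open>i \<notin> Y\<close> \<open>l \<notin> X\<close> by auto
    show False
    proof (cases "?C v")
      case True
      then have "lookup b v = w v - 1" using vil by (simp add: b f_def)
      then show False using v(1) vil True w_pos[of v] by (simp add: X_def W_def)
    next
      case False
      then have "lookup b v = 0" using vil by (auto simp: b f_def)
      then show False using v vil False by (auto simp: X_def Y_def W_def)
    qed
  qed
  \<comment> \<open>Removing \<open>A\<close> from \<open>a\<close> leaves \<open>b\<close> times
    the variables of the complement, so the complex becomes the dual of two disjoint simplices. The
    degree rises by the number of vertices, \<open>p + 2\<close>.\<close>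
  define a where "a = b + ind UNIV"
  have dv: "dvds (ind A) a" for A by (auto simp: dvds_def a_def lookup_add)
  have aA: "a - ind A = b + ind (- A)" for A
    by (intro poly_mapping_eqI) (simp add: a_def lookup_add lookup_minus)
  have in_lev: "b + ind B \<in> lev_all k \<longleftrightarrow> \<not> B \<subseteq> X \<and> \<not> B \<subseteq> Y" for B
  proof -
    have "k \<le> lev i (b + ind B) \<longleftrightarrow> \<not> B \<subseteq> X"
      using lev_add_ind_iff[of i b B] by (auto simp: levi m(1) X_def)
    moreover have "k \<le> lev l (b + ind B) \<longleftrightarrow> \<not> B \<subseteq> Y"
      using lev_add_ind_iff[of l b B] by (auto simp: levl m(1) Y_def)
    moreover have "k \<le> lev j (b + ind B)" if "j \<noteq> i" "j \<noteq> l" for j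
      using levj[OF that] lev_mono[of b "b + ind B" j] by simp
    ultimately show ?thesis unfolding lev_all_def mem_Collect_eq by metis
  qed
  have "kcx (lev_all k) a = {A. \<not> - A \<subseteq> X \<and> \<not> - A \<subseteq> Y}"
    unfolding kcx_def aA using dv in_lev by blast
  moreover have "X \<noteq> {}" "Y \<noteq> {}" by (auto simp: X_def Y_def)
  ultimately have "khom TYPE('k) (kcx (lev_all k) a) p"
    using khom_two_simplices[OF \<open>X \<inter> Y = {}\<close> _ _ n, where 'k = 'k] by simp
  moreover have "monom_degree a = (omega + 1) * (k - 1) + esum i l + 2 + p"
    by (simp add: a_def monom_degree_add degb n m(1))
  ultimately show ?thesis by blast
qed

text \<open>A vertex of largest weight may be a source; then all weights are 1 and any edge will
  do.\<close>

lemma ex_edge_omega: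
  assumes "card (UNIV :: 'v set) \<ge> 2"
  shows "\<exists>i l. (i, l) \<in> E \<and> w l = omega"
proof -
  have "omega \<in> range w" unfolding omega_def by (intro Max_in) auto
  then obtain l where l: "w l = omega" by auto
  show ?thesis
  proof (cases "\<exists>i. (i, l) \<in> E")
    case False
    then have o: "omega = 1" using source[of l] l by auto
    have "(UNIV :: 'v set) \<noteq> {l}"
    proof
      assume "(UNIV :: 'v set) = {l}"
      then have "card (UNIV :: 'v set) = card {l}" by (rule arg_cong)
      then show False using assms by simp
    qed
    then obtain x where "x \<noteq> l" by blast
    then have "(l, x) \<in> E" using total[of x l] False by blast
    then show ?thesis using w_pos[of x] w_le_omega[of x] o by (intro exI[of _ l] exI[of _ x]) auto
  qed (use l in blast)
qed

lemma regularity_lev_all: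
  assumes n: "card (UNIV :: 'v set) \<ge> 2" and k: "k \<ge> omega + 1 + total_excess"
  shows "regularity (mon (lev_all k) :: ('v, 'k::field) poly_ring set) =
    (int omega + 1) * (int k - 1) + Max {int (esum i l) | i l. (i, l) \<in> E \<and> w l = omega} + 2"
proof -
  obtain p where p: "card (UNIV :: 'v set) = Suc (Suc p)" using n by (metis add_2_eq_Suc le_Suc_ex)
  let ?M = "{int (esum i l) | i l. (i, l) \<in> E \<and> w l = omega}"
  have fin: "finite ?M"
    by (rule finite_subset[of _ "(\<lambda>(i, l). int (esum i l)) ` UNIV"]) auto
  have "?M \<noteq> {}" using ex_edge_omega[OF n] by blast
  then have "Max ?M \<in> ?M" using fin by (intro Max_in)
  then obtain i l where il: "(i, l) \<in> E" "w l = omega" "Max ?M = int (esum i l)" by blast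
  have M: "esum j m \<le> esum i l" if "(j, m) \<in> E" "w m = omega" for j m
  proof -
    have "int (esum j m) \<le> Max ?M" using fin that by (intro Max_ge) auto
    then show ?thesis using il(3) by simp
  qed
  let ?S = "{int (monom_degree a) - int p | a p. khom TYPE('k) (kcx (lev_all k) a) p}"
  let ?r = "(int omega + 1) * (int k - 1) + int (esum i l) + 2"
  have k1: "k \<ge> 1" using k by simp
  obtain m where "k = Suc m" using k1 by (cases k) auto
  then have r: "?r = int ((omega + 1) * (k - 1) + esum i l + 2)" by (simp add: algebra_simps)
  have "Max ?S = ?r"
  proof (rule Max_eqI)
    show "finite ?S" by (rule regularity_mon(2)[OF up_closed_lev_all])
    show "y \<le> ?r" if "y \<in> ?S" for y
    proof -
      from that obtain a q where y: "y = int (monom_degree a) - int q" "khom TYPE('k) (kcx (lev_all k) a) q"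
        by blast
      have "monom_degree a \<le> (omega + 1) * (k - 1) + esum i l + 2 + q"
        by (rule khom_lev_all_le[OF k1 M _ y(2)]) (use k in auto)
      then show ?thesis unfolding r y(1) by linarith
    qed
    obtain a where "monom_degree a = (omega + 1) * (k - 1) + esum i l + 2 + p"
      "khom TYPE('k) (kcx (lev_all k) a) p"
      using khom_lev_all_attained[OF il(1,2) _ p, of k] k by auto
    then show "?r \<in> ?S" unfolding r by (intro CollectI exI[of _ a] exI[of _ p]) simp
  qed
  then show ?thesis using regularity_mon(1)[OF up_closed_lev_all, where 'k = 'k] il(3) by simp
qed

end

section \<open>Eventually linear maxima\<close>

text \<open>The set \<open>X k\<close> is, for large \<open>k\<close>, empty or has a maximum that is linear in \<open>k\<close>. Admitting
  several candidate lines makes the property stable under unions.\<close>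

definition ev_lin_max :: "(nat \<Rightarrow> int set) \<Rightarrow> bool"
  where "ev_lin_max X \<longleftrightarrow> (\<exists>L. finite L \<and> (\<forall>\<^sub>F k in sequentially.
    (\<forall>(a, b)\<in>L. a * int k + b \<in> X k) \<and> (\<forall>y\<in>X k. \<exists>(a, b)\<in>L. y \<le> a * int k + b)))"

lemma ev_lin_maxI_line:
  assumes "\<forall>\<^sub>F k in sequentially. a * int k + b \<in> X k \<and> (\<forall>y\<in>X k. y \<le> a * int k + b)"
  shows "ev_lin_max X"
  unfolding ev_lin_max_def using assms by (intro exI[of _ "{(a, b)}"]) simp

lemma ev_lin_maxI_empty:
  assumes "\<forall>\<^sub>F k in sequentially. X k = {}"
  shows "ev_lin_max X"
  unfolding ev_lin_max_def using assms by (intro exI[of _ "{}"]) simp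

lemma eventually_linear_compare:
  fixes a b a' b' :: int
  shows "(\<forall>\<^sub>F k in sequentially. a * int k + b \<le> a' * int k + b') \<or>
    (\<forall>\<^sub>F k in sequentially. a' * int k + b' \<le> a * int k + b)"
proof -
  have *: "\<forall>\<^sub>F k in sequentially. a * int k + b \<le> a' * int k + b'" if "a < a'" for a b a' b' :: int
  proof (rule eventually_sequentiallyI[of "nat (b - b')"])
    fix k assume "nat (b - b') \<le> k"
    then have "b - b' \<le> 1 * int k" by linarith
    also have "\<dots> \<le> (a' - a) * int k" using that by (intro mult_right_mono) auto
    finally show "a * int k + b \<le> a' * int k + b'" by (simp add: algebra_simps)
  qed
  consider "a < a'" | "a' < a" | "a = a'" by linarith
  then show ?thesis
  proof cases
    case 3
    then show ?thesis by (cases "b \<le> b'") auto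
  qed (use * in blast)+
qed

lemma ex_dominating_line:
  fixes L :: "(int \<times> int) set"
  assumes "finite L" "L \<noteq> {}"
  shows "\<exists>(a, b)\<in>L. \<forall>\<^sub>F k in sequentially. \<forall>(a', b')\<in>L. a' * int k + b' \<le> a * int k + b"
  using assms
proof (induction L rule: finite_ne_induct)
  case (insert x L)
  obtain c d where x: "x = (c, d)" by (cases x)
  obtain a b where ab: "(a, b) \<in> L"
    "\<forall>\<^sub>F k in sequentially. \<forall>(a', b')\<in>L. a' * int k + b' \<le> a * int k + b" using insert.IH by blast
  from eventually_linear_compare[of c d a b] show ?case
  proof
    assume "\<forall>\<^sub>F k in sequentially. c * int k + d \<le> a * int k + b"
    with ab(2) have "\<forall>\<^sub>F k in sequentially. \<forall>(a', b')\<in>insert x L. a' * int k + b' \<le> a * int k + b"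
      by eventually_elim (auto simp: x)
    then show ?thesis using ab(1) by blast
  next
    assume "\<forall>\<^sub>F k in sequentially. a * int k + b \<le> c * int k + d"
    with ab(2) have "\<forall>\<^sub>F k in sequentially. \<forall>(a', b')\<in>insert x L. a' * int k + b' \<le> c * int k + d"
      by eventually_elim (fastforce simp: x)
    then show ?thesis using x by blast
  qed
qed auto

lemma ev_lin_max_union:
  assumes "ev_lin_max X" "ev_lin_max Y"
  shows "ev_lin_max (\<lambda>k. X k \<union> Y k)"
proof -
  obtain L M where L: "finite L" "\<forall>\<^sub>F k in sequentially.
      (\<forall>(a, b)\<in>L. a * int k + b \<in> X k) \<and> (\<forall>y\<in>X k. \<exists>(a, b)\<in>L. y \<le> a * int k + b)"
    and M: "finite M" "\<forall>\<^sub>F k in sequentially.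
      (\<forall>(a, b)\<in>M. a * int k + b \<in> Y k) \<and> (\<forall>y\<in>Y k. \<exists>(a, b)\<in>M. y \<le> a * int k + b)"
    using assms unfolding ev_lin_max_def by blast
  from L(2) M(2) have "\<forall>\<^sub>F k in sequentially. (\<forall>(a, b)\<in>L \<union> M. a * int k + b \<in> X k \<union> Y k) \<and>
      (\<forall>y\<in>X k \<union> Y k. \<exists>(a, b)\<in>L \<union> M. y \<le> a * int k + b)"
    by eventually_elim blast
  then show ?thesis unfolding ev_lin_max_def using L(1) M(1) by blast
qed

lemma ev_lin_max_UN:
  assumes "finite I" "\<And>i. i \<in> I \<Longrightarrow> ev_lin_max (X i)"
  shows "ev_lin_max (\<lambda>k. \<Union>i\<in>I. X i k)"
  using assms
proof (induction I rule: finite_induct)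
  case (insert i I)
  then have "ev_lin_max (\<lambda>k. X i k \<union> (\<Union>i\<in>I. X i k))" by (intro ev_lin_max_union) auto
  then show ?case by simp
qed (simp add: ev_lin_maxI_empty)

lemma ev_lin_max_shift:
  assumes "ev_lin_max X"
  shows "ev_lin_max (\<lambda>k. {x + c | x. k \<ge> k0 \<and> x \<in> X (k - k0)})"
proof -
  obtain L where L: "finite L" "\<forall>\<^sub>F k in sequentially.
      (\<forall>(a, b)\<in>L. a * int k + b \<in> X k) \<and> (\<forall>y\<in>X k. \<exists>(a, b)\<in>L. y \<le> a * int k + b)"
    using assms unfolding ev_lin_max_def by blast
  let ?f = "\<lambda>(a, b). (a, b + c - a * int k0)"
  have "\<forall>\<^sub>F k in sequentially. (\<forall>(a, b)\<in>L. a * int (k - k0) + b \<in> X (k - k0)) \<and>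
      (\<forall>y\<in>X (k - k0). \<exists>(a, b)\<in>L. y \<le> a * int (k - k0) + b)"
    using L(2) filterlim_minus_const_nat_at_top[of k0] by (rule eventually_compose_filterlim)
  then have "\<forall>\<^sub>F k in sequentially.
      (\<forall>(a, b)\<in>?f ` L. a * int k + b \<in> {x + c | x. k \<ge> k0 \<and> x \<in> X (k - k0)}) \<and>
      (\<forall>y\<in>{x + c | x. k \<ge> k0 \<and> x \<in> X (k - k0)}. \<exists>(a, b)\<in>?f ` L. y \<le> a * int k + b)"
    using eventually_ge_at_top[of k0]
  proof eventually_elim
    case (elim k)
    have eq: "a * int k + (b + c - a * int k0) = (a * int (k - k0) + b) + c" for a b
      using elim(2) by (simp add: of_nat_diff algebra_simps)
    show ?case
    proof (intro conjI ballI)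
      fix x assume "x \<in> ?f ` L"
      then obtain a b where ab: "(a, b) \<in> L" "x = (a, b + c - a * int k0)" by auto
      have "a * int (k - k0) + b \<in> X (k - k0)" using conjunct1[OF elim(1)] ab(1) by blast
      then show "case x of (a, b) \<Rightarrow> a * int k + b \<in> {x + c | x. k \<ge> k0 \<and> x \<in> X (k - k0)}"
        unfolding ab(2) prod.case eq using elim(2) by blast
    next
      fix y assume "y \<in> {x + c | x. k \<ge> k0 \<and> x \<in> X (k - k0)}"
      then obtain x where x: "y = x + c" "x \<in> X (k - k0)" by blast
      then obtain a b where ab: "(a, b) \<in> L" "x \<le> a * int (k - k0) + b" using conjunct2[OF elim(1)] by blast
      then have "y \<le> a * int k + (b + c - a * int k0)" unfolding eq x(1) by simp
      then show "\<exists>(a, b)\<in>?f ` L. y \<le> a * int k + b" using ab(1) by force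
    qed
  qed
  then show ?thesis unfolding ev_lin_max_def using L(1) by blast
qed

lemma ev_lin_max_imp_Max:
  assumes "ev_lin_max X" and fin: "\<And>k. finite (X k)" and ne: "\<And>k. X k \<noteq> {}"
  shows "\<exists>a b. \<forall>\<^sub>F k in sequentially. Max (X k) = a * int k + b"
proof -
  obtain L where L: "finite L" "\<forall>\<^sub>F k in sequentially.
      (\<forall>(a, b)\<in>L. a * int k + b \<in> X k) \<and> (\<forall>y\<in>X k. \<exists>(a, b)\<in>L. y \<le> a * int k + b)"
    using assms(1) unfolding ev_lin_max_def by blast
  have "L \<noteq> {}"
    using eventually_happens'[OF sequentially_bot L(2)] ne by blast
  then obtain a b where ab: "(a, b) \<in> L"
    "\<forall>\<^sub>F k in sequentially. \<forall>(a', b')\<in>L. a' * int k + b' \<le> a * int k + b"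
    using ex_dominating_line[OF L(1)] by blast
  from L(2) ab(2) have "\<forall>\<^sub>F k in sequentially. Max (X k) = a * int k + b"
  proof eventually_elim
    case (elim k)
    show ?case
      by (rule Max_eqI[OF fin]) (use elim ab(1) in \<open>force+\<close>)
  qed
  then show ?thesis by blast
qed

section \<open>Linear functionals on order ideals of exponents\<close>

text \<open>Coordinates without a pair in \<open>F\<close> are free; the level can tend to infinity
  only through them.\<close>

definition box :: "('e \<times> nat) set \<Rightarrow> ('e \<Rightarrow> nat) set"
  where "box F = {c. \<forall>(e, u)\<in>F. c e < u}"

definition level_values :: "('e::finite \<Rightarrow> nat) \<Rightarrow> ('e \<Rightarrow> nat) set \<Rightarrow> nat \<Rightarrow> int set"
  where "level_values g C m = {int (\<Sum>e\<in>UNIV. c e * g e) | c. c \<in> C \<and> sum c UNIV = m}"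

lemma ev_lin_max_box:
  fixes g :: "'e::finite \<Rightarrow> nat"
  assumes F: "finite F"
  shows "ev_lin_max (level_values g (box F))"
proof -
  define B where "B = fst ` F"
  define U where "U e = Min {u. (e, u) \<in> F}" for e
  have fin: "finite {u. (e, u) \<in> F}" for e
    by (rule finite_subset[of _ "snd ` F"]) (use F in force)+
  have box: "c \<in> box F \<longleftrightarrow> (\<forall>e\<in>B. c e < U e)" for c
  proof -
    have "(\<forall>e\<in>B. c e < U e) \<longleftrightarrow> (\<forall>e\<in>B. \<forall>u\<in>{u. (e, u) \<in> F}. c e < u)"
      unfolding U_def using fin by (intro ball_cong refl Min_gr_iff) (auto simp: B_def)
    then show ?thesis by (force simp: box_def B_def)
  qed
  consider e where "e \<in> B" "U e = 0" | "B = UNIV" | "\<forall>e\<in>B. U e > 0" "B \<noteq> UNIV" by blast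
  then show ?thesis
  proof cases
    case 1
    then have "c \<notin> box F" for c using box[of c] by (metis not_less0)
    then have "level_values g (box F) m = {}" for m by (simp add: level_values_def)
    then show ?thesis by (simp add: ev_lin_maxI_empty)
  next
    case 2
    have "level_values g (box F) m = {}" if "m \<ge> sum U UNIV" "m > 0" for m
    proof (rule ccontr)
      assume "level_values g (box F) m \<noteq> {}"
      then obtain c where c: "\<forall>e. c e < U e" "sum c UNIV = m" using 2 by (auto simp: level_values_def box)
      then have "sum c UNIV < sum U UNIV" by (intro sum_strict_mono) auto
      then show False using c that by simp
    qed
    then have "\<forall>\<^sub>F m in sequentially. level_values g (box F) m = {}"
      by (intro eventually_sequentiallyI[of "Suc (sum U UNIV)"]) simp
    then show ?thesis by (rule ev_lin_maxI_empty)
  next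
    case 3
    define G where "G = Max (g ` (- B))"
    have "G \<in> g ` (- B)" unfolding G_def using 3(2) by (intro Max_in) auto
    then obtain e0 where e0: "e0 \<notin> B" "g e0 = G" by auto
    have gG: "g e \<le> G" if "e \<notin> B" for e using that by (simp add: G_def)
    \<comment> \<open>The optimum fills the bounded coordinates that pay more than \<open>G\<close>,
      the best free value, and puts the rest of the level on the free coordinate \<open>e0\<close>.
      Hence slope \<open>G\<close>, and \<open>K\<close> is the surplus over it.\<close>
    define h where "h e = (if e \<in> B \<and> g e > G then U e - 1 else 0)" for e
    define K where "K = (\<Sum>e\<in>UNIV. int (h e) * (int (g e) - int G))"
    have val: "int (\<Sum>e\<in>UNIV. c e * g e) = int G * int m + (\<Sum>e\<in>UNIV. int (c e) * (int (g e) - int G))"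
      if "sum c UNIV = m" for c m
    proof -
      have "int G * int m = (\<Sum>e\<in>UNIV. int (c e) * int G)"
        unfolding that[symmetric] by (simp add: sum_distrib_left mult.commute)
      then show ?thesis by (simp add: right_diff_distrib sum_subtractf)
    qed
    have "int G * int m + K \<in> level_values g (box F) m \<and>
        (\<forall>y\<in>level_values g (box F) m. y \<le> int G * int m + K)" if m: "m \<ge> sum h UNIV" for m
    proof
      define c where "c e = h e + (if e = e0 then m - sum h UNIV else 0)" for e
      have c: "sum c UNIV = m" using m by (simp add: c_def sum.distrib)
      have "c \<in> box F" using e0 3(1) by (auto simp: box c_def h_def)
      moreover have "(\<Sum>e\<in>UNIV. int (c e) * (int (g e) - int G)) = K"
        unfolding K_def by (intro sum.cong) (auto simp: c_def e0)
      ultimately show "int G * int m + K \<in> level_values g (box F) m"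
        unfolding level_values_def using c val[OF c] by (intro CollectI exI[of _ c]) simp
      show "\<forall>y\<in>level_values g (box F) m. y \<le> int G * int m + K"
      proof
        fix y assume "y \<in> level_values g (box F) m"
        then obtain c where c: "y = int (\<Sum>e\<in>UNIV. c e * g e)" "c \<in> box F" "sum c UNIV = m"
          by (auto simp: level_values_def)
        have "int (c e) * (int (g e) - int G) \<le> int (h e) * (int (g e) - int G)" for e
        proof (cases "e \<in> B \<and> g e > G")
          case True
          then have "c e \<le> h e" using c(2) by (fastforce simp: box h_def)
          then show ?thesis using True by (intro mult_right_mono) auto
        next
          case False
          then have "g e \<le> G" using gG[of e] by auto
          then show ?thesis using False by (simp add: h_def mult_nonneg_nonpos)
        qed
        then have "(\<Sum>e\<in>UNIV. int (c e) * (int (g e) - int G)) \<le> K" unfolding K_def by (intro sum_mono)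
        then show "y \<le> int G * int m + K" unfolding c(1) val[OF c(3)] by simp
      qed
    qed
    then have "\<forall>\<^sub>F m in sequentially. int G * int m + K \<in> level_values g (box F) m \<and>
        (\<forall>y\<in>level_values g (box F) m. y \<le> int G * int m + K)"
      by (intro eventually_sequentiallyI)
    then show ?thesis by (rule ev_lin_maxI_line)
  qed
qed

text \<open>The complement is generated by finitely many \<open>t\<close>. Avoiding \<open>t\<close>
  means being smaller in some coordinate, and choosing one coordinate for each \<open>t\<close>
  gives a box.\<close>

lemma down_closed_union_boxes:
  fixes C :: "('e::finite \<Rightarrow> nat) set"
  assumes C: "\<And>c c'. c' \<in> C \<Longrightarrow> c \<le> c' \<Longrightarrow> c \<in> C"
  shows "\<exists>I. finite I \<and> (\<forall>F\<in>I. finite F) \<and> C = (\<Union>F\<in>I. box F)"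
proof -
  obtain G where G: "finite G" "G \<subseteq> - C" "\<forall>s\<in>-C. \<exists>t\<in>G. t \<le> s"
    using dickson[of "- C"] by blast
  have inC: "c \<in> C \<longleftrightarrow> (\<forall>t\<in>G. \<exists>e. c e < t e)" for c
  proof
    assume c: "c \<in> C"
    show "\<forall>t\<in>G. \<exists>e. c e < t e"
    proof (rule ballI, rule ccontr)
      fix t assume "t \<in> G" "\<not> (\<exists>e. c e < t e)"
      then have "t \<le> c" by (auto simp: le_fun_def not_less)
      then show False using C[OF c] G(2) \<open>t \<in> G\<close> by blast
    qed
  next
    assume "\<forall>t\<in>G. \<exists>e. c e < t e"
    then have "\<not> (\<exists>t\<in>G. t \<le> c)" by (auto simp: le_fun_def not_le)
    then show "c \<in> C" using G(3) by blast
  qed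
  define P where "P = (\<Union>t\<in>G. (\<lambda>e. (e, t e)) ` UNIV)"
  have P: "finite P" using G(1) by (simp add: P_def)
  define I where "I = {F. F \<subseteq> P \<and> box F \<subseteq> C}"
  have "c \<in> (\<Union>F\<in>I. box F)" if c: "c \<in> C" for c
  proof -
    define F where "F = {(e, u) \<in> P. c e < u}"
    have "box F \<subseteq> C"
    proof
      fix c' assume c': "c' \<in> box F"
      show "c' \<in> C"
        unfolding inC
      proof
        fix t assume t: "t \<in> G"
        then obtain e where "c e < t e" using c inC by blast
        then have "(e, t e) \<in> F" using t by (auto simp: F_def P_def)
        then show "\<exists>e. c' e < t e" using c' by (auto simp: box_def)
      qed
    qed
    then have "F \<in> I" by (auto simp: I_def F_def)
    moreover have "c \<in> box F" by (auto simp: box_def F_def)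
    ultimately show ?thesis by blast
  qed
  then have "C = (\<Union>F\<in>I. box F)" by (auto simp: I_def)
  moreover have "finite I" "\<forall>F\<in>I. finite F" using P by (auto simp: I_def intro: finite_subset)
  ultimately show ?thesis by blast
qed

lemma ev_lin_max_down_closed:
  fixes C :: "('e::finite \<Rightarrow> nat) set"
  assumes C: "\<And>c c'. c' \<in> C \<Longrightarrow> c \<le> c' \<Longrightarrow> c \<in> C"
  shows "ev_lin_max (level_values g C)"
proof -
  have "\<exists>I. finite I \<and> (\<forall>F\<in>I. finite F) \<and> C = (\<Union>F\<in>I. box F)"
    by (rule down_closed_union_boxes) (rule C)
  then obtain I where I: "finite I" "\<forall>F\<in>I. finite F" "C = (\<Union>F\<in>I. box F)" by blast
  have "level_values g C m = (\<Union>F\<in>I. level_values g (box F) m)" for m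
    unfolding I(3) by (auto simp: level_values_def)
  then have "level_values g C = (\<lambda>m. \<Union>F\<in>I. level_values g (box F) m)" by blast
  then show ?thesis using I(1,2) by (simp add: ev_lin_max_UN ev_lin_max_box)
qed

section \<open>Regularity of powers of edge ideals is eventually linear\<close>

definition gsum :: "('v::finite \<Rightarrow> nat) \<Rightarrow> ('v \<times> 'v \<Rightarrow> nat) \<Rightarrow> ('v \<Rightarrow>\<^sub>0 nat)"
  where "gsum w c = expo (\<lambda>v. \<Sum>e\<in>UNIV. c e * lookup (edge_expo w e) v)"

lemma gsum_add: "gsum w (\<lambda>e. c e + c' e) = gsum w c + gsum w c'"
  by (intro poly_mapping_eqI) (simp add: gsum_def lookup_add distrib_right sum.distrib)

lemma gsum_single: "gsum w (\<lambda>x. if x = e then 1 else 0) = edge_expo w e"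
  by (intro poly_mapping_eqI) (simp add: gsum_def if_distrib[of "\<lambda>x. x * _"] cong: if_cong)

lemma monom_degree_gsum: "monom_degree (gsum w c) = (\<Sum>e\<in>UNIV. c e * monom_degree (edge_expo w e))"
  by (simp add: gsum_def monom_degree_def sum_distrib_left) (rule sum.swap)

lemma sum_nat_Suc_decompose:
  fixes c :: "'e::finite \<Rightarrow> nat"
  assumes "sum c UNIV = Suc k"
  obtains e c' where "c e > 0" "c = (\<lambda>x. c' x + (if x = e then 1 else 0))" "sum c' UNIV = k"
proof -
  have "\<exists>e. c e > 0" using assms by (metis gr0I nat.simps(3) sum.neutral)
  then obtain e where e: "c e > 0" ..
  define c' where "c' x = c x - (if x = e then 1 else 0)" for x
  have c: "c = (\<lambda>x. c' x + (if x = e then 1 else 0))" using e by (auto simp: c'_def fun_eq_iff)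
  have "sum c UNIV = sum c' UNIV + 1" by (subst c) (simp add: sum.distrib)
  then show thesis using that[OF e c] assms by simp
qed

lemma subset_uphull: "g \<in> G \<Longrightarrow> g \<in> uphull G"
  unfolding uphull_def using dvds_refl by blast

lemma pow_expo_add_gsum:
  assumes "\<And>e. c e \<noteq> 0 \<Longrightarrow> e \<in> E" "t \<in> pow_expo E w k"
  shows "gsum w c + t \<in> pow_expo E w (k + sum c UNIV)"
  using assms(1)
proof (induction "sum c UNIV" arbitrary: c)
  case 0
  then have "c = (\<lambda>_. 0)" by auto
  then have "gsum w c = 0" by (intro poly_mapping_eqI) (simp add: gsum_def)
  then show ?case unfolding 0(1)[symmetric] using assms(2) by simp
next
  case (Suc m)
  obtain e c' where e: "c e > 0" "c = (\<lambda>x. c' x + (if x = e then 1 else 0))" "sum c' UNIV = m"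
    using sum_nat_Suc_decompose[of c m] Suc.hyps(2) by metis
  have "c' x \<noteq> 0 \<Longrightarrow> x \<in> E" for x using Suc.prems[of x] e(2) by simp
  then have "gsum w c' + t \<in> pow_expo E w (k + m)" using Suc.hyps(1)[of c'] e(3) by simp
  moreover have "edge_expo w e \<in> uphull (edge_expo w ` E)"
    using Suc.prems[of e] e(1) by (intro subset_uphull imageI) simp
  moreover have "gsum w c + t = edge_expo w e + (gsum w c' + t)"
    by (subst e(2)) (simp add: gsum_add gsum_single ac_simps)
  ultimately show ?case unfolding Suc.hyps(2)[symmetric] by (auto simp: setadd_def)
qed

lemma pow_expo_imp_gsum:
  "t \<in> pow_expo E w k \<Longrightarrow> \<exists>c d. (\<forall>e. c e \<noteq> 0 \<longrightarrow> e \<in> E) \<and> sum c UNIV = k \<and> t = gsum w c + expo d"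
proof (induction k arbitrary: t)
  case 0
  have "t = gsum w (\<lambda>_. 0) + expo (lookup t)"
    by (intro poly_mapping_eqI) (simp add: gsum_def lookup_add)
  then show ?case by (intro exI[of _ "\<lambda>_. 0"] exI[of _ "lookup t"]) simp
next
  case (Suc k)
  then obtain s t' where st: "s \<in> uphull (edge_expo w ` E)" "t' \<in> pow_expo E w k" "t = s + t'"
    by (auto simp: setadd_def)
  obtain e where e: "e \<in> E" "dvds (edge_expo w e) s" using st(1) by (auto simp: uphull_def)
  obtain c d where c: "\<forall>e. c e \<noteq> 0 \<longrightarrow> e \<in> E" "sum c UNIV = k" "t' = gsum w c + expo d"
    using Suc.IH[OF st(2)] by blast
  let ?c = "\<lambda>x. c x + (if x = e then 1 else 0)"
  let ?d = "\<lambda>v. lookup (s - edge_expo w e) v + d v"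
  have "t = gsum w ?c + expo ?d"
  proof -
    have "expo ?d = (s - edge_expo w e) + expo d" by (intro poly_mapping_eqI) (simp add: lookup_add)
    then have "gsum w ?c + expo ?d = (s - edge_expo w e + edge_expo w e) + (gsum w c + expo d)"
      unfolding gsum_add gsum_single by (simp only: ac_simps)
    then show ?thesis using dvds_imp_eq_add[OF e(2)] st(3) c(3) by simp
  qed
  moreover have "sum ?c UNIV = Suc k" using c(2) by (simp add: sum.distrib)
  moreover have "\<forall>x. ?c x \<noteq> 0 \<longrightarrow> x \<in> E" using c(1) e(1) by auto
  ultimately show ?case by (intro exI[of _ ?c] exI[of _ ?d] conjI)
qed

lemma kcx_subset_add:
  assumes "\<And>t. t \<in> T \<Longrightarrow> s + t \<in> T'"
  shows "kcx T a \<subseteq> kcx T' (s + a)"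
proof
  fix A assume "A \<in> kcx T a"
  then have A: "dvds (ind A) a" "a - ind A \<in> T" by (auto simp: kcx_def)
  have "s + a - ind A = s + (a - ind A)"
    using A(1) by (intro poly_mapping_eqI) (simp add: lookup_add lookup_minus dvds_def)
  moreover have "dvds (ind A) (s + a)" using dvds_trans[OF A(1) dvds_add(2)] .
  ultimately show "A \<in> kcx T' (s + a)" using assms[OF A(2)] by (simp add: kcx_def)
qed

text \<open>Multiplying by a variable makes room for it as an apex over all old faces; this is what
  forces cones in \<open>wcx_same_offset\<close>.\<close>

lemma kcx_insert_add:
  assumes "A \<in> kcx T a" "up_closed T"
  shows "insert v A \<in> kcx T (monomial v 1 + a)"
proof (cases "v \<in> A")
  case True
  then show ?thesis
    using assms(1) kcx_subset_add[of T "monomial v 1" T a] up_closed_add[OF assms(2)]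
    by (auto simp: insert_absorb)
next
  case False
  have A: "dvds (ind A) a" "a - ind A \<in> T" using assms(1) by (auto simp: kcx_def)
  have "monomial v 1 + a - ind (insert v A) = a - ind A"
    using False by (simp add: ind_insert)
  moreover have "dvds (ind (insert v A)) (monomial v 1 + a)"
    using A(1) unfolding ind_insert[OF False] dvds_def lookup_add by (simp del: lookup_ind)
  ultimately show ?thesis using A(2) by (simp add: kcx_def)
qed

text \<open>Coordinates on the Rees algebra: \<open>c\<close> counts the generators used and so
  carries the level, while \<open>d\<close> is a monomial factor that leaves the level
  unchanged.\<close>

definition wcx :: "('v::finite \<times> 'v) set \<Rightarrow> ('v \<Rightarrow> nat) \<Rightarrow> ('v \<times> 'v \<Rightarrow> nat) \<Rightarrow> ('v \<Rightarrow> nat) \<Rightarrow> 'v set set"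
  where "wcx E w c d = kcx (pow_expo E w (sum c UNIV)) (gsum w c + expo d)"

lemma wcx_mono:
  assumes "c \<le> c'" "d \<le> d'" "\<And>e. c' e \<noteq> 0 \<Longrightarrow> e \<in> E"
  shows "wcx E w c d \<subseteq> wcx E w c' d'"
proof -
  define c'' where "c'' e = c' e - c e" for e
  define s where "s = gsum w c'' + expo (\<lambda>v. d' v - d v)"
  have c': "c' = (\<lambda>e. c'' e + c e)" using assms(1) by (auto simp: c''_def le_fun_def)
  have "expo d' = expo (\<lambda>v. d' v - d v) + expo d"
    using assms(2) by (intro poly_mapping_eqI) (simp add: lookup_add le_fun_def)
  then have eq: "gsum w c' + expo d' = s + (gsum w c + expo d)"
    unfolding s_def c' gsum_add by (simp only: ac_simps)
  have sum: "sum c' UNIV = sum c UNIV + sum c'' UNIV" by (simp add: c' sum.distrib)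
  show ?thesis
    unfolding wcx_def eq sum
  proof (rule kcx_subset_add)
    fix t assume t: "t \<in> pow_expo E w (sum c UNIV)"
    have "c'' e \<noteq> 0 \<Longrightarrow> e \<in> E" for e using assms(3)[of e] by (simp add: c''_def)
    then have "gsum w c'' + t \<in> pow_expo E w (sum c UNIV + sum c'' UNIV)"
      using pow_expo_add_gsum t by blast
    from up_closed_add[OF up_closed_pow_expo this, of "expo (\<lambda>v. d' v - d v)"]
    show "s + t \<in> pow_expo E w (sum c UNIV + sum c'' UNIV)" by (simp add: s_def ac_simps)
  qed
qed

text \<open>Multiplying by a variable inside the stratum of multidegrees with a given complex \<open>D\<close> would
  make \<open>D\<close> a cone. Hence the stratum of a complex that is not a cone is finitely generated under
  multiplication by the generators of the ideal alone.\<close>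

lemma wcx_same_offset:
  assumes "c \<le> c'" "d \<le> d'" "\<And>e. c' e \<noteq> 0 \<Longrightarrow> e \<in> E"
    and D: "wcx E w c d = D" "wcx E w c' d' = D" and nc: "\<And>v. \<exists>A\<in>D. insert v A \<notin> D"
  shows "d = d'"
proof (rule ccontr)
  assume "d \<noteq> d'"
  then obtain v where v: "d v < d' v" using assms(2) by (metis le_funD le_neq_implies_less ext)
  define d'' where "d'' u = d' u - (if u = v then 1 else 0)" for u
  have "d \<le> d''" using assms(2) v by (auto simp: d''_def le_fun_def)
  then have sub: "D \<subseteq> wcx E w c' d''" using wcx_mono[of c c' d d''] assms by blast
  have d': "gsum w c' + expo d' = monomial v 1 + (gsum w c' + expo d'')"
    using v by (intro poly_mapping_eqI) (auto simp: lookup_add lookup_single when_def d''_def)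
  have "insert v A \<in> D" if "A \<in> D" for A
    using kcx_insert_add[OF _ up_closed_pow_expo, of A E w "sum c' UNIV" "gsum w c' + expo d''" v] sub that
    unfolding D(2)[symmetric] wcx_def[of E w c' d'] d' by (auto simp: wcx_def)
  then show False using nc[of v] by blast
qed

text \<open>Dickson's lemma is applied to generator and variable exponents jointly, over a sum type.
  A monomial may have several representations, but each determines its degree and level, so overlaps
  do no harm.\<close>

lemma ev_lin_max_stratum:
  fixes E :: "('v::finite \<times> 'v) set"
  assumes nc: "\<And>v. \<exists>A\<in>D. insert v A \<notin> D"
  shows "ev_lin_max (\<lambda>k. {int (monom_degree a) | a. kcx (pow_expo E w k) a = D})"
proof -
  define S where "S = {x :: ('v \<times> 'v) + 'v \<Rightarrow> nat. (\<forall>e. x (Inl e) \<noteq> 0 \<longrightarrow> e \<in> E) \<and>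
    wcx E w (\<lambda>e. x (Inl e)) (\<lambda>v. x (Inr v)) = D}"
  obtain F where F: "finite F" "F \<subseteq> S" "\<forall>x\<in>S. \<exists>f\<in>F. f \<le> x" using dickson[of S] by blast
  define C where "C f = {c. (\<forall>e. c e \<noteq> 0 \<longrightarrow> e \<in> E) \<and>
    wcx E w (\<lambda>e. f (Inl e) + c e) (\<lambda>v. f (Inr v)) = D}" for f :: "('v \<times> 'v) + 'v \<Rightarrow> nat"
  define g where "g e = monom_degree (edge_expo w e)" for e
  define con where "con f = (\<Sum>e\<in>UNIV. f (Inl e) * g e) + (\<Sum>v\<in>UNIV. f (Inr v))" for f :: "('v \<times> 'v) + 'v \<Rightarrow> nat"
  define lv where "lv f = (\<Sum>e\<in>UNIV. f (Inl e))" for f :: "('v \<times> 'v) + 'v \<Rightarrow> nat"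
  have eq: "{int (monom_degree a) | a. kcx (pow_expo E w k) a = D} =
    (\<Union>f\<in>F. {x + int (con f) | x. k \<ge> lv f \<and> x \<in> level_values g (C f) (k - lv f)})" for k
  proof (intro Set.set_eqI iffI)
    fix y assume "y \<in> {int (monom_degree a) | a. kcx (pow_expo E w k) a = D}"
    then obtain a where a: "y = int (monom_degree a)" "kcx (pow_expo E w k) a = D" by blast
    \<comment> \<open>A complex that is not a cone has a face, so \<open>a\<close> lies in the power
      and can be written with generators.\<close>
    obtain A where "A \<in> D" using nc by blast
    then have "a - ind A \<in> pow_expo E w k" using a(2) by (auto simp: kcx_def)
    then have "a \<in> pow_expo E w k"
      by (rule up_closedD[OF up_closed_pow_expo]) (simp add: dvds_def lookup_minus)
    then obtain c d where cd: "\<forall>e. c e \<noteq> 0 \<longrightarrow> e \<in> E" "sum c UNIV = k" "a = gsum w c + expo d"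
      using pow_expo_imp_gsum by blast
    have D: "wcx E w c d = D" using a(2) cd by (simp add: wcx_def)
    define x where "x = case_sum c d"
    have "x \<in> S" using cd(1) D by (simp add: S_def x_def)
    then obtain f where f: "f \<in> F" "f \<le> x" using F(3) by blast
    have fS: "f \<in> S" using f F(2) by blast
    have fc: "(\<lambda>e. f (Inl e)) \<le> c"
    proof (rule le_funI)
      fix e show "f (Inl e) \<le> c e" using le_funD[OF f(2), of "Inl e"] by (simp add: x_def)
    qed
    have fd: "(\<lambda>v. f (Inr v)) \<le> d"
    proof (rule le_funI)
      fix v show "f (Inr v) \<le> d v" using le_funD[OF f(2), of "Inr v"] by (simp add: x_def)
    qed
    \<comment> \<open>Within the stratum only the generator part can grow above a minimal pair, so
      the translates are indexed by \<open>c\<close> alone.\<close>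
    have d: "(\<lambda>v. f (Inr v)) = d"
      by (rule wcx_same_offset[OF fc fd _ _ D nc]) (use cd(1) fS in \<open>auto simp: S_def\<close>)
    define c' where "c' e = c e - f (Inl e)" for e
    have c: "c = (\<lambda>e. f (Inl e) + c' e)" using fc by (auto simp: c'_def le_fun_def)
    have "c' \<in> C f"
      unfolding C_def mem_Collect_eq c[symmetric] d using cd(1) D by (simp add: c'_def)
    moreover have sc: "sum c UNIV = lv f + sum c' UNIV" by (subst c) (simp add: lv_def sum.distrib)
    moreover have "monom_degree a = (\<Sum>e\<in>UNIV. c' e * g e) + con f"
    proof -
      have "monom_degree a = (\<Sum>e\<in>UNIV. c e * g e) + sum d UNIV"
        unfolding cd(3) by (simp add: monom_degree_add monom_degree_gsum g_def)
      also have "(\<Sum>e\<in>UNIV. c e * g e) = (\<Sum>e\<in>UNIV. f (Inl e) * g e) + (\<Sum>e\<in>UNIV. c' e * g e)"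
        by (subst c) (simp add: distrib_right sum.distrib)
      finally show ?thesis unfolding con_def d[symmetric] by simp
    qed
    ultimately have "y = int (\<Sum>e\<in>UNIV. c' e * g e) + int (con f) \<and> k \<ge> lv f \<and>
      int (\<Sum>e\<in>UNIV. c' e * g e) \<in> level_values g (C f) (k - lv f)"
      using a(1) cd(2) by (auto simp: level_values_def)
    then show "y \<in> (\<Union>f\<in>F. {x + int (con f) | x. k \<ge> lv f \<and> x \<in> level_values g (C f) (k - lv f)})"
      using f(1) by blast
  next
    fix y assume "y \<in> (\<Union>f\<in>F. {x + int (con f) | x. k \<ge> lv f \<and> x \<in> level_values g (C f) (k - lv f)})"
    then obtain f c where f: "f \<in> F" "k \<ge> lv f" "c \<in> C f" "sum c UNIV = k - lv f"
      "y = int (\<Sum>e\<in>UNIV. c e * g e) + int (con f)" by (auto simp: level_values_def)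
    let ?c = "\<lambda>e. f (Inl e) + c e"
    define a where "a = gsum w ?c + expo (\<lambda>v. f (Inr v))"
    have "sum ?c UNIV = k" using f(2,4) by (simp add: sum.distrib lv_def)
    then have "kcx (pow_expo E w k) a = D" using f(3) by (simp add: C_def wcx_def a_def)
    moreover have "y = int (monom_degree a)"
      unfolding a_def f(5) con_def
      by (simp add: monom_degree_add monom_degree_gsum gsum_add g_def)
    ultimately show "y \<in> {int (monom_degree a) | a. kcx (pow_expo E w k) a = D}" by blast
  qed
  \<comment> \<open>The complex at an intermediate \<open>c\<close> is squeezed between two copies
    of \<open>D\<close>.\<close>
  have down: "c \<in> C f" if f: "f \<in> F" and c': "c' \<in> C f" "c \<le> c'" for f c c'
  proof -
    have fS: "f \<in> S" using f F(2) by blast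
    have "\<forall>e. c' e \<noteq> 0 \<longrightarrow> e \<in> E" using c'(1) by (simp add: C_def)
    moreover have "c e \<noteq> 0 \<Longrightarrow> c' e \<noteq> 0" for e using le_funD[OF c'(2), of e] by simp
    ultimately have suppc: "c e \<noteq> 0 \<Longrightarrow> e \<in> E" for e by blast
    have "wcx E w (\<lambda>e. f (Inl e)) (\<lambda>v. f (Inr v)) \<subseteq> wcx E w (\<lambda>e. f (Inl e) + c e) (\<lambda>v. f (Inr v))"
      by (rule wcx_mono) (use fS suppc in \<open>auto simp: le_fun_def S_def\<close>)
    moreover have "wcx E w (\<lambda>e. f (Inl e) + c e) (\<lambda>v. f (Inr v)) \<subseteq> wcx E w (\<lambda>e. f (Inl e) + c' e) (\<lambda>v. f (Inr v))"
      by (rule wcx_mono) (use fS c' in \<open>auto simp: le_fun_def S_def C_def\<close>)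
    ultimately show ?thesis using fS c' suppc by (auto simp: S_def C_def)
  qed
  show ?thesis
    unfolding eq using F(1) down
    by (intro ev_lin_max_UN ev_lin_max_shift ev_lin_max_down_closed) blast+
qed

lemma pow_expo_nonempty: "E \<noteq> {} \<Longrightarrow> pow_expo E w k \<noteq> {}"
proof (induction k)
  case (Suc k)
  then obtain e t where "e \<in> E" "t \<in> pow_expo E w k" by blast
  moreover from this have "edge_expo w e \<in> uphull (edge_expo w ` E)"
    by (intro subset_uphull imageI)
  ultimately have "edge_expo w e + t \<in> pow_expo E w (Suc k)" by (auto simp: setadd_def)
  then show ?case by blast
qed simp

text \<open>At a monomial of least degree the only face is the empty one. This keeps the set whose
  maximum is taken nonempty.\<close>

lemma khom_minimal_degree:
  assumes "T \<noteq> {}"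
  shows "\<exists>a. khom TYPE('k::field) (kcx T a) 0"
proof -
  obtain t where "t \<in> T" using assms by blast
  then obtain a where a: "a \<in> T" "\<And>t. t \<in> T \<Longrightarrow> monom_degree a \<le> monom_degree t"
    using ex_has_least_nat[of "\<lambda>t. t \<in> T" t monom_degree] by blast
  have "kcx T a = {{}}"
  proof (intro Set.set_eqI iffI)
    fix A assume "A \<in> kcx T a"
    then have "dvds (ind A) a" "a - ind A \<in> T" by (auto simp: kcx_def)
    then have "card A = 0" using a(2)[of "a - ind A"] monom_degree_minus[of "ind A" a] by simp
    then show "A \<in> {{}}" by simp
  qed (use a(1) in \<open>simp add: kcx_def\<close>)
  then show ?thesis using khom_singleton_empty[where 'k = 'k] by metis
qed

theorem regularity_pow_eventually_linear:
  fixes E :: "('v::finite \<times> 'v) set"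
  assumes "E \<noteq> {}"
  shows "\<exists>a b. \<forall>\<^sub>F k in sequentially.
    regularity (mon (pow_expo E w k) :: ('v, 'k::field) poly_ring set) = a * int k + b"
proof -
  define R where "R k = {int (monom_degree a) - int p | a p. khom TYPE('k) (kcx (pow_expo E w k) a) p}" for k
  define I where "I = {(D :: 'v set set, p). khom TYPE('k) D p}"
  have "finite I"
    by (rule finite_subset[of _ "UNIV \<times> {..card (UNIV :: 'v set)}"]) (auto simp: I_def dest: khom_card_le)
  \<comment> \<open>There are finitely many pairs of a complex and a homological degree. The trivial
    \<open>k - 0\<close> gives each piece the exact form of \<open>ev_lin_max_shift\<close>, with
    the homological degree as constant.\<close>
  have R: "R k = (\<Union>x\<in>I. {y + (- int (snd x)) | y. k \<ge> 0 \<and>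
      y \<in> {int (monom_degree a) | a. kcx (pow_expo E w (k - 0)) a = fst x}})" for k
  proof (intro Set.set_eqI iffI)
    fix y assume "y \<in> R k"
    then obtain a p where "y = int (monom_degree a) - int p" "khom TYPE('k) (kcx (pow_expo E w k) a) p"
      by (auto simp: R_def)
    then show "y \<in> (\<Union>x\<in>I. {y + (- int (snd x)) | y. k \<ge> 0 \<and>
      y \<in> {int (monom_degree a) | a. kcx (pow_expo E w (k - 0)) a = fst x}})"
      by (intro UN_I[of "(kcx (pow_expo E w k) a, p)"]) (auto simp: I_def)
  next
    fix y assume "y \<in> (\<Union>x\<in>I. {y + (- int (snd x)) | y. k \<ge> 0 \<and>
      y \<in> {int (monom_degree a) | a. kcx (pow_expo E w (k - 0)) a = fst x}})"
    then obtain a p where "khom TYPE('k) (kcx (pow_expo E w k) a) p" "y = int (monom_degree a) - int p"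
      by (auto simp: I_def)
    then show "y \<in> R k" by (auto simp: R_def)
  qed
  have "ev_lin_max R"
    unfolding R[abs_def]
  proof (intro ev_lin_max_UN \<open>finite I\<close> ev_lin_max_shift ev_lin_max_stratum)
    fix x v assume "x \<in> I"
    then have "khom TYPE('k) (fst x) (snd x)" by (auto simp: I_def)
    then show "\<exists>A\<in>fst x. insert v A \<notin> fst x"
      using not_khom_cone[of "fst x" v "snd x", where 'k = 'k] by blast
  qed
  moreover have "finite (R k)" for k
    unfolding R_def by (rule regularity_mon(2)[OF up_closed_pow_expo])
  moreover have "R k \<noteq> {}" for k
    using khom_minimal_degree[OF pow_expo_nonempty[OF assms], of w k, where 'k = 'k] by (auto simp: R_def)
  ultimately have "\<exists>a b. \<forall>\<^sub>F k in sequentially. Max (R k) = a * int k + b" by (rule ev_lin_max_imp_Max)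
  then show ?thesis unfolding regularity_mon(1)[OF up_closed_pow_expo] R_def .
qed

theorem corollary5p8:
  fixes E :: "('v::finite \<times> 'v) set"
    and w :: "'v \<Rightarrow> nat"
    and I :: "('v, 'k::field) poly_ring set"
    and \<omega> :: nat
  assumes "card (UNIV :: 'v set) \<ge> 2"
    and "weighted_oriented_complete_graph E w"
  defines "I \<equiv> edge_ideal E w"
    and "\<omega> \<equiv> Max (range w)"
  shows "(\<exists>a b :: int. \<forall>\<^sub>F k in sequentially.
            regularity (symbolic_power I k) = a * int k + b) \<and>
         (out_nbhd_set E (V_plus w) \<noteq> UNIV \<longrightarrow>
           (\<forall>\<^sub>F k in sequentially.
              regularity (symbolic_power I k) =
                (int \<omega> + 1) * (int k - 1)
                + Max {\<Sum>x\<in>out_nbhd E i \<inter> closed_out_nbhd E l. int (w x) - 1 | i l.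
                       (i, l) \<in> E \<and> w l = \<omega>}
                + 2))"
proof -
  interpret complete_wog E w using assms(2) by unfold_locales
  define M where "M = Max {\<Sum>x\<in>out_nbhd E i \<inter> closed_out_nbhd E l. int (w x) - 1 | i l. (i, l) \<in> E \<and> w l = \<omega>}"
  have om: "\<omega> = omega" by (simp add: \<omega>_def omega_def)
  have "int (esum i l) = (\<Sum>x\<in>out_nbhd E i \<inter> closed_out_nbhd E l. int (w x) - 1)" for i l
    using w_pos by (simp add: esum_def of_nat_diff)
  then have M: "M = Max {int (esum i l) | i l. (i, l) \<in> E \<and> w l = omega}" by (simp add: M_def om)
  show ?thesis
  proof (cases "out_nbhd_set E (V_plus w) = UNIV")
    case True
    have "E \<noteq> {}" using ex_edge_omega[OF assms(1)] by blast
    then show ?thesis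
      using regularity_pow_eventually_linear[of E w, where 'k = 'k] True
      unfolding I_def symbolic_power_eq_power[OF True] by simp
  next
    case False
    have "\<forall>\<^sub>F k in sequentially. regularity (symbolic_power I k) = (int \<omega> + 1) * (int k - 1) + M + 2"
    proof (rule eventually_sequentiallyI)
      fix k assume "k \<ge> omega + 1 + total_excess"
      then show "regularity (symbolic_power I k) = (int \<omega> + 1) * (int k - 1) + M + 2"
        using regularity_lev_all[OF assms(1), of k, where 'k = 'k]
        unfolding I_def symbolic_power_eq_lev[OF False] lev_all_def M om by simp
    qed
    \<comment> \<open>Expanding the formula also settles the first claim, with slope \<omega> +
      1.\<close>
    moreover from this have "\<forall>\<^sub>F k in sequentially.
        regularity (symbolic_power I k) = (int \<omega> + 1) * int k + (M + 1 - int \<omega>)"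
      by eventually_elim (simp add: algebra_simps)
    ultimately show ?thesis unfolding M_def by blast
  qed
qed

end
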